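(* The phase space $\mathcal{M}$ (the space of three-dimensional, nonabelian, unimodular metric Lie algebras modulo isometry and scaling) is the disjoint union of the following sets, each of which is invariant under the Ricci flow dynamics $\phi_t$ on $\mathcal{M}$: (a) four points $p_1,p_2,p_3,p_4$; (b) six one-dimensional trajectories (orbits) $T_{1,2},T_{1,3},T_{1,3}',T_{1,4},T_{2,3},T_{3,4}$; (c) three connected two-dimensional open sets $B_{1,4},B_{1,3},B_{1,3}'$; (all given explicitly in the context) such that (i) the points $p_1,p_2,p_3,p_4$ are fixed by $\phi_t$; (ii) every point $p$ in a trajectory $T_{i,j}$ or $T_{i,j}'$ satisfies $\lim_{t\to-\infty}\phi_t(p)=p_i$ and $\lim_{t\to\infty}\phi_t(p)=p_j$; (iii) every point $p$ in a set $B_{i,j}$ or $B_{i,j}'$ satisfies $\lim_{t\to-\infty}\phi_t(p)=p_i$ and $\lim_{t\to\infty}\phi_t(p)=p_j$.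
   Context: A metric Lie algebra $(\mathfrak g,\mathsf Q)$ is a real Lie algebra $\mathfrak g$ with an inner product $\mathsf Q$; it is unimodular if $\operatorname{tr}\operatorname{ad}_X=0$ for all $X\in\mathfrak g$. It corresponds to a simply-connected Lie group $G$ with Lie algebra $\mathfrak g$ and left-invariant Riemannian metric $g$ induced by $\mathsf Q$. Two metric Lie algebras are equivalent up to isometry and scaling if there are a diffeomorphism $\phi:G\to G'$ and $c>0$ with $g=c\,\phi^*g'$. $\mathcal M$ is the set of equivalence classes of three-dimensional, nonabelian, unimodular metric Lie algebras. Every three-dimensional unimodular metric Lie algebra has an orthonormal basis $\{e_1,e_2,e_3\}$ with $[e_2,e_3]=a_1e_1$, $[e_3,e_1]=a_2e_2$, $[e_1,e_2]=a_3e_3$ for some real $a_1,a_2,a_3$ (Milnor). Two nonzero triples $(a_1,a_2,a_3)$ represent the same element of $\mathcal M$ iff they differ by a nonzero scalar and a permutation, so $\mathcal M$ is identified with $\mathbb{RP}^2/S_3$. Equivalently, let $\mathcal S_m=\{(m_2,m_3)\in\mathbb R^2: 0\le m_2\le 1,\ m_3\le m_2\}$, let $\bar{\mathcal S}_m=\mathcal S_m\cup\{\infty\}$ be its one-point compactification, and let $\sim$ be the equivalence relation on $\bar{\mathcal S}_m$ generated by $(0,m_3)\sim(0,1/m_3)$ for $m_3\ne0$ and $\infty\sim(0,0)$. Then $\mathcal M$ is identified with $\bar{\mathcal S}_m/\!\sim$, where $(m_2,m_3)$ is the class with structure constants $(a_1,a_2,a_3)=(1,m_2,m_3)$ and $\infty$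 is the class of $(1,0,0)$. $\mathcal M$ carries the quotient topology from $\bar{\mathcal S}_m/\!\sim$. The Ricci flow $\partial g/\partial t=-2\operatorname{Rc}(g)$ preserves left-invariance and, with respect to an evolving orthonormal frame $\{e_1(t),e_2(t),e_3(t)\}$ which keeps the bracket in the diagonal form $[e_2,e_3]=a_1e_1$, $[e_3,e_1]=a_2e_2$, $[e_1,e_2]=a_3e_3$ (with $a_i=a_i(t)$), induces an evolution of $(a_1,a_2,a_3)$ and hence of points of $\mathcal M$. The flow $\phi_t$ on $\mathcal M$ is the one whose orbits are the trajectories of this evolution, with their time orientation, parametrized (by a positive change of time, which does not affect orbits) so as to be defined for all $t\in\mathbb R$. In the coordinates $m_2=a_2/a_1$, $m_3=a_3/a_1$, the oriented trajectories are those of the autonomous system $$\frac{dm_2}{dt}=m_2(1-m_2)(1+m_2-m_3),\qquad \frac{dm_3}{dt}=m_3(1-m_3)(1-m_2+m_3).\qquad( * )$$ Concretely, one may take $\phi_t$ to be the flow on $\mathbb{RP}^2/S_3$ induced by the vector field $$\dot a_i=\frac{a_i}{2|a|^2}\left(-3a_i^2+(a_j-a_k)^2+2a_i(a_j+a_k)\right),\quad \{i,j,k\}=\{1,2,3\},$$ on $\mathbb R^3\setminus\{0\}$, where $|a|^2=a_1^2+a_2^2+a_3^2$; this commutes with scaling and with permutations. The sets (images in $\bar{\mathcal S}_m/\!\sim$ of the following): $p_1=(0,0)\sim\infty$, $p_2=(0,-1)$, $p_3=(1,0)$, $p_4=(1,1)$; $T_{1,2}=\{m_2=0,\ -1<m_3<0\}\sim\{m_2=0,\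 m_3<-1\}$; $T_{1,3}=\{m_3=0,\ 0<m_2<1\}$; $T_{1,3}'=\{m_2=1,\ m_3<0\}$; $T_{1,4}=\{m_2=m_3,\ 0<m_2<1\}$; $T_{3,4}=\{m_2=1,\ 0<m_3<1\}$; $T_{2,3}$ is the set of points with $0<m_2<1$ lying on the unstable manifold of the fixed point $(0,-1)$ of $( * )$ (i.e. points whose backward solution of $( * )$ exists for all $t\le0$ and converges to $(0,-1)$ as $t\to-\infty$); $B_{1,4}=\{0<m_2<1,\ 0<m_3<m_2\}$; $B_{1,3}=\{0<m_2<1,\ m_3<0,\ \text{and } (m_2,s)\in T_{2,3}\text{ for some } s<m_3\}$ (the region between $T_{2,3}$ and the $m_2$-axis); $B_{1,3}'=\{0<m_2<1,\ m_3<0,\ \text{and } (m_2,s)\in T_{2,3}\text{ for some } s>m_3\}$ (the region below $T_{2,3}$). *)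

theory Defs
  imports "HOL-Analysis.Analysis"
begin

section \<open>Metric Lie algebras\<close>

text \<open>Since every three-dimensional real vector space is isomorphic to \<^typ>\<open>real^3\<close>, a
  three-dimensional metric Lie algebra is a bracket together with an inner product (not
  necessarily the standard one) on \<^typ>\<open>real^3\<close>.\<close>

type_synonym bracket = "real^3 \<Rightarrow> real^3 \<Rightarrow> real^3"
type_synonym form = "real^3 \<Rightarrow> real^3 \<Rightarrow> real"

definition lie_bracket :: "bracket \<Rightarrow> bool" where
  "lie_bracket br \<longleftrightarrow> bilinear br \<and> (\<forall>x. br x x = 0) \<and>
     (\<forall>x y z. br x (br y z) + br y (br z x) + br z (br x y) = 0)"

definition inner_product :: "form \<Rightarrow> bool" where
  "inner_product Q \<longleftrightarrow> bilinear Q \<and> (\<forall>x y. Q x y = Q y x) \<and> (\<forall>x. x \<noteq> 0 \<longrightarrow> Q x x > 0)"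

definition unimodular :: "bracket \<Rightarrow> bool" where
  "unimodular br \<longleftrightarrow> (\<forall>x. trace (matrix (br x)) = 0)"

definition nonabelian :: "bracket \<Rightarrow> bool" where
  "nonabelian br \<longleftrightarrow> (\<exists>x y. br x y \<noteq> 0)"

definition metric_lie_algebras :: "(bracket \<times> form) set" where
  "metric_lie_algebras =
     {(br, Q). lie_bracket br \<and> inner_product Q \<and> unimodular br \<and> nonabelian br}"

text \<open>Equivalence up to isometry and scaling. The simply connected Lie groups with their
  left-invariant metrics are not represented: the relation is expressed on the Lie algebras as
  isomorphism of metric Lie algebras up to a positive factor. On nonabelian unimodular algebras
  this amounts to the structure constants in a diagonalizing orthonormal frame agreeing up to a
  permutation and a nonzero factor (the map \<open>x \<mapsto> - x\<close> changes the sign of the structure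
  constants), which is also when the associated Riemannian manifolds are isometric up to
  scaling.\<close>

definition mla_equiv :: "((bracket \<times> form) \<times> (bracket \<times> form)) set" where
  "mla_equiv = {((br, Q), (br', Q')).
     (br, Q) \<in> metric_lie_algebras \<and> (br', Q') \<in> metric_lie_algebras \<and>
     (\<exists>A c. linear A \<and> bij A \<and> c > 0 \<and>
        (\<forall>x y. A (br x y) = br' (A x) (A y)) \<and>
        (\<forall>x y. Q x y = c * Q' (A x) (A y)))}"

type_synonym mla_class = "(bracket \<times> form) set"

definition phase_space :: "mla_class set" where
  "phase_space = metric_lie_algebras // mla_equiv"

definition mla_class_of :: "bracket \<Rightarrow> form \<Rightarrow> mla_class" where
  "mla_class_of br Q = mla_equiv `` {(br, Q)}"

text \<open>In terms of the standard basis, \<open>[e\<^sub>2, e\<^sub>3] = a\<^sub>1 e\<^sub>1\<close>, \<open>[e\<^sub>3, e\<^sub>1] = a\<^sub>2 e\<^sub>2\<close> and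
  \<open>[e\<^sub>1, e\<^sub>2] = a\<^sub>3 e\<^sub>3\<close>.\<close>

definition diag_bracket :: "real^3 \<Rightarrow> bracket" where
  "diag_bracket a x y = (\<chi> i. a $ i * cross3 x y $ i)"

definition triple_class :: "real^3 \<Rightarrow> mla_class" where
  "triple_class a = mla_class_of (diag_bracket a) (\<bullet>)"


section \<open>Topology of the phase space\<close>

definition S_m :: "(real \<times> real) set" where
  "S_m = {(m2, m3). 0 \<le> m2 \<and> m2 \<le> 1 \<and> m3 \<le> m2}"

abbreviation S_m_bar :: "(real \<times> real) option topology" where
  "S_m_bar \<equiv> Alexandroff_compactification (top_of_set S_m)"

text \<open>\<^term>\<open>None\<close> is the point at infinity. The fibres of this map on the compactification of
  \<^term>\<open>S_m\<close> are the classes of the equivalence relation generated by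
  \<open>(0, m\<^sub>3) \<sim> (0, 1 / m\<^sub>3)\<close> for \<open>m\<^sub>3 \<noteq> 0\<close> and \<open>\<infinity> \<sim> (0, 0)\<close>, so that the final topology below
  is the quotient topology for that relation.\<close>

fun proj :: "(real \<times> real) option \<Rightarrow> mla_class" where
  "proj None = triple_class (vector [1, 0, 0])"
| "proj (Some (m2, m3)) = triple_class (vector [1, m2, m3])"

definition phase_top :: "mla_class topology" where
  "phase_top = topology (\<lambda>U. U \<subseteq> phase_space \<and>
     openin S_m_bar {x \<in> topspace S_m_bar. proj x \<in> U})"

text \<open>Dimension of a nonempty space, in the sense of topological manifolds.\<close>

definition has_dimension :: "'a topology \<Rightarrow> nat \<Rightarrow> bool" where
  "has_dimension X n \<longleftrightarrow> topspace X \<noteq> {} \<and>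
     (\<forall>x \<in> topspace X. \<exists>U V. openin X U \<and> x \<in> U \<and> openin (Euclidean_space n) V \<and>
        subtopology X U homeomorphic_space subtopology (Euclidean_space n) V)"


section \<open>Ricci flow\<close>

text \<open>Koszul formula for left-invariant vector fields.\<close>

definition levi_civita :: "bracket \<Rightarrow> form \<Rightarrow> real^3 \<Rightarrow> real^3 \<Rightarrow> real^3" where
  "levi_civita br Q x y =
     (THE w. \<forall>z. 2 * Q w z = Q (br x y) z - Q (br y z) x + Q (br z x) y)"

definition curvature :: "bracket \<Rightarrow> form \<Rightarrow> real^3 \<Rightarrow> real^3 \<Rightarrow> real^3 \<Rightarrow> real^3" where
  "curvature br Q x y z =
     levi_civita br Q x (levi_civita br Q y z) - levi_civita br Q y (levi_civita br Q x z)
     - levi_civita br Q (br x y) z"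

definition ricci :: "bracket \<Rightarrow> form \<Rightarrow> form" where
  "ricci br Q y z = trace (matrix (\<lambda>x. curvature br Q x y z))"

definition ricci_flow_on :: "real set \<Rightarrow> bracket \<Rightarrow> (real \<Rightarrow> form) \<Rightarrow> bool" where
  "ricci_flow_on J br g \<longleftrightarrow>
     (\<forall>t\<in>J. (br, g t) \<in> metric_lie_algebras \<and>
        (\<forall>x y. ((\<lambda>s. g s x y) has_real_derivative - 2 * ricci br (g t) x y) (at t within J)))"

definition milnor_frame :: "bracket \<Rightarrow> form \<Rightarrow> (3 \<Rightarrow> real^3) \<Rightarrow> real^3 \<Rightarrow> bool" where
  "milnor_frame br Q e a \<longleftrightarrow>
     (\<forall>i j. Q (e i) (e j) = (if i = j then 1 else 0)) \<and>
     br (e 2) (e 3) = a $ 1 *\<^sub>R e 1 \<and>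
     br (e 3) (e 1) = a $ 2 *\<^sub>R e 2 \<and>
     br (e 1) (e 2) = a $ 3 *\<^sub>R e 3"

text \<open>A Ricci flow on an open interval, with an evolving orthonormal frame that keeps the bracket
  diagonal, is followed in the time scale \<open>s\<close> determined by \<open>dt/ds = 1 / |a|\<^sup>2\<close>. In this time
  scale solutions are defined for all \<open>s\<close>, and the structure constants satisfy
  \<open>da\<^sub>i/ds = a\<^sub>i (- 3 a\<^sub>i\<^sup>2 + (a\<^sub>j - a\<^sub>k)\<^sup>2 + 2 a\<^sub>i (a\<^sub>j + a\<^sub>k)) / (2 |a|\<^sup>2)\<close>.\<close>

definition ricci_trajectory :: "(real \<Rightarrow> mla_class) \<Rightarrow> bool" where
  "ricci_trajectory P \<longleftrightarrow>
     (\<exists>J br g e a \<sigma>. open J \<and> is_interval J \<and> ricci_flow_on J br g \<and>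
        (\<forall>t\<in>J. milnor_frame br (g t) (e t) (a t) \<and>
           (\<forall>i. (\<lambda>u. e u i) differentiable (at t))) \<and>
        (\<forall>s. \<sigma> s \<in> J \<and> (\<sigma> has_real_derivative 1 / (norm (a (\<sigma> s)))\<^sup>2) (at s) \<and>
           P s = mla_class_of br (g (\<sigma> s))))"

definition ricci_dynamics :: "real \<Rightarrow> mla_class \<Rightarrow> mla_class" where
  "ricci_dynamics s p = (THE q. \<exists>P. ricci_trajectory P \<and> P 0 = p \<and> P s = q)"

definition orbit :: "mla_class \<Rightarrow> mla_class set" where
  "orbit p = range (\<lambda>s. ricci_dynamics s p)"


section \<open>The pieces of the phase portrait\<close>

definition planar_field :: "real \<times> real \<Rightarrow> real \<times> real" where
  "planar_field = (\<lambda>(m2, m3). (m2 * (1 - m2) * (1 + m2 - m3), m3 * (1 - m3) * (1 - m2 + m3)))"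

definition unstable_manifold :: "real \<times> real \<Rightarrow> (real \<times> real) set" where
  "unstable_manifold q =
     {p. \<exists>m. m 0 = p \<and>
           (\<forall>t\<le>0. (m has_vector_derivative planar_field (m t)) (at t within {..0})) \<and>
           (m \<longlongrightarrow> q) at_bot}"

definition planar_T23 :: "(real \<times> real) set" where
  "planar_T23 = {(m2, m3). 0 < m2 \<and> m2 < 1 \<and> (m2, m3) \<in> unstable_manifold (0, -1)}"

definition in_phase_space :: "(real \<times> real) set \<Rightarrow> mla_class set" where
  "in_phase_space X = proj ` Some ` X"

definition "p1 = proj (Some (0, 0))"
definition "p2 = proj (Some (0, -1))"
definition "p3 = proj (Some (1, 0))"
definition "p4 = proj (Some (1, 1))"

definition "T12 = in_phase_space {(m2, m3). m2 = 0 \<and> -1 < m3 \<and> m3 < 0}"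
definition "T13 = in_phase_space {(m2, m3). m3 = 0 \<and> 0 < m2 \<and> m2 < 1}"
definition "T13' = in_phase_space {(m2, m3). m2 = 1 \<and> m3 < 0}"
definition "T14 = in_phase_space {(m2, m3). m2 = m3 \<and> 0 < m2 \<and> m2 < 1}"
definition "T23 = in_phase_space planar_T23"
definition "T34 = in_phase_space {(m2, m3). m2 = 1 \<and> 0 < m3 \<and> m3 < 1}"

definition "B14 = in_phase_space {(m2, m3). 0 < m2 \<and> m2 < 1 \<and> 0 < m3 \<and> m3 < m2}"
definition "B13 = in_phase_space
  {(m2, m3). 0 < m2 \<and> m2 < 1 \<and> m3 < 0 \<and> (\<exists>s<m3. (m2, s) \<in> planar_T23)}"
definition "B13' = in_phase_space
  {(m2, m3). 0 < m2 \<and> m2 < 1 \<and> m3 < 0 \<and> (\<exists>s>m3. (m2, s) \<in> planar_T23)}"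

end

theory Submission
  imports Defs
begin

text \<open>In a Milnor frame the Ricci flow becomes an ordinary differential equation for the structure
  constants \<open>(a\<^sub>1, a\<^sub>2, a\<^sub>3)\<close>. The chosen time scale makes its right-hand side homogeneous of degree
  one and globally Lipschitz, so it has a complete flow, which commutes with scalings and
  permutations and hence descends to the phase space. In the coordinates \<open>(m\<^sub>2, m\<^sub>3)\<close> the boundary
  lines of the pieces are invariant, \<open>m\<^sub>2\<close> is monotone, and \<open>m\<^sub>3\<close> is eventually monotone in both
  time directions, so every trajectory converges to an equilibrium or leaves every compact set.

  The separatrix \<open>T\<^sub>2\<^sub>,\<^sub>3\<close> is obtained by shooting. Backwards in time, a trajectory in
  \<open>0 < m\<^sub>2 < 1\<close>, \<open>m\<^sub>3 < 0\<close> either enters \<open>m\<^sub>3 > m\<^sub>2 - 1\<close>, or enters \<open>m\<^sub>3 < - 1\<close>, or stays in the wedge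
  between. The first two sets of initial points are open and disjoint, so each vertical line meets
  the third. Below the line \<open>m\<^sub>3 = m\<^sub>2 - 1\<close> the slope \<open>dm\<^sub>3 / dm\<^sub>2\<close> is decreasing in \<open>m\<^sub>3\<close>, so two
  trajectories emanating from \<open>(0, - 1)\<close> coincide; thus the third set is a graph and equals the
  unstable manifold.\<close>

section \<open>Ordinary differential equations\<close>

text \<open>The planar system is not complete: on the edge m2 = 1 it reads dm3/dt = m3^2 (1 - m3),
  so m3 < 0 escapes to minus infinity in finite backward time. Hence the flow is built on triples
  and read off in the ratios m2, m3; it follows the planar system at the speed
  \<open>planar_speed\<close>. The unstable manifold in \<open>planar_T23\<close>, however, refers
  to the planar time, so the two times must be compared; the speed is bounded below on the wedge.

  Each boundary line of the wedge is crossed in one direction only, because 1 - m2 + m3 and - (1 +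
  m3) satisfy u' = k u - h with h > 0. Being across a line at one time thus means being across it at
  all earlier times; this makes the two alternatives of the shooting argument exclusive and open.
  Shooting gives existence only, and dm3/dm2 is singular at m2 = 0, so uniqueness rests on the
  monotone slope and not on a Lipschitz bound.

  Infinity and (0, 0) both represent p1, so trajectories with m3 tending to minus infinity converge
  to p1.\<close>

lemma antiderivative_exists:
  fixes f :: "real \<Rightarrow> 'a::euclidean_space"
  assumes "continuous_on UNIV f"
  obtains F where "\<And>x. (F has_vector_derivative f x) (at x)" "F 0 = 0"
proof -
  have "isCont f x" for x
    using assms by (simp add: continuous_on_eq_continuous_at)
  then obtain F where F: "\<And>x::real. (F has_vector_derivative f x) (at x)"
    using einterval_antiderivative[of "-\<infinity>" "\<infinity>" f] by auto
  have "((\<lambda>x. F x - F 0) has_vector_derivative f x) (at x)" for x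
    using F[of x] by (auto intro!: derivative_eq_intros)
  then show ?thesis by (rule that) simp
qed

text \<open>Integrating the weight exp (K |u|) reproduces it up to the factor 1 / K. This gain is
  what makes the Picard operator a contraction in the weighted norm.\<close>

lemma antiderivative_norm_bound:
  fixes G :: "real \<Rightarrow> 'a::euclidean_space"
  assumes G: "\<And>u. (G has_vector_derivative g u) (at u)" and G0: "G 0 = 0"
    and g: "\<And>u. norm (g u) \<le> C * exp (K * \<bar>u\<bar>)" and K: "K > 0"
  shows "norm (G s) \<le> C / K * exp (K * \<bar>s\<bar>)"
proof -
  have C: "C \<ge> 0" using g[of 0] norm_ge_zero[of "g 0"] by (simp del: norm_ge_zero)
  have pos: "norm (G s) \<le> C / K * exp (K * s)"
    if G: "\<And>u. (G has_vector_derivative g u) (at u)" and G0: "G 0 = 0"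
    and g: "\<And>u. norm (g u) \<le> C * exp (K * \<bar>u\<bar>)" and s: "s \<ge> 0"
  for G g :: "real \<Rightarrow> 'a" and s
  proof (cases "s = 0")
    case True then show ?thesis using C K G0 by simp
  next
    case False
    then have "0 < s" using s by simp
    then have "norm (G s - G 0) \<le> C / K * exp (K * s) - C / K * exp (K * 0)"
    proof (rule differentiable_bound_general[where f' = g and \<phi>' = "\<lambda>u. C * exp (K * u)"])
      show "continuous_on {0..s} G"
        using G by (meson continuous_at_imp_continuous_on has_vector_derivative_continuous)
      show "continuous_on {0..s} (\<lambda>x. C / K * exp (K * x))"
        by (intro continuous_intros) (use K in auto)
      show "((\<lambda>a. C / K * exp (K * a)) has_vector_derivative C * exp (K * x)) (at x)" for x
        unfolding has_real_derivative_iff_has_vector_derivative[symmetric]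
        by (rule derivative_eq_intros refl | use K in simp)+
      show "norm (g x) \<le> C * exp (K * x)" if "0 < x" for x using g[of x] that by simp
    qed (use G in auto)
    moreover have "C / K \<ge> 0" using C K by simp
    ultimately show ?thesis using G0 by simp
  qed
  show ?thesis
  proof (cases "s \<ge> 0")
    case True then show ?thesis using pos[OF G G0 g] by simp
  next
    case False
    have "((\<lambda>u. G (- u)) has_vector_derivative - g (- u)) (at u)" for u
    proof -
      have "((\<lambda>u::real. - u) has_vector_derivative - 1) (at u)"
        by (auto intro!: derivative_eq_intros)
      from vector_diff_chain_at[OF this G] show ?thesis by (simp add: o_def)
    qed
    from pos[OF this, of "- s"] show ?thesis using False G0 g[of "- u" for u] by auto
  qed
qed

text \<open>Weighting a path by \<open>exp (- 2 L |s|)\<close> turns the Picard operator into a contraction on all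
  of the real line, so that no continuation argument is needed.\<close>

lemma lipschitz_ode_exists:
  fixes F :: "'a::euclidean_space \<Rightarrow> 'a"
  assumes lip: "\<And>x y. norm (F x - F y) \<le> L * norm (x - y)" and L: "L > 0"
  obtains x where "x 0 = x0" "\<And>s. (x has_vector_derivative F (x s)) (at s)"
proof -
  \<comment> \<open>The contraction constant will be L / K, so this choice gives 1/2.\<close>
  define K where "K = 2 * L"
  have K: "K > 0" using L by (simp add: K_def)
  have "L-lipschitz_on UNIV F" using lip L by (auto simp: lipschitz_on_def dist_norm)
  then have contF: "continuous_on UNIV F" by (rule lipschitz_on_continuous_on)
  have contF': "continuous_on A (\<lambda>u. F (h u))" if "continuous_on A h" for h :: "real \<Rightarrow> 'a" and A
    using continuous_on_compose2[OF contF that] by auto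
  define path where "path y u = x0 + exp (K * \<bar>u\<bar>) *\<^sub>R apply_bcontfun y u" for y :: "real \<Rightarrow>\<^sub>C 'a" and u
  have cpath: "continuous_on A (path y)" for y A
    unfolding path_def by (intro continuous_intros continuous_on_apply_bcontfun)
  have "\<exists>G. G 0 = 0 \<and> (\<forall>u. (G has_vector_derivative F (path y u)) (at u))" for y
    using antiderivative_exists[OF contF'[OF cpath[of UNIV y]]] by metis
  then obtain G where G0: "\<And>y. G y 0 = 0"
    and G: "\<And>y u. (G y has_vector_derivative F (path y u)) (at u)" by metis
  define T where "T y s = exp (- K * \<bar>s\<bar>) *\<^sub>R G y s" for y s
  have expp: "exp (- K * \<bar>s\<bar>) * (c * exp (K * \<bar>s\<bar>)) = c" for s c
    by (simp add: exp_minus field_simps)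
  have "T y \<in> bcontfun" for y
  proof -
    have "continuous_on UNIV (G y)"
      using G by (meson continuous_at_imp_continuous_on has_vector_derivative_continuous)
    then have "continuous_on UNIV (T y)" unfolding T_def by (intro continuous_intros)
    moreover
    obtain B where B: "\<And>u. norm (apply_bcontfun y u) \<le> B"
      using bounded_apply_bcontfun[of y] by (auto simp: bounded_iff)
    have "norm (F (path y u)) \<le> (norm (F x0) + L * B) * exp (K * \<bar>u\<bar>)" for u
    proof -
      have "norm (F (path y u)) \<le> norm (F x0) + norm (F (path y u) - F x0)"
        by (metis add.commute norm_triangle_sub)
      also have "norm (F (path y u) - F x0) \<le> L * (exp (K * \<bar>u\<bar>) * B)"
        using lip[of "path y u" x0] B[of u] L
        by (simp add: path_def) (smt (verit, best) mult_left_mono exp_ge_zero)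
      also have "norm (F x0) \<le> norm (F x0) * exp (K * \<bar>u\<bar>)"
        using K by (simp add: mult_le_cancel_left1)
      finally show ?thesis by (simp add: algebra_simps)
    qed
    then have b: "norm (G y s) \<le> (norm (F x0) + L * B) / K * exp (K * \<bar>s\<bar>)" for s
      using antiderivative_norm_bound[OF G G0] K by blast
    have "norm (T y s) \<le> (norm (F x0) + L * B) / K" for s
      unfolding T_def using mult_left_mono[OF b, of "exp (- K * \<bar>s\<bar>)" s]
      unfolding expp by simp
    then have "bounded (range (T y))" by (auto simp: bounded_iff)
    ultimately show ?thesis by (simp add: bcontfun_def)
  qed
  then have T: "apply_bcontfun (Bcontfun (T y)) = T y" for y
    by (simp add: Bcontfun_inverse)
  have "dist (Bcontfun (T y)) (Bcontfun (T z)) \<le> 1/2 * dist y z" for y z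
  proof (rule dist_bound)
    fix s
    have "norm (F (path y u) - F (path z u)) \<le> L * dist y z * exp (K * \<bar>u\<bar>)" for u
    proof -
      have "path y u - path z u = exp (K * \<bar>u\<bar>) *\<^sub>R (y u - z u)"
        by (simp add: path_def scaleR_diff_right)
      then have "norm (path y u - path z u) = exp (K * \<bar>u\<bar>) * dist (y u) (z u)"
        by (simp add: dist_norm)
      also have "\<dots> \<le> exp (K * \<bar>u\<bar>) * dist y z" by (intro mult_left_mono dist_bounded) auto
      finally have "L * norm (path y u - path z u) \<le> L * (exp (K * \<bar>u\<bar>) * dist y z)"
        using L by simp
      with lip[of "path y u" "path z u"] show ?thesis by (simp add: mult_ac)
    qed
    moreover have "((\<lambda>s. G y s - G z s) has_vector_derivative F (path y u) - F (path z u)) (at u)"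
      for u by (intro derivative_intros G)
    ultimately have b: "norm (G y s - G z s) \<le> L * dist y z / K * exp (K * \<bar>s\<bar>)"
      by (intro antiderivative_norm_bound[where G = "\<lambda>s. G y s - G z s"] K) (simp_all add: G0)
    have "dist (T y s) (T z s) = exp (- K * \<bar>s\<bar>) * norm (G y s - G z s)"
      by (simp add: T_def dist_norm flip: scaleR_diff_right)
    also have "\<dots> \<le> L * dist y z / K"
      using mult_left_mono[OF b, of "exp (- K * \<bar>s\<bar>)"] unfolding expp by simp
    also have "\<dots> = 1/2 * dist y z" using L by (simp add: K_def)
    finally show "dist (Bcontfun (T y) s) (Bcontfun (T z) s) \<le> 1/2 * dist y z"
      by (simp add: T)
  qed
  then obtain y where y: "Bcontfun (T y) = y"
    using banach_fix_type[of "1/2" "\<lambda>y. Bcontfun (T y)"] by auto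
  then have "apply_bcontfun y = T y" using T[of y] by simp
  then have "path y s = x0 + G y s" for s
    by (simp add: path_def T_def exp_minus)
  then have e: "path y = (\<lambda>s. x0 + G y s)" by auto
  have "(path y has_vector_derivative F (path y s)) (at s)" for s
    by (subst e) (auto intro!: derivative_eq_intros G)
  moreover have "path y 0 = x0" by (simp add: e G0)
  ultimately show ?thesis by (intro that[of "path y"])
qed

text \<open>Gronwall's inequality: by Cauchy-Schwarz and the Lipschitz bound, the squared distance
  of two solutions, discounted by exp (- 2 L s), is nonincreasing. The square is differentiable even
  where the solutions meet.\<close>

lemma lipschitz_ode_dependence_forward:
  fixes F :: "'a::euclidean_space \<Rightarrow> 'a"
  assumes lip: "\<And>x y. norm (F x - F y) \<le> L * norm (x - y)"
    and x: "\<And>s. (x has_vector_derivative F (x s)) (at s)"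
    and y: "\<And>s. (y has_vector_derivative F (y s)) (at s)" and s: "s \<ge> 0"
  shows "norm (x s - y s) \<le> exp (L * s) * norm (x 0 - y 0)"
proof -
  define D where "D s = exp (- (2 * L * s)) * ((x s - y s) \<bullet> (x s - y s))" for s
  have d: "((\<lambda>s. (x s - y s) \<bullet> (x s - y s)) has_real_derivative 2 * ((x s - y s) \<bullet> (F (x s) - F (y s)))) (at s)" for s
  proof -
    have h: "((\<lambda>s. x s - y s) has_derivative (\<lambda>h. h *\<^sub>R (F (x s) - F (y s)))) (at s)"
      using has_vector_derivative_diff[OF x y] unfolding has_vector_derivative_def .
    show ?thesis unfolding has_field_derivative_def
      by (rule has_derivative_eq_rhs[OF has_derivative_inner[OF h h]])
        (simp add: fun_eq_iff inner_commute)
  qed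
  have D: "(D has_real_derivative exp (- (2 * L * s)) *
      (2 * ((x s - y s) \<bullet> (F (x s) - F (y s))) - 2 * L * ((x s - y s) \<bullet> (x s - y s)))) (at s)" for s
    unfolding D_def by (rule derivative_eq_intros d refl)+ (simp add: algebra_simps)
  have "(x s - y s) \<bullet> (F (x s) - F (y s)) \<le> L * ((x s - y s) \<bullet> (x s - y s))" for s
  proof -
    have "(x s - y s) \<bullet> (F (x s) - F (y s)) \<le> norm (x s - y s) * norm (F (x s) - F (y s))"
      by (rule norm_cauchy_schwarz)
    also have "\<dots> \<le> norm (x s - y s) * (L * norm (x s - y s))"
      by (intro mult_left_mono lip) auto
    finally show ?thesis by (simp add: dot_square_norm power2_eq_square mult_ac)
  qed
  then have "D s \<le> D 0"
    using s by (intro DERIV_nonpos_imp_nonincreasing[of 0 s D]) (use D in \<open>force simp: mult_le_0_iff\<close>)+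
  then have "(norm (x s - y s))\<^sup>2 \<le> exp (2 * L * s) * (norm (x 0 - y 0))\<^sup>2"
    by (simp add: D_def dot_square_norm exp_minus field_simps)
  also have "\<dots> = (exp (L * s) * norm (x 0 - y 0))\<^sup>2"
    by (simp add: power_mult_distrib flip: exp_double mult.assoc)
  finally show ?thesis by (rule power2_le_imp_le) simp
qed

text \<open>For negative times the forward estimate is applied to the reversed solutions, which
  solve the equation for - F with the same constant. Equal initial values give uniqueness, different
  ones give continuity of the time maps.\<close>

lemma lipschitz_ode_dependence:
  fixes F :: "'a::euclidean_space \<Rightarrow> 'a"
  assumes lip: "\<And>x y. norm (F x - F y) \<le> L * norm (x - y)"
    and x: "\<And>s. (x has_vector_derivative F (x s)) (at s)"
    and y: "\<And>s. (y has_vector_derivative F (y s)) (at s)"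
  shows "norm (x s - y s) \<le> exp (L * \<bar>s\<bar>) * norm (x 0 - y 0)"
proof (cases "s \<ge> 0")
  case True
  then show ?thesis using lipschitz_ode_dependence_forward[OF assms] by simp
next
  case False
  have r: "((\<lambda>u. z (- u)) has_vector_derivative - F (z (- u))) (at u)"
    if "\<And>s. (z has_vector_derivative F (z s)) (at s)" for u and z :: "real \<Rightarrow> 'a"
  proof -
    have "((\<lambda>u::real. - u) has_vector_derivative - 1) (at u)"
      by (auto intro!: derivative_eq_intros)
    from vector_diff_chain_at[OF this that] show ?thesis by (simp add: o_def)
  qed
  have "norm (- F x - - F y) \<le> L * norm (x - y)" for x y
    using lip[of y x] by (simp add: norm_minus_commute)
  from lipschitz_ode_dependence_forward[where F = "\<lambda>x. - F x", OF this r[OF x] r[OF y], of "- s"]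
  show ?thesis using False by simp
qed

text \<open>If K' = k, then u exp (- K) is constant, and exp (- K) is positive. Every invariant line
  below comes from this. The domain may be a half line because solutions in the unstable manifold
  are only given for t \<le> 0.\<close>

lemma linear_ode_sgn:
  fixes u k :: "real \<Rightarrow> real"
  assumes S: "closed S" "convex S" and k: "continuous_on S k"
    and u: "\<And>s. s \<in> S \<Longrightarrow> (u has_real_derivative k s * u s) (at s within S)"
    and s: "s \<in> S" "t \<in> S"
  shows "sgn (u s) = sgn (u t)"
proof -
  have "closedin (top_of_set UNIV) S" using S by simp
  \<comment> \<open>A continuous extension of k to the whole line has an antiderivative there,
    whatever the shape of S.\<close>
  from Tietze_unbounded[OF k this] obtain k' where k': "continuous_on UNIV k'"
    "\<And>s. s \<in> S \<Longrightarrow> k' s = k s" by metis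
  from antiderivative_exists[OF k'(1)] obtain K
    where K: "\<And>s. (K has_vector_derivative k' s) (at s)" by metis
  have "((\<lambda>s. u s * exp (- K s)) has_real_derivative 0) (at s within S)" if "s \<in> S" for s
  proof -
    have "(K has_real_derivative k s) (at s within S)"
      using K[of s] k'(2)[OF that]
      by (simp add: has_real_derivative_iff_has_vector_derivative has_vector_derivative_at_within)
    from this u[OF that] show ?thesis
      by (auto intro!: derivative_eq_intros simp: algebra_simps)
  qed
  from has_field_derivative_zero_constant[OF S(2) this] obtain c
    where c: "\<And>s. s \<in> S \<Longrightarrow> u s * exp (- K s) = c" by auto
  have "sgn (u s) = sgn c" if "s \<in> S" for s
    using c[OF that, symmetric] by (simp add: sgn_mult)
  then show ?thesis using s by metis
qed

section \<open>Limits at infinity, monotone convergence and changes of parameter\<close>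

lemma tendsto_derivative_at_top_zero:
  fixes f :: "real \<Rightarrow> real"
  assumes f: "(f \<longlongrightarrow> l) at_top" and f': "(f' \<longlongrightarrow> d) at_top"
    and der: "\<And>s. (f has_real_derivative f' s) (at s)"
  shows "d = 0"
proof -
  \<comment> \<open>The increment over a unit interval tends to l - l = 0, and by the mean value
    theorem it is a value of f' at a point that moves to infinity with s.\<close>
  have "\<exists>z>s. z < s + 1 \<and> f (s + 1) - f s = f' z" for s
    using MVT2[of s "s + 1" f f'] der by auto
  then obtain z where z: "\<And>s. z s > s" "\<And>s. f (s + 1) - f s = f' (z s)" by metis
  have "filterlim z at_top at_top"
    by (rule filterlim_at_top_mono[OF filterlim_ident]) (use z(1) in \<open>auto intro: always_eventually less_imp_le\<close>)
  then have "((\<lambda>s. f' (z s)) \<longlongrightarrow> d) at_top" by (rule filterlim_compose[OF f'])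
  moreover have "((\<lambda>s. f (s + 1) - f s) \<longlongrightarrow> l - l) at_top"
    by (intro tendsto_diff f filterlim_compose[OF f] filterlim_tendsto_add_at_top[OF tendsto_const filterlim_ident, of 1, simplified add.commute])
  ultimately show ?thesis using z(2) tendsto_unique by (metis (lifting) ext diff_self trivial_limit_at_top_linorder)
qed

lemma tendsto_derivative_at_bot_zero:
  fixes f :: "real \<Rightarrow> real"
  assumes f: "(f \<longlongrightarrow> l) at_bot" and f': "(f' \<longlongrightarrow> d) at_bot"
    and der: "\<And>s. (f has_real_derivative f' s) (at s)"
  shows "d = 0"
proof -
  have "- d = 0"
  proof (rule tendsto_derivative_at_top_zero)
    show "((\<lambda>s. f (- s)) \<longlongrightarrow> l) at_top" using f by (simp add: filterlim_at_bot_mirror)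
    show "((\<lambda>s. - f' (- s)) \<longlongrightarrow> - d) at_top"
      using f' by (intro tendsto_minus) (simp add: filterlim_at_bot_mirror)
    show "((\<lambda>s. f (- s)) has_real_derivative - f' (- s)) (at s)" for s
      using DERIV_mirror[of f "f' (-s)" s] der[of "- s"] by simp
  qed
  then show ?thesis by simp
qed

lemma eventually_mono_bounded_tendsto:
  fixes f :: "real \<Rightarrow> real"
  assumes mono: "\<And>s t. a \<le> s \<Longrightarrow> s \<le> t \<Longrightarrow> f s \<le> f t" and bd: "\<And>s. a \<le> s \<Longrightarrow> f s \<le> b"
  obtains l where "(f \<longlongrightarrow> l) at_top" "\<And>s. a \<le> s \<Longrightarrow> f s \<le> l" "l \<le> b"
proof -
  define l where "l = Sup (f ` {a..})"
  have bdd: "bdd_above (f ` {a..})" using bd by (auto intro!: bdd_aboveI)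
  have le: "f s \<le> l" if "a \<le> s" for s unfolding l_def using that bdd by (auto intro: cSUP_upper)
  have "(f \<longlongrightarrow> l) at_top"
  proof (rule order_tendstoI)
    fix c assume "c < l"
    then obtain s where s: "s \<ge> a" "c < f s"
      unfolding l_def using less_cSUP_iff[OF _ bdd] by auto
    then show "\<forall>\<^sub>F x in at_top. c < f x"
      using mono by (intro eventually_at_top_linorderI[of s]) force
  next
    fix c assume "l < c"
    then show "\<forall>\<^sub>F x in at_top. f x < c"
      using le by (intro eventually_at_top_linorderI[of a]) force
  qed
  moreover have "l \<le> b" unfolding l_def using bd by (intro cSUP_least) auto
  ultimately show ?thesis using le that by blast
qed

lemma eventually_antimono_bounded_tendsto:
  fixes f :: "real \<Rightarrow> real"
  assumes mono: "\<And>s t. a \<le> s \<Longrightarrow> s \<le> t \<Longrightarrow> f t \<le> f s" and bd: "\<And>s. a \<le> s \<Longrightarrow> b \<le> f s"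
  obtains l where "(f \<longlongrightarrow> l) at_top" "\<And>s. a \<le> s \<Longrightarrow> l \<le> f s" "b \<le> l"
proof -
  obtain l where l: "((\<lambda>s. - f s) \<longlongrightarrow> l) at_top" "\<And>s. a \<le> s \<Longrightarrow> - f s \<le> l" "l \<le> - b"
    using eventually_mono_bounded_tendsto[of a "\<lambda>s. - f s" "- b"] mono bd by auto
  show ?thesis
    by (rule that[of "- l"]) (use l tendsto_minus[OF l(1)] in force)+
qed

text \<open>The inverse function theorem for changes of parameter. The new parameter will be the
  Ricci flow time, the time of the planar system, or the coordinate m2.\<close>

lemma increasing_inverse:
  fixes \<theta> k :: "real \<Rightarrow> real"
  assumes S: "open S" "is_interval S"
    and der: "\<And>s. s \<in> S \<Longrightarrow> (\<theta> has_real_derivative k s) (at s)"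
    and k: "\<And>s. s \<in> S \<Longrightarrow> k s > 0"
  obtains \<sigma> where "\<And>s. s \<in> S \<Longrightarrow> \<sigma> (\<theta> s) = s"
    "\<And>s. s \<in> S \<Longrightarrow> (\<sigma> has_real_derivative 1 / k s) (at (\<theta> s))"
    "open (\<theta> ` S)" "is_interval (\<theta> ` S)" "strict_mono_on S \<theta>"
proof -
  have cont: "continuous_on S \<theta>"
    using der by (meson DERIV_isCont continuous_at_imp_continuous_on)
  have sm: "\<theta> s < \<theta> t" if "s \<in> S" "t \<in> S" "s < t" for s t
  proof (rule DERIV_pos_imp_increasing[OF that(3)])
    fix x assume "s \<le> x" "x \<le> t"
    then have "x \<in> S" using mem_is_interval_1_I[OF S(2) that(1,2)] by blast
    then show "\<exists>y. (\<theta> has_real_derivative y) (at x) \<and> 0 < y" using der k by blast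
  qed
  then have sm': "strict_mono_on S \<theta>" by (auto intro: strict_mono_onI)
  then have inj: "inj_on \<theta> S" by (rule strict_mono_on_imp_inj_on)
  define \<sigma> where "\<sigma> = the_inv_into S \<theta>"
  have \<sigma>: "\<sigma> (\<theta> s) = s" if "s \<in> S" for s
    unfolding \<sigma>_def using the_inv_into_f_f[OF inj that] .
  have "(\<sigma> has_real_derivative 1 / k s) (at (\<theta> s))" if "s \<in> S" for s
  proof -
    have "(\<sigma> has_derivative (\<lambda>h. h / k s)) (at (\<theta> s))"
      by (rule has_derivative_inverse_strong[OF S(1) that cont \<sigma>
            der[OF that, unfolded has_field_derivative_def]])
        (use k[OF that] in \<open>auto simp: fun_eq_iff\<close>)
    then show ?thesis unfolding has_field_derivative_def
      by (rule has_derivative_eq_rhs) (auto simp: fun_eq_iff)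
  qed
  moreover have "open (\<theta> ` S)"
    using injective_into_1d_imp_open_map_UNIV[OF S(1) cont inj] by simp
  moreover have "is_interval (\<theta> ` S)"
    using S(2) cont connected_continuous_image is_interval_connected_1 by blast
  ultimately show ?thesis using that \<sigma> sm' by blast
qed

section \<open>The Ricci flow on structure constants\<close>

text \<open>Symmetric form of the field from the informal statement: with \<open>n = |a|\<^sup>2\<close> and
  \<open>e = a\<^sub>1 + a\<^sub>2 + a\<^sub>3\<close>, one has
  \<open>- 3 a\<^sub>i\<^sup>2 + (a\<^sub>j - a\<^sub>k)\<^sup>2 + 2 a\<^sub>i (a\<^sub>j + a\<^sub>k) = 2 n - e\<^sup>2 + 4 e a\<^sub>i - 8 a\<^sub>i\<^sup>2\<close>.\<close>

definition milnor_field :: "real^3 \<Rightarrow> real^3" where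
  "milnor_field a = (\<chi> i. a $ i * (2 * (a \<bullet> a) - (\<Sum>j\<in>UNIV. a $ j)\<^sup>2 + 4 * (\<Sum>j\<in>UNIV. a $ j) * a $ i
      - 8 * (a $ i)\<^sup>2) / (2 * (a \<bullet> a)))"

text \<open>The radial projection to the sphere is Lipschitz only away from the origin, with a
  constant of order 1 / |b|. The factor |b| compensates for this, so the estimate holds up to the
  origin.\<close>

lemma sgn_diff_bound:
  fixes a b :: "'a::real_normed_vector"
  shows "norm b * norm (sgn a - sgn b) \<le> 2 * norm (a - b)"
proof (cases "a = 0 \<or> b = 0")
  case True
  then show ?thesis by (auto simp: norm_sgn)
next
  case False
  have "norm b *\<^sub>R (sgn a - sgn b) = (norm b - norm a) *\<^sub>R sgn a + (a - b)"
    using False by (simp add: sgn_div_norm algebra_simps)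
  then have "norm (norm b *\<^sub>R (sgn a - sgn b)) \<le> norm ((norm b - norm a) *\<^sub>R sgn a) + norm (a - b)"
    by (metis norm_triangle_ineq)
  also have "norm ((norm b - norm a) *\<^sub>R sgn a) = \<bar>norm b - norm a\<bar>"
    using False by (simp add: norm_sgn)
  also have "\<dots> \<le> norm (a - b)" by (metis abs_minus_commute norm_triangle_ineq3)
  finally show ?thesis by simp
qed

text \<open>With u = a / |a| the quotient is \<open>a $ i * u $ j * u $ k\<close>, one coordinate
  times bounded factors. Changing one factor at a time costs |a - b| once and 2 |a - b| twice,
  whence 5.\<close>

lemma cubic_quotient_lipschitz:
  fixes a b :: "real^'n"
  shows "\<bar>a$i * a$j * a$k / (a \<bullet> a) - b$i * b$j * b$k / (b \<bullet> b)\<bar> \<le> 5 * norm (a - b)"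
proof -
  define u v where "u = sgn a" and "v = sgn b"
  have e: "c$i * c$j * c$k / (c \<bullet> c) = c$i * sgn c$j * sgn c$k" for c :: "real^'n"
    by (simp add: sgn_div_norm dot_square_norm power2_eq_square field_simps)
  have u: "\<bar>u $ l\<bar> \<le> 1" "\<bar>v $ l\<bar> \<le> 1" for l
    using component_le_norm_cart[of u l] component_le_norm_cart[of v l]
    by (auto simp: u_def v_def norm_sgn split: if_splits)
  have uv: "\<bar>b$i\<bar> * \<bar>u$l - v$l\<bar> \<le> 2 * norm (a - b)" for l
  proof -
    have "\<bar>b$i\<bar> * \<bar>u$l - v$l\<bar> \<le> norm b * norm (u - v)"
      using component_le_norm_cart[of b i] component_le_norm_cart[of "u - v" l]
      by (intro mult_mono) auto
    then show ?thesis using sgn_diff_bound[of b a] by (simp add: u_def v_def)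
  qed
  have "a$i * u$j * u$k - b$i * v$j * v$k =
    (a$i - b$i) * (u$j * u$k) + (b$i * (u$j - v$j)) * u$k + (b$i * (u$k - v$k)) * v$j"
    by (simp add: algebra_simps)
  also have "\<bar>\<dots>\<bar> \<le> \<bar>(a$i - b$i) * (u$j * u$k)\<bar> + \<bar>(b$i * (u$j - v$j)) * u$k\<bar>
      + \<bar>(b$i * (u$k - v$k)) * v$j\<bar>" by linarith
  also have "\<dots> \<le> norm (a - b) * 1 + (2 * norm (a - b)) * 1 + (2 * norm (a - b)) * 1"
    unfolding abs_mult
    by (intro add_mono mult_mono uv u mult_le_one)
      (use component_le_norm_cart[of "a - b" i] in auto)
  finally show ?thesis unfolding e u_def v_def by simp
qed

text \<open>Splits the field into a linear term and homogeneous quotients whose Lipschitz constant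
  is known.\<close>

lemma milnor_field_cubic:
  "milnor_field a $ i = a$i - (\<Sum>j\<in>UNIV. \<Sum>k\<in>UNIV. a$i * a$j * a$k / (a \<bullet> a)) / 2
     + 2 * (\<Sum>j\<in>UNIV. a$i * a$i * a$j / (a \<bullet> a)) - 4 * (a$i * a$i * a$i / (a \<bullet> a))"
proof (cases "a = 0")
  case True
  then show ?thesis by (simp add: milnor_field_def)
next
  case False
  then have "a \<bullet> a \<noteq> 0" by simp
  then show ?thesis
    unfolding milnor_field_def sum_3 by (simp add: field_simps power2_eq_square)
qed

text \<open>Each component has the constant 1 + 9 * 5 / 2 + 2 * 15 + 4 * 5 = 147 / 2, rounded up to
  100; the three components are added in the l1 norm.\<close>

lemma milnor_field_lipschitz: "norm (milnor_field a - milnor_field b) \<le> 300 * norm (a - b)"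
proof -
  have c: "\<bar>milnor_field a $ i - milnor_field b $ i\<bar> \<le> 100 * norm (a - b)" for i
  proof -
    define c where "c i j k = a$i * a$j * a$k / (a \<bullet> a) - b$i * b$j * b$k / (b \<bullet> b)" for i j k
    have c: "\<bar>c i j k\<bar> \<le> 5 * norm (a - b)" for i j k
      unfolding c_def by (rule cubic_quotient_lipschitz)
    have "milnor_field a $ i - milnor_field b $ i = (a - b)$i - (\<Sum>j\<in>UNIV. \<Sum>k\<in>UNIV. c i j k) / 2
        + 2 * (\<Sum>j\<in>UNIV. c i i j) - 4 * c i i i"
      unfolding milnor_field_cubic sum_3 c_def by (simp add: field_simps)
    also have "\<bar>\<dots>\<bar> \<le> \<bar>(a - b)$i\<bar> + (\<Sum>j\<in>UNIV. \<Sum>k\<in>UNIV. \<bar>c i j k\<bar>) / 2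
        + 2 * (\<Sum>j\<in>UNIV. \<bar>c i i j\<bar>) + 4 * \<bar>c i i i\<bar>"
    proof -
      have "\<bar>\<Sum>j\<in>UNIV. \<Sum>k\<in>UNIV. c i j k\<bar> \<le> (\<Sum>j\<in>UNIV. \<Sum>k\<in>UNIV. \<bar>c i j k\<bar>)"
        by (rule order_trans[OF sum_abs sum_mono[OF sum_abs]])
      moreover have "\<bar>\<Sum>j\<in>UNIV. c i i j\<bar> \<le> (\<Sum>j\<in>UNIV. \<bar>c i i j\<bar>)" by (rule sum_abs)
      ultimately show ?thesis by linarith
    qed
    also have "\<dots> \<le> norm (a - b) + (\<Sum>j\<in>(UNIV::3 set). \<Sum>k\<in>(UNIV::3 set). 5 * norm (a - b)) / 2
        + 2 * (\<Sum>j\<in>(UNIV::3 set). 5 * norm (a - b)) + 4 * (5 * norm (a - b))"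
      by (intro add_mono mult_left_mono divide_right_mono sum_mono c component_le_norm_cart) auto
    also have "\<dots> = 147 / 2 * norm (a - b)" by simp
    also have "\<dots> \<le> 100 * norm (a - b)" by (intro mult_right_mono) auto
    finally show ?thesis .
  qed
  have "norm (milnor_field a - milnor_field b) \<le> (\<Sum>i\<in>UNIV. \<bar>(milnor_field a - milnor_field b) $ i\<bar>)"
    by (rule norm_le_l1_cart)
  also have "\<dots> \<le> (\<Sum>i\<in>(UNIV::3 set). 100 * norm (a - b))"
    using c by (intro sum_mono) auto
  finally show ?thesis by simp
qed

lemma milnor_field_0 [simp]: "milnor_field 0 = 0"
  by (simp add: milnor_field_def vec_eq_iff)

text \<open>Homogeneity for factors of either sign is what lets the flow descend to triples up to a
  nonzero scalar.\<close>

lemma milnor_field_scale: "milnor_field (c *\<^sub>R a) = c *\<^sub>R milnor_field a"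
proof (cases "c = 0 \<or> a = 0")
  case False
  then have "a \<bullet> a \<noteq> 0" "c \<noteq> 0" by auto
  then show ?thesis
    by (simp add: vec_eq_iff milnor_field_def divide_simps flip: sum_distrib_left)
      (simp add: algebra_simps power2_eq_square)
qed auto

lemma milnor_field_permute:
  assumes "bij p"
  shows "milnor_field (\<chi> i. a $ p i) = (\<chi> i. milnor_field a $ p i)"
proof -
  have "(\<Sum>i\<in>UNIV. f (p i)) = (\<Sum>i\<in>UNIV. f i)" for f :: "3 \<Rightarrow> real"
    using sum.reindex_bij_betw[of p UNIV UNIV f] assms by simp
  note s = this[of "\<lambda>i. a $ i"] this[of "\<lambda>i. a $ i * a $ i"]
  show ?thesis by (simp add: milnor_field_def vec_eq_iff inner_vec_def s)
qed

section \<open>The complete flow of the structure constants and its symmetries\<close>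

definition milnor_flow :: "real \<Rightarrow> real^3 \<Rightarrow> real^3" where
  "milnor_flow s a = (SOME x. x 0 = a \<and> (\<forall>s. (x has_vector_derivative milnor_field (x s)) (at s))) s"

lemma milnor_flow:
  shows milnor_flow_0 [simp]: "milnor_flow 0 a = a"
    and milnor_flow_has_vector_derivative:
      "((\<lambda>s. milnor_flow s a) has_vector_derivative milnor_field (milnor_flow s a)) (at s)"
proof -
  obtain x where "x 0 = a" "\<And>s. (x has_vector_derivative milnor_field (x s)) (at s)"
    using lipschitz_ode_exists[OF milnor_field_lipschitz, of a] by auto
  then have "\<exists>x. x 0 = a \<and> (\<forall>s. (x has_vector_derivative milnor_field (x s)) (at s))" by blast
  from someI_ex[OF this] show "milnor_flow 0 a = a"
    "((\<lambda>s. milnor_flow s a) has_vector_derivative milnor_field (milnor_flow s a)) (at s)"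
    unfolding milnor_flow_def by auto
qed

lemma milnor_flow_unique:
  assumes "\<And>s. (x has_vector_derivative milnor_field (x s)) (at s)"
  shows "x s = milnor_flow s (x 0)"
  using lipschitz_ode_dependence[OF milnor_field_lipschitz assms
      milnor_flow_has_vector_derivative[of "x 0"], of s] by simp

lemma milnor_flow_dist:
  "norm (milnor_flow s a - milnor_flow s b) \<le> exp (300 * \<bar>s\<bar>) * norm (a - b)"
  using lipschitz_ode_dependence[OF milnor_field_lipschitz
      milnor_flow_has_vector_derivative milnor_flow_has_vector_derivative, of s a b] by simp

lemma milnor_flow_scale: "milnor_flow s (c *\<^sub>R a) = c *\<^sub>R milnor_flow s a"
proof -
  have "((\<lambda>s. c *\<^sub>R milnor_flow s a) has_vector_derivative milnor_field (c *\<^sub>R milnor_flow s a)) (at s)" for s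
    unfolding milnor_field_scale
    using has_vector_derivative_scaleR[OF DERIV_const milnor_flow_has_vector_derivative] by simp
  from milnor_flow_unique[OF this, of s] show ?thesis by simp
qed

lemma has_vector_derivative_cart:
  fixes x :: "real \<Rightarrow> real^'n"
  shows "(x has_vector_derivative y) (at s within S) \<longleftrightarrow>
    (\<forall>i. ((\<lambda>s. x s $ i) has_vector_derivative y $ i) (at s within S))"
proof -
  have "(x has_derivative (\<lambda>h. h *\<^sub>R y)) (at s within S) \<longleftrightarrow>
    (\<forall>b\<in>Basis. ((\<lambda>s. x s \<bullet> b) has_derivative (\<lambda>h. (h *\<^sub>R y) \<bullet> b)) (at s within S))"
    by (rule has_derivative_componentwise_within)
  also have "\<dots> \<longleftrightarrow> (\<forall>i. ((\<lambda>s. x s $ i) has_derivative (\<lambda>h. h *\<^sub>R (y $ i))) (at s within S))"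
    by (simp add: Basis_vec_def inner_axis)
  finally show ?thesis by (simp add: has_vector_derivative_def)
qed

lemma milnor_flow_permute:
  assumes "bij p"
  shows "milnor_flow s (\<chi> i. a $ p i) = (\<chi> i. milnor_flow s a $ p i)"
proof -
  have "((\<lambda>s. \<chi> i. milnor_flow s a $ p i) has_vector_derivative
      milnor_field (\<chi> i. milnor_flow s a $ p i)) (at s)" for s
    unfolding milnor_field_permute[OF assms]
    using milnor_flow_has_vector_derivative[of a s] by (simp add: has_vector_derivative_cart)
  from milnor_flow_unique[OF this, of s] show ?thesis by simp
qed

lemma milnor_flow_add: "milnor_flow (s + t) a = milnor_flow s (milnor_flow t a)"
proof -
  have "((\<lambda>s. milnor_flow (s + t) a) has_vector_derivative milnor_field (milnor_flow (s + t) a)) (at s)" for s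
  proof -
    have "((\<lambda>s. s + t) has_vector_derivative 1) (at s)" by (auto intro!: derivative_eq_intros)
    from vector_diff_chain_at[OF this milnor_flow_has_vector_derivative] show ?thesis
      by (simp add: o_def)
  qed
  from milnor_flow_unique[OF this, of s] show ?thesis by simp
qed

lemma milnor_flow_nonzero:
  assumes "a \<noteq> 0"
  shows "milnor_flow s a \<noteq> 0"
proof
  assume "milnor_flow s a = 0"
  \<comment> \<open>Scaling by 0 shows that the origin is fixed, so flowing back from it cannot lead
    to a nonzero triple.\<close>
  moreover have "milnor_flow (- s) (0 *\<^sub>R 0) = 0 *\<^sub>R milnor_flow (- s) 0" by (rule milnor_flow_scale)
  moreover have "milnor_flow (- s) (milnor_flow s a) = a" by (simp flip: milnor_flow_add)
  ultimately show False using assms by simp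
qed

lemma milnor_flow_component:
  "((\<lambda>s. milnor_flow s a $ i) has_real_derivative milnor_field (milnor_flow s a) $ i) (at s)"
  using milnor_flow_has_vector_derivative[of a s]
  by (simp add: has_vector_derivative_cart has_real_derivative_iff_has_vector_derivative)

section \<open>Metric Lie algebras and Milnor frames\<close>

lemma UNIV_3_neq [simp]: "(1::3) \<noteq> 2" "(1::3) \<noteq> 3" "(2::3) \<noteq> 3" "(2::3) \<noteq> 1" "(3::3) \<noteq> 1" "(3::3) \<noteq> 2"
  by auto

lemma bilinear_diag_bracket: "bilinear (diag_bracket a)"
  by (auto simp: bilinear_def diag_bracket_def vec_eq_iff forall_3 cross3_def algebra_simps intro!: linearI)

lemma bilinear_inner: "bilinear ((\<bullet>) :: form)"
  by (auto simp: bilinear_def inner_add inner_diff intro!: linearI)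

lemma diag_bracket_mem:
  assumes "a \<noteq> 0"
  shows "(diag_bracket a, (\<bullet>)) \<in> metric_lie_algebras"
proof -
  have "lie_bracket (diag_bracket a)"
    unfolding lie_bracket_def using bilinear_diag_bracket
    by (auto simp: diag_bracket_def vec_eq_iff forall_3 cross3_def algebra_simps)
  moreover have "inner_product ((\<bullet>) :: form)"
    using bilinear_inner by (auto simp: inner_product_def inner_commute)
  moreover have "unimodular (diag_bracket a)"
    by (simp add: unimodular_def trace_def matrix_def sum_3 diag_bracket_def cross3_def axis_def)
  moreover have "nonabelian (diag_bracket a)"
  proof -
    obtain i where "a $ i \<noteq> 0" using assms by (auto simp: vec_eq_iff)
    then have "diag_bracket a (axis 2 1) (axis 3 1) \<noteq> 0 \<or> diag_bracket a (axis 3 1) (axis 1 1) \<noteq> 0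
        \<or> diag_bracket a (axis 1 1) (axis 2 1) \<noteq> 0"
      using exhaust_3[of i]
      by (auto simp: diag_bracket_def vec_eq_iff forall_3 cross3_def axis_def)
    then show ?thesis unfolding nonabelian_def by blast
  qed
  ultimately show ?thesis by (simp add: metric_lie_algebras_def)
qed

lemma bilinearD:
  assumes "bilinear f"
  shows "linear (f x)" "linear (\<lambda>x. f x y)"
  using assms by (auto simp: bilinear_def)

lemma alternating_skew:
  assumes "bilinear f" "\<And>x. f x x = 0"
  shows "f x y = - f y x"
proof -
  have "f (x + y) (x + y) = f x y + f y x"
    unfolding bilinear_ladd[OF assms(1)] bilinear_radd[OF assms(1)]
    by (simp add: assms(2)[of x] assms(2)[of y])
  then show ?thesis using assms(2)[of "x + y"] by (simp add: eq_neg_iff_add_eq_0)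
qed

lemma equiv_mla: "equiv metric_lie_algebras mla_equiv"
proof (rule equivI)
  show "mla_equiv \<subseteq> metric_lie_algebras \<times> metric_lie_algebras"
    by (auto simp: mla_equiv_def)
  show "refl_on metric_lie_algebras mla_equiv"
  proof (rule refl_onI, clarify)
    fix br Q assume "(br, Q) \<in> metric_lie_algebras"
    moreover have "linear id \<and> bij id \<and> (1::real) > 0 \<and> (\<forall>x y. id (br x y) = br (id x) (id y)) \<and>
        (\<forall>x y. Q x y = 1 * Q (id x) (id y))"
      using linear_id by auto
    ultimately show "((br, Q), (br, Q)) \<in> mla_equiv"
      unfolding mla_equiv_def by blast
  qed
  show "sym mla_equiv"
  proof (rule symI, clarify)
    fix br Q br' Q' assume "((br, Q), (br', Q')) \<in> mla_equiv"
    then obtain A c where m: "(br, Q) \<in> metric_lie_algebras" "(br', Q') \<in> metric_lie_algebras"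
      and A: "linear A" "bij A" "c > 0" "\<And>x y. A (br x y) = br' (A x) (A y)"
        "\<And>x y. Q x y = c * Q' (A x) (A y)" unfolding mla_equiv_def by auto
    have AB: "A (inv A x) = x" "inv A (A x) = x" for x
      using A(2) by (auto simp: bij_is_surj surj_f_inv_f bij_is_inj)
    have "linear (inv A)" using inj_linear_imp_inv_linear[OF A(1)] A(2) bij_is_inj by blast
    moreover have "bij (inv A)" using A(2) by (rule bij_imp_bij_inv)
    moreover have "inv A (br' x y) = br (inv A x) (inv A y)" for x y
      using A(4)[of "inv A x" "inv A y"] by (metis AB)
    moreover have "Q' x y = 1 / c * Q (inv A x) (inv A y)" for x y
      using A(5)[of "inv A x" "inv A y"] A(3) by (simp add: AB)
    moreover have "1 / c > 0" using A(3) by simp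
    ultimately show "((br', Q'), (br, Q)) \<in> mla_equiv"
      unfolding mla_equiv_def using m by blast
  qed
  show "trans mla_equiv"
  proof (rule transI, clarify)
    fix br Q br' Q' br'' Q''
    assume "((br, Q), (br', Q')) \<in> mla_equiv" "((br', Q'), (br'', Q'')) \<in> mla_equiv"
    then obtain A c A' c' where m: "(br, Q) \<in> metric_lie_algebras" "(br'', Q'') \<in> metric_lie_algebras"
      and A: "linear A" "bij A" "c > 0" "\<And>x y. A (br x y) = br' (A x) (A y)"
        "\<And>x y. Q x y = c * Q' (A x) (A y)"
      and A': "linear A'" "bij A'" "c' > 0" "\<And>x y. A' (br' x y) = br'' (A' x) (A' y)"
        "\<And>x y. Q' x y = c' * Q'' (A' x) (A' y)" unfolding mla_equiv_def by auto
    have "linear (A' \<circ> A)" "bij (A' \<circ> A)" "c * c' > 0"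
      "\<And>x y. (A' \<circ> A) (br x y) = br'' ((A' \<circ> A) x) ((A' \<circ> A) y)"
      "\<And>x y. Q x y = (c * c') * Q'' ((A' \<circ> A) x) ((A' \<circ> A) y)"
      using A A' by (auto intro: linear_compose bij_comp)
    then show "((br, Q), (br'', Q'')) \<in> mla_equiv"
      unfolding mla_equiv_def using m by blast
  qed
qed

lemma mla_class_of_eq_iff:
  assumes "(br, Q) \<in> metric_lie_algebras" "(br', Q') \<in> metric_lie_algebras"
  shows "mla_class_of br Q = mla_class_of br' Q' \<longleftrightarrow> ((br, Q), (br', Q')) \<in> mla_equiv"
  unfolding mla_class_of_def using eq_equiv_class_iff[OF equiv_mla assms] .

lemma mla_class_of_mem:
  "(br, Q) \<in> metric_lie_algebras \<Longrightarrow> mla_class_of br Q \<in> phase_space"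
  unfolding phase_space_def mla_class_of_def by (rule quotientI)

section \<open>Orthonormal frames as isomorphisms of metric Lie algebras\<close>

definition frame_map :: "(3 \<Rightarrow> real^3) \<Rightarrow> real^3 \<Rightarrow> real^3" where
  "frame_map e x = (\<Sum>i\<in>UNIV. x $ i *\<^sub>R e i)"

lemma linear_frame_map: "linear (frame_map e)"
  by (auto simp: frame_map_def algebra_simps sum.distrib scaleR_sum_right intro!: linearI)

lemma frame_map_axis [simp]: "frame_map e (axis i 1) = e i"
  using exhaust_3[of i] by (auto simp: frame_map_def sum_3 axis_def)

lemma frame_map_form:
  assumes Q: "inner_product Q" and e: "\<And>i j. Q (e i) (e j) = (if i = j then 1 else 0)"
  shows "Q (frame_map e x) (frame_map e y) = x \<bullet> y" "bij (frame_map e)"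
proof -
  have b: "bilinear Q" using Q by (simp add: inner_product_def)
  have 1: "Q (frame_map e x) (frame_map e y) = x \<bullet> y" for x y
    unfolding frame_map_def sum_3
    by (simp add: bilinear_ladd[OF b] bilinear_radd[OF b] bilinear_lmul[OF b] bilinear_rmul[OF b]
        e inner_vec_def sum_3 algebra_simps)
  show "Q (frame_map e x) (frame_map e y) = x \<bullet> y" by (rule 1)
  have "inj (frame_map e)"
  proof (subst linear_injective_0[OF linear_frame_map], intro allI impI)
    fix x assume "frame_map e x = 0"
    then have "x \<bullet> x = 0" using 1[of x x] bilinear_lzero[OF b] by simp
    then show "x = 0" by simp
  qed
  then show "bij (frame_map e)"
    using linear_injective_imp_surjective[OF linear_frame_map] by (auto simp: bij_def)
qed

lemma frame_map_bracket:
  assumes br: "lie_bracket br" and e: "br (e 2) (e 3) = a $ 1 *\<^sub>R e 1"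
    "br (e 3) (e 1) = a $ 2 *\<^sub>R e 2" "br (e 1) (e 2) = a $ 3 *\<^sub>R e 3"
  shows "br (frame_map e x) (frame_map e y) = frame_map e (diag_bracket a x y)"
proof -
  have b: "bilinear br" and z: "\<And>x. br x x = 0" using br by (auto simp: lie_bracket_def)
  note sk = alternating_skew[OF b z]
  show ?thesis
    unfolding frame_map_def sum_3
    by (simp add: bilinear_ladd[OF b] bilinear_radd[OF b] bilinear_lmul[OF b] bilinear_rmul[OF b]
        e z sk[of "e 3" "e 2"] sk[of "e 1" "e 3"] sk[of "e 2" "e 1"] diag_bracket_def cross3_def
        algebra_simps)
qed

text \<open>The frame map is an isomorphism, with factor 1, from the diagonal model with the dot
  product onto (br, Q). A vanishing triple would make the bracket abelian.\<close>

lemma milnor_frame_class: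
  assumes m: "(br, Q) \<in> metric_lie_algebras" and f: "milnor_frame br Q e a"
  shows "a \<noteq> 0" "mla_class_of br Q = triple_class a"
proof -
  have Q: "inner_product Q" and br: "lie_bracket br" using m by (auto simp: metric_lie_algebras_def)
  have e: "\<And>i j. Q (e i) (e j) = (if i = j then 1 else 0)" using f by (simp add: milnor_frame_def)
  note F = frame_map_form[OF Q e]
  have B: "br (frame_map e x) (frame_map e y) = frame_map e (diag_bracket a x y)" for x y
    using frame_map_bracket[OF br] f by (simp add: milnor_frame_def)
  show a: "a \<noteq> 0"
  proof
    assume "a = 0"
    then have "br (frame_map e x) (frame_map e y) = 0" for x y
      unfolding B by (simp add: diag_bracket_def frame_map_def)
    then have "br x y = 0" for x y using F(2) by (metis bij_pointE)
    then show False using m by (auto simp: metric_lie_algebras_def nonabelian_def)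
  qed
  have "((diag_bracket a, (\<bullet>)), (br, Q)) \<in> mla_equiv"
    unfolding mla_equiv_def mem_Collect_eq case_prod_conv
    using diag_bracket_mem[OF a] m linear_frame_map[of e] F B
    by (intro conjI exI[of _ "frame_map e"] exI[of _ 1]) auto
  then show "mla_class_of br Q = triple_class a"
    unfolding triple_class_def
    using mla_class_of_eq_iff[OF diag_bracket_mem[OF a] m] by simp
qed

subsection \<open>Existence of Milnor frames\<close>

text \<open>A maximiser of the quadratic form on the unit sphere of an invariant subspace is an
  eigenvector. Allowing a subspace S lets the argument be repeated on the orthogonal complement of
  the first eigenvector.\<close>

lemma symmetric_eigenvector:
  fixes T :: "'a::euclidean_space \<Rightarrow> 'a"
  assumes T: "linear T" and sym: "\<And>x y. T x \<bullet> y = x \<bullet> T y"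
    and S: "subspace S" "\<And>x. x \<in> S \<Longrightarrow> T x \<in> S" and nz: "w \<in> S" "w \<noteq> 0"
  obtains v l where "v \<in> S" "norm v = 1" "T v = l *\<^sub>R v"
proof -
  have "compact (S \<inter> sphere 0 1)" using closed_subspace[OF S(1)] by (intro closed_Int_compact) auto
  moreover have "(1 / norm w) *\<^sub>R w \<in> S \<inter> sphere 0 1"
    using nz S(1) by (auto simp: subspace_scale)
  then have "S \<inter> sphere 0 1 \<noteq> {}" by blast
  moreover have "continuous_on (S \<inter> sphere 0 1) (\<lambda>x. x \<bullet> T x)"
    using T by (intro continuous_intros linear_continuous_on) (simp add: linear_conv_bounded_linear)
  ultimately obtain v where "v \<in> S \<inter> sphere 0 1" "\<forall>x\<in>S \<inter> sphere 0 1. x \<bullet> T x \<le> v \<bullet> T v"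
    using continuous_attains_sup[of "S \<inter> sphere 0 1" "\<lambda>x. x \<bullet> T x"] by blast
  then have v: "v \<in> S" "norm v = 1"
    and max: "\<And>x. x \<in> S \<Longrightarrow> norm x = 1 \<Longrightarrow> x \<bullet> T x \<le> v \<bullet> T v" by auto
  define l where "l = v \<bullet> T v"
  have max': "x \<bullet> T x \<le> l * (x \<bullet> x)" if "x \<in> S" for x
  proof (cases "x = 0")
    case False
    have "((1 / norm x) *\<^sub>R x) \<bullet> T ((1 / norm x) *\<^sub>R x) \<le> l"
      unfolding l_def using that S(1) False by (intro max) (auto simp: subspace_scale)
    then have "(x \<bullet> T x) / (norm x * norm x) \<le> l" by (simp add: linear_scale[OF T])
    then show ?thesis using False by (simp add: dot_square_norm power2_eq_square field_simps)
  qed (simp add: linear_0[OF T])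
  \<comment> \<open>The residual of the eigenvalue equation is also the direction in which the
    maximiser v is varied; the first-order term of the variation is then |u|^2.\<close>
  define u where "u = l *\<^sub>R v - T v"
  have u: "u \<in> S" unfolding u_def using S v(1) by (simp add: subspace_diff subspace_scale)
  define q where "q = l * (u \<bullet> u) - u \<bullet> T u"
  have q: "q \<ge> 0" using max'[OF u] by (simp add: q_def)
  have quad: "0 \<le> 2 * t * (u \<bullet> u) + t\<^sup>2 * q" for t
  proof -
    have vv: "v \<bullet> v = 1" using v(2) by (simp add: dot_square_norm)
    have "v + t *\<^sub>R u \<in> S" using S v(1) u by (simp add: subspace_add subspace_scale)
    from max'[OF this] have "0 \<le> l * ((v + t *\<^sub>R u) \<bullet> (v + t *\<^sub>R u)) - (v + t *\<^sub>R u) \<bullet> T (v + t *\<^sub>R u)"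
      by simp
    also have "\<dots> = 2 * t * (l * (v \<bullet> u) - u \<bullet> T v) + t\<^sup>2 * q"
      using sym[of u v] vv
      by (simp add: linear_add[OF T] linear_scale[OF T] inner_add inner_commute q_def
          power2_eq_square algebra_simps l_def)
    also have "l * (v \<bullet> u) - u \<bullet> T v = u \<bullet> u"
      by (subst (3) u_def) (simp add: inner_diff_right inner_commute)
    finally show ?thesis .
  qed
  have "u \<bullet> u = 0"
  proof (rule ccontr)
    assume "u \<bullet> u \<noteq> 0"
    then have pos: "u \<bullet> u > 0" using inner_ge_zero[of u] by linarith
    \<comment> \<open>The sign makes the linear term of \<open>quad\<close> negative; the
      denominator q + 1 is positive even for q = 0 and keeps the quadratic term from outweighing
      it.\<close>
    define t where "t = - (u \<bullet> u) / (q + 1)"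
    have "0 \<le> (2 * t * (u \<bullet> u) + t\<^sup>2 * q) * (q + 1)\<^sup>2" using quad[of t] by simp
    also have "\<dots> = 2 * (t * (q + 1)) * (u \<bullet> u) * (q + 1) + (t * (q + 1))\<^sup>2 * q"
      by (simp add: power2_eq_square algebra_simps)
    also have "t * (q + 1) = - (u \<bullet> u)" using q by (simp add: t_def)
    also have "2 * - (u \<bullet> u) * (u \<bullet> u) * (q + 1) + (- (u \<bullet> u))\<^sup>2 * q = (u \<bullet> u)\<^sup>2 * (- q - 2)"
      by (simp add: power2_eq_square algebra_simps)
    finally show False using pos q by (simp add: zero_le_mult_iff)
  qed
  then show ?thesis using that[OF v, of l] by (simp add: u_def)
qed

lemma cross3_orthonormal_expansion:
  assumes "u \<bullet> u = 1" "v \<bullet> v = 1" "u \<bullet> v = 0"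
  shows "x = (x \<bullet> u) *\<^sub>R u + (x \<bullet> v) *\<^sub>R v + (x \<bullet> cross3 u v) *\<^sub>R cross3 u v"
proof -
  define w where "w = x - ((x \<bullet> u) *\<^sub>R u + (x \<bullet> v) *\<^sub>R v + (x \<bullet> cross3 u v) *\<^sub>R cross3 u v)"
  have c: "cross3 u v \<bullet> cross3 u v = 1" using assms by (simp add: dot_cross inner_commute)
  have w: "w \<bullet> u = 0" "w \<bullet> v = 0" "w \<bullet> cross3 u v = 0"
    unfolding w_def using assms c inner_commute[of u v]
    by (simp_all add: inner_diff_left inner_add_left dot_cross_self)
  \<comment> \<open>By Lagrange's formula the remainder w is parallel to \<open>cross3 u v\<close>,
    to which it is also orthogonal.\<close>
  then have "cross3 w (cross3 u v) = 0" by (simp add: Lagrange)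
  then have "w = 0" using w(3) c norm_and_cross_eq_0[of w "cross3 u v"] by auto
  then show ?thesis by (simp add: w_def)
qed

text \<open>Two orthonormal eigenvectors come from maximisation; symmetry makes their cross product
  an eigenvector as well. Choosing the cross product as third vector fixes the orientation that the
  cyclic bracket relations of a Milnor frame require.\<close>

lemma symmetric_eigenframe:
  fixes T :: "real^3 \<Rightarrow> real^3"
  assumes T: "linear T" and sym: "\<And>x y. T x \<bullet> y = x \<bullet> T y"
  obtains e :: "3 \<Rightarrow> real^3" and l :: "real^3" where "\<And>i j. e i \<bullet> e j = (if i = j then 1 else 0)"
    "\<And>i. T (e i) = l $ i *\<^sub>R e i" "cross3 (e 1) (e 2) = e 3" "cross3 (e 2) (e 3) = e 1"
    "cross3 (e 3) (e 1) = e 2"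
proof -
  obtain u l1 where u: "norm u = 1" "T u = l1 *\<^sub>R u"
    by (rule symmetric_eigenvector[OF T sym, of UNIV "axis 1 1"]) (auto simp: axis_eq_0_iff)
  have uu: "u \<bullet> u = 1" using u by (simp add: dot_square_norm)
  define S where "S = {x. u \<bullet> x = 0}"
  have S: "subspace S" unfolding S_def by (rule subspace_hyperplane)
  have TS: "T x \<in> S" if "x \<in> S" for x
    using that sym[of u x] u by (simp add: S_def)
  obtain w where w: "w \<in> S" "w \<noteq> 0"
    using cross_basis_nonzero[of u] uu by (force simp: S_def dot_cross_self)
  obtain v l2 where v: "v \<in> S" "norm v = 1" "T v = l2 *\<^sub>R v"
    by (rule symmetric_eigenvector[OF T sym S TS w])
  have vv: "v \<bullet> v = 1" "u \<bullet> v = 0" using v by (simp_all add: dot_square_norm S_def)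
  define c where "c = cross3 u v"
  have c: "c \<bullet> c = 1" "u \<bullet> c = 0" "v \<bullet> c = 0" using uu vv
    by (simp_all add: c_def dot_cross dot_cross_self inner_commute)
  have "T c = (T c \<bullet> u) *\<^sub>R u + (T c \<bullet> v) *\<^sub>R v + (T c \<bullet> c) *\<^sub>R c"
    unfolding c_def by (rule cross3_orthonormal_expansion[OF uu vv])
  also have "T c \<bullet> u = 0" using sym[of c u] u c by (simp add: inner_commute)
  also have "T c \<bullet> v = 0" using sym[of c v] v c by (simp add: inner_commute)
  finally have Tc: "T c = (T c \<bullet> c) *\<^sub>R c" by simp
  define e :: "3 \<Rightarrow> real^3" where "e i = (if i = 1 then u else if i = 2 then v else c)" for i
  have e: "e 1 = u" "e 2 = v" "e 3 = c" by (simp_all add: e_def)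
  have vu: "v \<bullet> u = 0" "c \<bullet> u = 0" "c \<bullet> v = 0" using vv c by (simp_all add: inner_commute)
  have "cross3 v c = u" unfolding c_def using uu vv vu by (simp add: Lagrange)
  moreover have "cross3 c u = v"
    using Lagrange[of u u v] uu vv cross_skew[of u c] by (simp add: c_def cross_skew[of "cross3 u v" u])
  moreover have "\<forall>i j. e i \<bullet> e j = (if i = j then 1 else 0)"
    using uu vv c vu by (simp add: forall_3 e)
  moreover have "\<forall>i. T (e i) = vector [l1, l2, T c \<bullet> c] $ i *\<^sub>R e i"
    using u v Tc by (simp add: forall_3 e)
  ultimately show ?thesis using that[of e "vector [l1, l2, T c \<bullet> c]"] e c_def by metis
qed

text \<open>The Gram operator of Q is symmetric with positive eigenvalues; its eigenvectors divided
  by the square roots of these are orthonormal for Q.\<close>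

lemma inner_product_orthonormal_frame:
  assumes Q: "inner_product Q"
  obtains f :: "3 \<Rightarrow> real^3" where "\<And>i j. Q (f i) (f j) = (if i = j then 1 else 0)"
proof -
  have b: "bilinear Q" and s: "\<And>x y. Q x y = Q y x" and p: "\<And>x. x \<noteq> 0 \<Longrightarrow> Q x x > 0"
    using Q by (auto simp: inner_product_def)
  define T :: "real^3 \<Rightarrow> real^3" where "T x = (\<chi> i. Q x (axis i 1))" for x
  have T: "linear T"
    by (auto simp: T_def vec_eq_iff bilinear_ladd[OF b] bilinear_lmul[OF b] intro!: linearI)
  have QT: "Q x y = T x \<bullet> y" for x y
  proof -
    have "y = frame_map (\<lambda>i. axis i 1) y"
      by (simp add: frame_map_def vec_eq_iff forall_3 sum_3 axis_def)
    then have "Q x y = Q x (frame_map (\<lambda>i. axis i 1) y)" by simp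
    then show ?thesis
      by (simp add: frame_map_def sum_3 bilinear_radd[OF b] bilinear_rmul[OF b] T_def inner_vec_def)
  qed
  have "T x \<bullet> y = x \<bullet> T y" for x y using s[of x y] by (simp add: QT inner_commute)
  from symmetric_eigenframe[OF T this] obtain e :: "3 \<Rightarrow> real^3" and l :: "real^3" where
    e: "\<And>i j. e i \<bullet> e j = (if i = j then 1 else 0)" and l: "\<And>i. T (e i) = l $ i *\<^sub>R e i" by metis
  have Qe: "Q (e i) (e j) = (if i = j then l $ i else 0)" for i j by (simp add: QT l e)
  have "l $ i > 0" for i
  proof -
    have "e i \<noteq> 0" using e[of i i] by auto
    then show ?thesis using p[of "e i"] Qe[of i i] by simp
  qed
  then have "Q ((1 / sqrt (l $ i)) *\<^sub>R e i) ((1 / sqrt (l $ j)) *\<^sub>R e j) = (if i = j then 1 else 0)" for i j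
    by (simp add: bilinear_lmul[OF b] bilinear_rmul[OF b] Qe less_imp_le order_less_imp_not_eq2)
  then show ?thesis by (rule that)
qed

lemma trace_conjugate:
  fixes f F :: "real^'n \<Rightarrow> real^'n"
  assumes "linear f" "linear F" "bij F"
  shows "trace (matrix (\<lambda>x. inv F (f (F x)))) = trace (matrix f)"
proof -
  have i: "linear (inv F)" using inj_linear_imp_inv_linear assms bij_is_inj by blast
  have "(\<lambda>x. inv F (f (F x))) = inv F \<circ> (f \<circ> F)" by auto
  then have "trace (matrix (\<lambda>x. inv F (f (F x)))) = trace (matrix (inv F) ** (matrix f ** matrix F))"
    using assms i by (simp add: matrix_compose linear_compose)
  also have "\<dots> = trace (matrix f ** (matrix F ** matrix (inv F)))"
    by (subst trace_mul_sym) (simp add: matrix_mul_assoc)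
  also have "matrix F ** matrix (inv F) = matrix (F \<circ> inv F)"
    using assms i by (simp add: matrix_compose)
  also have "F \<circ> inv F = id" using assms(3) bij_is_surj surj_iff by blast
  finally show ?thesis unfolding matrix_id_mat_1 by simp
qed

text \<open>Unimodularity says exactly that \<open>[x, y] = L (x \<times> y)\<close> with \<open>L\<close> symmetric; a Milnor frame is an
  eigenframe of \<open>L\<close>.\<close>

lemma milnor_frame_exists:
  assumes m: "(br, Q) \<in> metric_lie_algebras"
  obtains e a where "milnor_frame br Q e a"
proof -
  have Q: "inner_product Q" and br: "lie_bracket br" and un: "unimodular br"
    using m by (auto simp: metric_lie_algebras_def)
  have b: "bilinear br" and z: "\<And>x. br x x = 0" using br by (auto simp: lie_bracket_def)
  obtain f :: "3 \<Rightarrow> real^3" where f: "\<And>i j. Q (f i) (f j) = (if i = j then 1 else 0)"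
    using inner_product_orthonormal_frame[OF Q] by metis
  define F where "F = frame_map f"
  have F: "linear F" "bij F" "\<And>x y. Q (F x) (F y) = x \<bullet> y"
    using linear_frame_map frame_map_form[OF Q f] by (auto simp: F_def)
  have inv: "linear (inv F)" using inj_linear_imp_inv_linear F bij_is_inj by blast
  have FF: "F (inv F x) = x" "inv F (F x) = x" for x
    using F(2) by (auto simp: bij_is_surj surj_f_inv_f bij_is_inj)
  \<comment> \<open>In orthonormal coordinates Q becomes the dot product, so that the cross product
    and the spectral theorem apply to the bracket.\<close>
  define B where "B x y = inv F (br (F x) (F y))" for x y
  have B: "bilinear B"
    by (auto simp: bilinear_def B_def linear_add[OF F(1)] linear_add[OF inv] linear_scale[OF F(1)]
        linear_scale[OF inv] bilinear_ladd[OF b] bilinear_radd[OF b] bilinear_lmul[OF b]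
        bilinear_rmul[OF b] intro!: linearI)
  have Bz: "B x x = 0" for x by (simp add: B_def z linear_0[OF inv])
  note sk = alternating_skew[OF B Bz]
  have "trace (matrix (B x)) = 0" for x
    using trace_conjugate[OF bilinearD(1)[OF b] F(1,2), of "F x"] un
    unfolding unimodular_def B_def[abs_def] by simp
  then have tr: "B x (axis 1 1) $ 1 + B x (axis 2 1) $ 2 + B x (axis 3 1) $ 3 = 0" for x
    by (simp add: trace_def matrix_def sum_3)
  define L :: "real^3 \<Rightarrow> real^3" where "L x = x $ 1 *\<^sub>R B (axis 2 1) (axis 3 1) +
    x $ 2 *\<^sub>R B (axis 3 1) (axis 1 1) + x $ 3 *\<^sub>R B (axis 1 1) (axis 2 1)" for x
  have L: "linear L" by (auto simp: L_def algebra_simps intro!: linearI)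
  note sk' = sk[of "axis 3 1" "axis 2 1"] sk[of "axis 1 1" "axis 3 1"] sk[of "axis 2 1" "axis 1 1"]
  have BL: "B x y = L (cross3 x y)" for x y
  proof -
    have e: "w = w $ 1 *\<^sub>R axis 1 1 + w $ 2 *\<^sub>R axis 2 1 + w $ 3 *\<^sub>R axis 3 1" for w :: "real^3"
      by (simp add: vec_eq_iff forall_3 axis_def)
    have "B x y = B (x $ 1 *\<^sub>R axis 1 1 + x $ 2 *\<^sub>R axis 2 1 + x $ 3 *\<^sub>R axis 3 1)
       (y $ 1 *\<^sub>R axis 1 1 + y $ 2 *\<^sub>R axis 2 1 + y $ 3 *\<^sub>R axis 3 1)"
      using e[of x] e[of y] by simp
    then show ?thesis
      by (simp add: bilinear_ladd[OF B] bilinear_radd[OF B] bilinear_lmul[OF B] bilinear_rmul[OF B]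
          Bz sk' L_def cross3_def algebra_simps)
  qed
  have "L x \<bullet> y = x \<bullet> L y" for x y
    using tr[of "axis 1 1"] tr[of "axis 2 1"] tr[of "axis 3 1"]
    by (simp add: Bz sk' inner_vec_def sum_3 L_def algebra_simps)
  from symmetric_eigenframe[OF L this] obtain e :: "3 \<Rightarrow> real^3" and l :: "real^3" where
    e: "\<And>i j. e i \<bullet> e j = (if i = j then 1 else 0)" "\<And>i. L (e i) = l $ i *\<^sub>R e i"
      "cross3 (e 1) (e 2) = e 3" "cross3 (e 2) (e 3) = e 1" "cross3 (e 3) (e 1) = e 2" by metis
  have "br (F x) (F y) = F (L (cross3 x y))" for x y
    using BL[of x y] FF(1)[of "br (F x) (F y)"] by (simp add: B_def)
  then have "milnor_frame br Q (\<lambda>i. F (e i)) l"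
    by (simp add: milnor_frame_def F(3) e linear_scale[OF F(1)])
  then show ?thesis by (rule that)
qed

lemma phase_space_triple:
  assumes "p \<in> phase_space"
  obtains a where "a \<noteq> 0" "p = triple_class a"
proof -
  obtain br Q where m: "(br, Q) \<in> metric_lie_algebras" "p = mla_class_of br Q"
    using assms unfolding phase_space_def mla_class_of_def by (auto elim!: quotientE)
  obtain e a where "milnor_frame br Q e a" using milnor_frame_exists[OF m(1)] .
  from milnor_frame_class[OF m(1) this] m(2) that show ?thesis by blast
qed

lemma triple_class_mem: "a \<noteq> 0 \<Longrightarrow> triple_class a \<in> phase_space"
  unfolding triple_class_def by (rule mla_class_of_mem[OF diag_bracket_mem])

subsection \<open>Coordinates on the phase space\<close>

definition similar_triples :: "real^3 \<Rightarrow> real^3 \<Rightarrow> bool" where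
  "similar_triples a b \<longleftrightarrow> (\<exists>c p. c \<noteq> 0 \<and> bij p \<and> b = c *\<^sub>R (\<chi> i. a $ p i))"

lemma similar_triples_sym: "similar_triples a b \<Longrightarrow> similar_triples b a"
proof -
  assume "similar_triples a b"
  then obtain c p where c: "c \<noteq> 0" "bij p" "b = c *\<^sub>R (\<chi> i. a $ p i)"
    by (auto simp: similar_triples_def)
  have "a = (1 / c) *\<^sub>R (\<chi> i. b $ inv p i)"
    using c by (simp add: vec_eq_iff bij_is_surj surj_f_inv_f)
  moreover have "1 / c \<noteq> 0" "bij (inv p)" using c bij_imp_bij_inv by auto
  ultimately show ?thesis unfolding similar_triples_def by blast
qed

lemma similar_triples_trans:
  "similar_triples a b \<Longrightarrow> similar_triples b d \<Longrightarrow> similar_triples a d"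
proof -
  assume "similar_triples a b" "similar_triples b d"
  then obtain c p c' p' where c: "c \<noteq> 0" "bij p" "b = c *\<^sub>R (\<chi> i. a $ p i)"
    "c' \<noteq> 0" "bij p'" "d = c' *\<^sub>R (\<chi> i. b $ p' i)"
    by (auto simp: similar_triples_def)
  have "d = (c' * c) *\<^sub>R (\<chi> i. a $ (p \<circ> p') i)" using c by (simp add: vec_eq_iff)
  moreover have "c' * c \<noteq> 0" "bij (p \<circ> p')" using c bij_comp by auto
  ultimately show ?thesis unfolding similar_triples_def by blast
qed

lemma similar_triples_nonzero: "similar_triples a b \<Longrightarrow> a \<noteq> 0 \<Longrightarrow> b \<noteq> 0"
proof
  assume "similar_triples a b" "a \<noteq> 0" "b = 0"
  then obtain c p where c: "c \<noteq> 0" "bij p" "b = c *\<^sub>R (\<chi> i. a $ p i)"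
    by (auto simp only: similar_triples_def)
  have c3: "a $ p i = 0" for i
    using arg_cong[OF c(3), of "\<lambda>x. x $ i"] c(1) \<open>b = 0\<close> by simp
  then have "a $ i = 0" for i using c3[of "inv p i"] c(2) by (simp add: bij_is_surj surj_f_inv_f)
  then show False using \<open>a \<noteq> 0\<close> by (simp add: vec_eq_iff)
qed

lemma similar_triples_flow:
  "similar_triples a b \<Longrightarrow> similar_triples (milnor_flow s a) (milnor_flow s b)"
proof -
  assume "similar_triples a b"
  then obtain c p where c: "c \<noteq> 0" "bij p" "b = c *\<^sub>R (\<chi> i. a $ p i)"
    by (auto simp: similar_triples_def)
  then have "milnor_flow s b = c *\<^sub>R (\<chi> i. milnor_flow s a $ p i)"
    by (simp add: milnor_flow_scale milnor_flow_permute)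
  with c show ?thesis unfolding similar_triples_def by blast
qed

text \<open>A coordinate permutation P is orthogonal with determinant s = 1 or s = - 1, and it
  commutes with the cross product up to s. The multiple (s / c) P therefore absorbs both the sign of
  an odd permutation and the scalar c, and it scales the inner product by a positive factor.\<close>

lemma similar_triple_class:
  assumes "similar_triples a b" and a: "a \<noteq> 0"
  shows "triple_class a = triple_class b"
proof -
  obtain c p where c: "c \<noteq> 0" and p: "bij p" and b: "b = c *\<^sub>R (\<chi> i. a $ p i)"
    using assms(1) by (auto simp: similar_triples_def)
  have b0: "b \<noteq> 0" using similar_triples_nonzero[OF assms] .
  define P :: "real^3 \<Rightarrow> real^3" where "P x = (\<chi> i. x $ p i)" for x
  have lP: "linear P" by (auto simp: P_def vec_eq_iff intro!: linearI)
  have ip: "P x \<bullet> P y = x \<bullet> y" for x y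
    using sum.reindex_bij_betw[of p UNIV UNIV "\<lambda>i. x $ i * y $ i"] p
    by (simp add: P_def inner_vec_def)
  have oP: "orthogonal_transformation P" using lP ip by (simp add: orthogonal_transformation_def)
  have bijP: "bij P" using orthogonal_transformation_bij[OF oP] .
  define s where "s = det (matrix P)"
  have om: "orthogonal_matrix (matrix P)"
    using oP orthogonal_transformation_matrix by blast
  have s: "s * s = 1" using det_orthogonal_matrix[OF om] by (auto simp: s_def)
  have cr: "cross3 (P x) (P y) = s *\<^sub>R P (cross3 x y)" for x y
    using cross_orthogonal_matrix[OF om, of x y] lP by (simp add: matrix_works s_def)
  define A where "A x = (s / c) *\<^sub>R P x" for x
  have s0: "s \<noteq> 0" using s by auto
  have k: "s / c \<noteq> 0" using s0 c by simp
  have "linear A" unfolding A_def[abs_def] using lP by (intro linear_compose_scale_right)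
  moreover have "bij A"
  proof -
    have "A = (\<lambda>x. (s / c) *\<^sub>R x) \<circ> P" by (auto simp: A_def)
    moreover have "bij (\<lambda>x::real^3. (s / c) *\<^sub>R x)"
      using k by (intro o_bij[where g = "\<lambda>x. (c / s) *\<^sub>R x"]) auto
    ultimately show ?thesis using bijP bij_comp by metis
  qed
  moreover have "A (diag_bracket a x y) = diag_bracket b (A x) (A y)" for x y
  proof -
    have "diag_bracket b (A x) (A y) $ i = (s / c) * (s * s) * (a $ p i * cross3 x y $ p i)" for i
      using c by (simp add: A_def diag_bracket_def cross_mult_left cross_mult_right cr b)
        (simp add: P_def field_simps)
    then show ?thesis unfolding s by (simp add: vec_eq_iff A_def P_def diag_bracket_def)
  qed
  moreover have "x \<bullet> y = (c / s)\<^sup>2 * (A x \<bullet> A y)" for x y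
    using c s0 by (simp add: A_def ip power2_eq_square)
  moreover have "(c / s)\<^sup>2 > 0" using c s0 by simp
  ultimately have "((diag_bracket a, (\<bullet>)), (diag_bracket b, (\<bullet>))) \<in> mla_equiv"
    unfolding mla_equiv_def using diag_bracket_mem a b0 by blast
  then show ?thesis
    unfolding triple_class_def using mla_class_of_eq_iff diag_bracket_mem a b0 by simp
qed

text \<open>An isomorphism of the metric Lie algebras is a multiple of an orthogonal matrix that
  conjugates the two diagonal matrices up to a factor, whence their characteristic polynomials
  agree.\<close>

lemma triple_class_eq_charpoly:
  assumes "triple_class a = triple_class b" and a: "a \<noteq> 0" and b: "b \<noteq> 0"
  obtains l where "l \<noteq> 0"
    "\<And>x. (a $ 1 - x) * (a $ 2 - x) * (a $ 3 - x) = (l * b $ 1 - x) * (l * b $ 2 - x) * (l * b $ 3 - x)"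
proof -
  have "((diag_bracket a, (\<bullet>)), (diag_bracket b, (\<bullet>))) \<in> mla_equiv"
    using assms mla_class_of_eq_iff diag_bracket_mem by (simp add: triple_class_def)
  then obtain A c where A: "linear A" and c: "c > 0"
    and br: "\<And>x y. A (diag_bracket a x y) = diag_bracket b (A x) (A y)"
    and ip: "\<And>x y. x \<bullet> y = c * (A x \<bullet> A y)" unfolding mla_equiv_def by auto
  define P where "P x = sqrt c *\<^sub>R A x" for x
  have lP: "linear P" unfolding P_def[abs_def] using A by (intro linear_compose_scale_right)
  have "P x \<bullet> P y = x \<bullet> y" for x y using ip[of x y] c by (simp add: P_def)
  then have oP: "orthogonal_transformation P" using lP by (simp add: orthogonal_transformation_def)
  define M where "M = matrix P"
  have M: "M *v x = P x" for x unfolding M_def using lP by (simp add: matrix_works)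
  have om: "orthogonal_matrix M"
    unfolding M_def using oP orthogonal_transformation_matrix by blast
  define s where "s = det M"
  have s: "s \<noteq> 0" using det_orthogonal_matrix[OF om] by (auto simp: s_def)
  have cr: "cross3 (P x) (P y) = s *\<^sub>R P (cross3 x y)" for x y
    using cross_orthogonal_matrix[OF om, of x y] by (simp add: M s_def)
  define l where "l = s / sqrt c"
  define D where "D d = (\<chi> i j. if i = j then d $ i else 0 :: real^3^3)" for d :: "real^3"
  have D: "D d *v x = (\<chi> i. d $ i * x $ i)" for d x
    by (simp add: D_def vec_eq_iff matrix_vector_mult_def forall_3 sum_3)
  have dA: "A x = (1 / sqrt c) *\<^sub>R P x" for x using c by (simp add: P_def)
  have key: "P (D a *v (cross3 x y)) = l *\<^sub>R (D b *v P (cross3 x y))" for x y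
  proof -
    have "P (D a *v (cross3 x y)) = sqrt c *\<^sub>R A (diag_bracket a x y)"
      by (simp add: P_def D diag_bracket_def)
    also have "\<dots> = sqrt c *\<^sub>R (D b *v cross3 (A x) (A y))"
      unfolding br D by (simp add: diag_bracket_def)
    also have "cross3 (A x) (A y) = (1 / c * s) *\<^sub>R P (cross3 x y)"
      using c by (simp add: dA cross_mult_left cross_mult_right cr)
    also have "sqrt c *\<^sub>R (D b *v ((1 / c * s) *\<^sub>R P (cross3 x y)))
        = (sqrt c * (1 / c * s)) *\<^sub>R (D b *v P (cross3 x y))"
      by (simp add: matrix_vector_mult_scaleR)
    also have "sqrt c * (1 / c * s) = l"
      using c by (simp add: l_def field_simps)
    finally show ?thesis .
  qed
  have DS: "D (c *\<^sub>R d) *v z = c *\<^sub>R (D d *v z)" for c d z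
    by (simp add: D vec_eq_iff)
  have MD: "M ** D a = D (l *\<^sub>R b) ** M"
  proof -
    have "column i (M ** D a) = column i (D (l *\<^sub>R b) ** M)" for i
    proof -
      have "\<exists>x y. axis i (1::real) = cross3 x y" using exhaust_3[of i] cross_basis by metis
      then obtain x y where "axis i (1::real) = cross3 x y" by blast
      then have "(M ** D a) *v axis i 1 = (D (l *\<^sub>R b) ** M) *v axis i 1"
        using key[of x y] unfolding matrix_vector_mul_assoc[symmetric] M
        by (metis (no_types, lifting) DS)
      then show ?thesis by (simp only: matrix_vector_mult_basis)
    qed
    then show ?thesis by (simp add: vec_eq_iff column_def)
  qed
  have "(a $ 1 - x) * (a $ 2 - x) * (a $ 3 - x)
      = (l * b $ 1 - x) * (l * b $ 2 - x) * (l * b $ 3 - x)" for x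
  proof -
    have Dx: "D (d - x *\<^sub>R 1) = D d - x *\<^sub>R mat 1" for d
      by (simp add: D_def vec_eq_iff mat_def)
    have dD: "det (D d) = d $ 1 * d $ 2 * d $ 3" for d
      by (simp add: D_def det_3)
    have "M ** (x *\<^sub>R mat 1) = (x *\<^sub>R mat 1) ** M"
      by (metis matrix_mul_lid matrix_mul_rid matrix_scalar_ac scalar_matrix_assoc)
    then have "M ** D (a - x *\<^sub>R 1) = D (l *\<^sub>R b - x *\<^sub>R 1) ** M"
      unfolding Dx using MD
      by (simp add: vec_eq_iff matrix_matrix_mult_def left_diff_distrib right_diff_distrib
          sum_subtractf)
    then have "s * det (D (a - x *\<^sub>R 1)) = det (D (l *\<^sub>R b - x *\<^sub>R 1)) * s"
      unfolding s_def by (metis det_mul)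
    then show ?thesis using s by (simp add: dD)
  qed
  moreover have "l \<noteq> 0" using s c by (simp add: l_def)
  ultimately show ?thesis using that by blast
qed

text \<open>Each root of one cubic is a root of the other, so the largest roots bound each other,
  and so do the smallest.\<close>

lemma monic_cubic_roots_sorted:
  fixes p q r :: real
  assumes "p \<ge> q" "q \<ge> r" "p' \<ge> q'" "q' \<ge> r'"
    and eq: "\<And>x. (p - x) * (q - x) * (r - x) = (p' - x) * (q' - x) * (r' - x)"
  shows "p = p'" "q = q'" "r = r'"
proof -
  have "p = p' \<or> p = q' \<or> p = r'" using eq[of p] by auto
  moreover have "p = p' \<or> q = p' \<or> r = p'" using eq[of p'] by auto
  ultimately show p: "p = p'" using assms(1-4) by linarith
  have "r = p' \<or> r = q' \<or> r = r'" using eq[of r] by auto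
  moreover have "r' = p \<or> r' = q \<or> r' = r" using eq[of r'] by auto
  ultimately show r: "r = r'" using assms(1-4) by linarith
  \<comment> \<open>A point beyond p and r, where the two linear factors already matched can be
    cancelled.\<close>
  define x where "x = p + 1 + \<bar>r\<bar> + \<bar>p\<bar>"
  have "p - x \<noteq> 0" "r - x \<noteq> 0" by (auto simp: x_def)
  then show "q = q'" using eq[of x] unfolding p[symmetric] r[symmetric] by simp
qed

lemma similar_triples_vector:
  assumes "i \<noteq> j" "j \<noteq> k" "i \<noteq> k" and a: "a $ i \<noteq> 0"
  shows "similar_triples a (vector [1, a $ j / a $ i, a $ k / a $ i])"
proof -
  define p :: "3 \<Rightarrow> 3" where "p l = (if l = 1 then i else if l = 2 then j else k)" for l
  have p: "p 1 = i" "p 2 = j" "p 3 = k" by (simp_all add: p_def)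
  have "inj p" using assms(1-3) by (auto simp: inj_def forall_3 p)
  then have "bij p" by (simp add: bij_def finite_UNIV_inj_surj)
  moreover have "vector [1, a $ j / a $ i, a $ k / a $ i] = (1 / a $ i) *\<^sub>R (\<chi> l. a $ p l)"
    using a by (simp add: vec_eq_iff forall_3 p)
  moreover have "1 / a $ i \<noteq> 0" using a by simp
  ultimately show ?thesis unfolding similar_triples_def by blast
qed

text \<open>Sort the entries. If the middle one is nonnegative and the largest positive, divide by
  the largest; otherwise the smallest is negative, and dividing by it reverses the order.\<close>

lemma similar_triples_S_m:
  assumes "a \<noteq> 0"
  obtains m2 m3 where "(m2, m3) \<in> S_m" "similar_triples a (vector [1, m2, m3])"
proof -
  note result = that
  have main: thesis if ijk: "i \<noteq> j" "j \<noteq> k" "i \<noteq> k" and le: "a $ i \<ge> a $ j" "a $ j \<ge> a $ k" for i j k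
  proof -
    have nz: "\<not> (a $ i = 0 \<and> a $ j = 0 \<and> a $ k = 0)"
    proof
      assume *: "a $ i = 0 \<and> a $ j = 0 \<and> a $ k = 0"
      have "l = i \<or> l = j \<or> l = k" for l
        using ijk exhaust_3[of i] exhaust_3[of j] exhaust_3[of k] exhaust_3[of l] by auto
      then have "a $ l = 0" for l using * by metis
      then show False using assms by (simp add: vec_eq_iff)
    qed
    show thesis
    proof (cases "a $ j \<ge> 0 \<and> a $ i > 0")
      case True
      then have "(a $ j / a $ i, a $ k / a $ i) \<in> S_m"
        using le by (auto simp: S_m_def divide_right_mono)
      moreover have "similar_triples a (vector [1, a $ j / a $ i, a $ k / a $ i])"
        using True by (intro similar_triples_vector ijk) simp
      ultimately show thesis by (rule result)
    next
      case False
      then have "a $ k < 0" using le nz by linarith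
      moreover from this have "a $ j \<le> 0" using False le by linarith
      ultimately have "(a $ j / a $ k, a $ i / a $ k) \<in> S_m"
        using le by (auto simp: S_m_def divide_simps)
      moreover have "similar_triples a (vector [1, a $ j / a $ k, a $ i / a $ k])"
        using \<open>a $ k < 0\<close> ijk by (intro similar_triples_vector) auto
      ultimately show thesis by (rule result)
    qed
  qed
  consider "a $ 1 \<ge> a $ 2" "a $ 2 \<ge> a $ 3" | "a $ 1 \<ge> a $ 3" "a $ 3 \<ge> a $ 2"
    | "a $ 2 \<ge> a $ 1" "a $ 1 \<ge> a $ 3" | "a $ 2 \<ge> a $ 3" "a $ 3 \<ge> a $ 1"
    | "a $ 3 \<ge> a $ 1" "a $ 1 \<ge> a $ 2" | "a $ 3 \<ge> a $ 2" "a $ 2 \<ge> a $ 1" by linarith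
  then show thesis
    by cases (use main[of 1 2 3] main[of 1 3 2] main[of 2 1 3] main[of 2 3 1] main[of 3 1 2]
      main[of 3 2 1] in auto)
qed

lemma vector_1_nonzero [simp]: "vector [1, m2, m3] \<noteq> (0 :: real^3)"
proof
  assume "vector [1, m2, m3] = (0 :: real^3)"
  then have "(vector [1, m2, m3] :: real^3) $ 1 = 0 $ 1" by simp
  then show False by simp
qed

text \<open>Equal classes have equal cubics up to a factor l. A positive l preserves the order of
  the roots and must be 1. A negative l reverses the order, so that m2 \<ge> 0 equals
  \<open>l * n2\<close> \<le> 0; this is possible only on the edge where both middle entries
  vanish.\<close>

lemma proj_eq_iff:
  assumes m: "(m2, m3) \<in> S_m" and n: "(n2, n3) \<in> S_m"
  shows "proj (Some (m2, m3)) = proj (Some (n2, n3)) \<longleftrightarrow>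
    (m2, m3) = (n2, n3) \<or> m2 = 0 \<and> n2 = 0 \<and> m3 * n3 = 1"
proof
  assume "proj (Some (m2, m3)) = proj (Some (n2, n3))"
  then have "triple_class (vector [1, m2, m3]) = triple_class (vector [1, n2, n3])" by simp
  then obtain l where l: "l \<noteq> 0"
    and eq: "\<And>x. (1 - x) * (m2 - x) * (m3 - x) = (l * 1 - x) * (l * n2 - x) * (l * n3 - x)"
    by (rule triple_class_eq_charpoly) auto
  have mn: "0 \<le> m2" "m2 \<le> 1" "m3 \<le> m2" "0 \<le> n2" "n2 \<le> 1" "n3 \<le> n2"
    using m n by (auto simp: S_m_def)
  show "(m2, m3) = (n2, n3) \<or> m2 = 0 \<and> n2 = 0 \<and> m3 * n3 = 1"
  proof (cases "l > 0")
    case True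
    have "1 = l * 1" "m2 = l * n2" "m3 = l * n3"
      by (rule monic_cubic_roots_sorted[OF _ _ _ _ eq]; use mn True in simp)+
    then show ?thesis by simp
  next
    case False
    have eq': "(1 - x) * (m2 - x) * (m3 - x) = (l * n3 - x) * (l * n2 - x) * (l * 1 - x)" for x
      using eq[of x] by (simp add: mult_ac)
    have *: "1 = l * n3" "m2 = l * n2" "m3 = l * 1"
      by (rule monic_cubic_roots_sorted[OF _ _ _ _ eq']; use mn False l in \<open>simp add: mult_le_cancel_left\<close>)+
    have "l * n2 \<le> 0" using False mn by (simp add: mult_le_0_iff)
    then have "m2 = 0" using * mn by linarith
    then show ?thesis using * l by auto
  qed
next
  assume "(m2, m3) = (n2, n3) \<or> m2 = 0 \<and> n2 = 0 \<and> m3 * n3 = 1"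
  then show "proj (Some (m2, m3)) = proj (Some (n2, n3))"
  proof
    assume *: "m2 = 0 \<and> n2 = 0 \<and> m3 * n3 = 1"
    then have "m3 \<noteq> 0" by auto
    with * have "n3 = 1 / m3" by (simp add: field_simps)
    with \<open>m3 \<noteq> 0\<close> have "similar_triples (vector [1, m2, m3]) (vector [1, n2, n3])"
      using similar_triples_vector[of 3 2 1 "vector [1, m2, m3]"] * by simp
    then show ?thesis by (simp add: similar_triple_class)
  qed auto
qed

text \<open>Both triples are moved into \<open>S_m\<close>, where equality of classes is already
  decided. The exceptional pair (0, m3), (0, 1 / m3) comes from exchanging the first and third
  entries and rescaling.\<close>

lemma triple_class_eq_iff:
  assumes a: "a \<noteq> 0" and b: "b \<noteq> 0"
  shows "triple_class a = triple_class b \<longleftrightarrow> similar_triples a b"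
proof
  assume eq: "triple_class a = triple_class b"
  obtain m2 m3 where m: "(m2, m3) \<in> S_m" "similar_triples a (vector [1, m2, m3])"
    using similar_triples_S_m[OF a] .
  obtain n2 n3 where n: "(n2, n3) \<in> S_m" "similar_triples b (vector [1, n2, n3])"
    using similar_triples_S_m[OF b] .
  have "proj (Some (m2, m3)) = proj (Some (n2, n3))"
    using similar_triple_class[OF m(2) a] similar_triple_class[OF n(2) b] eq by simp
  then consider "(m2, m3) = (n2, n3)" | "m2 = 0" "n2 = 0" "m3 * n3 = 1"
    using proj_eq_iff[OF m(1) n(1)] by blast
  then have "similar_triples (vector [1, m2, m3]) (vector [1, n2, n3])"
  proof cases
    case 1
    then show ?thesis using similar_triples_sym similar_triples_trans m(2) by blast
  next
    case 2
    then have "m3 \<noteq> 0" by auto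
    with 2 have "n3 = 1 / m3" by (simp add: field_simps)
    with \<open>m3 \<noteq> 0\<close> show ?thesis
      using similar_triples_vector[of 3 2 1 "vector [1, m2, m3]"] 2 by simp
  qed
  then show "similar_triples a b"
    using m(2) n(2) similar_triples_sym similar_triples_trans by blast
next
  assume "similar_triples a b"
  then show "triple_class a = triple_class b" using similar_triple_class a by blast
qed

lemma phase_space_eq: "phase_space = proj ` Some ` S_m"
proof
  show "phase_space \<subseteq> proj ` Some ` S_m"
  proof
    fix p assume "p \<in> phase_space"
    then obtain a where a: "a \<noteq> 0" "p = triple_class a" by (rule phase_space_triple)
    obtain m2 m3 where m: "(m2, m3) \<in> S_m" "similar_triples a (vector [1, m2, m3])"
      using similar_triples_S_m[OF a(1)] .
    then have "p = proj (Some (m2, m3))" using similar_triple_class a by simp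
    then show "p \<in> proj ` Some ` S_m" using m(1) by blast
  qed
  show "proj ` Some ` S_m \<subseteq> phase_space" by (auto intro!: triple_class_mem)
qed

section \<open>Ricci flow in a Milnor frame\<close>

text \<open>The principal Ricci curvatures in a Milnor frame with structure constants a.\<close>

definition milnor_ricci :: "real^3 \<Rightarrow> real^3" where
  "milnor_ricci a = vector [((a $ 1)\<^sup>2 - (a $ 2 - a $ 3)\<^sup>2) / 2, ((a $ 2)\<^sup>2 - (a $ 3 - a $ 1)\<^sup>2) / 2,
     ((a $ 3)\<^sup>2 - (a $ 1 - a $ 2)\<^sup>2) / 2]"

text \<open>The Levi-Civita connection in coordinates of a Milnor frame: differentiating along a
  basis vector is a rotation about it, and the coefficients are Milnor's mu_i = (a_1 + a_2 + a_3) /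
  2 - a_i.\<close>

definition milnor_connection :: "real^3 \<Rightarrow> bracket" where
  "milnor_connection a x y = cross3 (\<chi> i. ((\<Sum>j\<in>UNIV. a $ j) / 2 - a $ i) * x $ i) y"

lemma bilinear_milnor_connection: "bilinear (milnor_connection a)"
proof -
  define L :: "real^3 \<Rightarrow> real^3" where "L x = (\<chi> i. ((\<Sum>j\<in>UNIV. a $ j) / 2 - a $ i) * x $ i)" for x
  have "L (x + y) = L x + L y" "L (c *\<^sub>R x) = c *\<^sub>R L x" for x y c
    by (simp_all add: L_def vec_eq_iff distrib_left)
  then show ?thesis
    by (simp add: bilinear_def milnor_connection_def cross_add_left cross_add_right cross_mult_left
        cross_mult_right linearI flip: L_def)
qed

text \<open>With principal curvatures r_i, Ricci flow gives a_i' = a_i (r_j + r_k - r_i). The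
  denominator is the change of time made in \<open>ricci_trajectory\<close>.\<close>

lemma milnor_field_ricci:
  "milnor_field a $ i = a $ i * ((\<Sum>j\<in>UNIV. milnor_ricci a $ j) - 2 * milnor_ricci a $ i) / (a \<bullet> a)"
proof (cases "a = 0")
  case False
  then have "a \<bullet> a \<noteq> 0" by simp
  then show ?thesis
    using exhaust_3[of i]
    by (auto simp: milnor_field_def milnor_ricci_def sum_3 field_simps inner_vec_def power2_eq_square)
qed simp

lemma milnor_field_ricci_divide:
  "milnor_field a $ i =
    a $ i * ((\<Sum>j\<in>UNIV. milnor_ricci a $ j / (a \<bullet> a)) - 2 * (milnor_ricci a $ i / (a \<bullet> a)))"
  unfolding milnor_field_ricci sum_divide_distrib[symmetric] by argo

locale framed_mla =
  fixes br :: bracket and Q :: form and e :: "3 \<Rightarrow> real^3" and a :: "real^3"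
  assumes mla: "(br, Q) \<in> metric_lie_algebras" and frame: "milnor_frame br Q e a"
begin

abbreviation "F \<equiv> frame_map e"

lemma inner_product: "inner_product Q" and lie: "lie_bracket br"
  using mla by (auto simp: metric_lie_algebras_def)

lemma orthonormal: "Q (e i) (e j) = (if i = j then 1 else 0)"
  using frame by (simp add: milnor_frame_def)

lemma bil: "bilinear Q" "bilinear br"
  using inner_product lie by (auto simp: inner_product_def lie_bracket_def)

lemma form_F: "Q (F x) (F y) = x \<bullet> y" and bij_F: "bij F"
  using frame_map_form[OF inner_product orthonormal] by auto

lemma bracket_F: "br (F x) (F y) = F (diag_bracket a x y)"
  using frame_map_bracket[OF lie] frame by (simp add: milnor_frame_def)

lemma F_inv: "F (inv F x) = x" "inv F (F x) = x"
  using bij_F by (auto simp: bij_is_surj surj_f_inv_f bij_is_inj)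

text \<open>Q is nondegenerate, so the Koszul formula has at most one solution; the explicit
  connection satisfies it.\<close>

lemma levi_civita_F: "levi_civita br Q (F x) (F y) = F (milnor_connection a x y)"
  unfolding levi_civita_def
proof (rule the_equality)
  have *: "2 * Q (F (milnor_connection a x y)) (F z) =
      Q (br (F x) (F y)) (F z) - Q (br (F y) (F z)) (F x) + Q (br (F z) (F x)) (F y)" for z
    unfolding bracket_F form_F
    by (simp add: inner_vec_def sum_3 diag_bracket_def milnor_connection_def cross3_def field_simps)
  then show "\<forall>z. 2 * Q (F (milnor_connection a x y)) z =
      Q (br (F x) (F y)) z - Q (br (F y) z) (F x) + Q (br z (F x)) (F y)"
    by (metis F_inv(1))
  fix w assume w: "\<forall>z. 2 * Q w z =
      Q (br (F x) (F y)) z - Q (br (F y) z) (F x) + Q (br z (F x)) (F y)"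
  define v where "v = w - F (milnor_connection a x y)"
  have "Q v (F z) = 0" for z
    using w[rule_format, of "F z"] *[of z] by (simp add: v_def bilinear_lsub[OF bil(1)])
  then have "Q v v = 0" by (metis F_inv(1))
  then have "v = 0" using inner_product unfolding inner_product_def by (metis less_irrefl)
  then show "w = F (milnor_connection a x y)" by (simp add: v_def)
qed

text \<open>The frame map conjugates the curvature endomorphism to the one of the diagonal model,
  and conjugation preserves the trace.\<close>

lemma ricci_F: "ricci br Q (F y) (F z) = (\<Sum>i\<in>UNIV. milnor_ricci a $ i * y $ i * z $ i)"
proof -
  define C where "C x = milnor_connection a x (milnor_connection a y z)
    - milnor_connection a y (milnor_connection a x z) - milnor_connection a (diag_bracket a x y) z" for x
  have lF: "linear F" by (rule linear_frame_map)
  have cF: "curvature br Q (F x) (F y) (F z) = F (C x)" for x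
    unfolding curvature_def bracket_F levi_civita_F C_def by (simp add: linear_diff[OF lF])
  have "(\<lambda>x. curvature br Q x (F y) (F z)) = F \<circ> C \<circ> inv F"
    using cF[of "inv F x" for x] by (simp add: fun_eq_iff F_inv)
  moreover have "linear C"
    unfolding C_def[abs_def] using bilinear_milnor_connection[of a] bilinear_diag_bracket[of a]
    by (auto simp: bilinear_ladd bilinear_radd bilinear_lmul bilinear_rmul algebra_simps intro!: linearI)
  moreover have "linear (inv F)" using inj_linear_imp_inv_linear[OF lF] bij_F bij_is_inj by blast
  ultimately have "linear (\<lambda>x. curvature br Q x (F y) (F z))"
    using lF by (simp add: linear_compose)
  from trace_conjugate[OF this lF bij_F]
  have "ricci br Q (F y) (F z) = trace (matrix C)"
    unfolding ricci_def cF F_inv by simp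
  also have "\<dots> = (\<Sum>i\<in>UNIV. milnor_ricci a $ i * y $ i * z $ i)"
    by (simp add: trace_def matrix_def sum_3 C_def milnor_connection_def diag_bracket_def
        cross3_def axis_def milnor_ricci_def power2_eq_square field_simps)
  finally show ?thesis .
qed

lemma e_F: "e i = F (axis i 1)"
  by simp

lemma ricci_frame: "ricci br Q (e i) (e j) = (if i = j then milnor_ricci a $ i else 0)"
  unfolding e_F ricci_F by (simp add: axis_def sum_3) (use exhaust_3[of i] exhaust_3[of j] in auto)

text \<open>When x is expanded in the frame, a single component survives. Hence, of the unknown
  derivative of an evolving frame, only the components of e_j' along e_j itself will enter.\<close>

lemma bracket_component:
  assumes "(i, j, k) \<in> {(1, 2, 3), (2, 3, 1), (3, 1, 2)}"
  shows "Q (br x (e k)) (e i) = a $ i * Q x (e j)" "Q (br (e j) x) (e i) = a $ i * Q x (e k)"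
proof -
  have "Q (br (F z) (F (axis k 1))) (F (axis i 1)) = a $ i * Q (F z) (F (axis j 1))"
    "Q (br (F (axis j 1)) (F z)) (F (axis i 1)) = a $ i * Q (F z) (F (axis k 1))" for z
  proof -
    consider "i = 1" "j = 2" "k = 3" | "i = 2" "j = 3" "k = 1" | "i = 3" "j = 1" "k = 2"
      using assms by blast
    then show "Q (br (F z) (F (axis k 1))) (F (axis i 1)) = a $ i * Q (F z) (F (axis j 1))"
      "Q (br (F (axis j 1)) (F z)) (F (axis i 1)) = a $ i * Q (F z) (F (axis k 1))"
      unfolding bracket_F form_F
      by (cases; simp add: diag_bracket_def cross3_def axis_def inner_vec_def sum_3)+
  qed
  from this[of "inv F x"] show "Q (br x (e k)) (e i) = a $ i * Q x (e j)"
    "Q (br (e j) x) (e i) = a $ i * Q x (e k)" by (simp_all add: F_inv)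
qed

end

section \<open>Differentiating structure constants along a Ricci flow\<close>

lemma bilinear_form_expand:
  fixes f :: form
  assumes "bilinear f"
  shows "f x y = (\<Sum>i\<in>UNIV. \<Sum>j\<in>UNIV. x $ i * y $ j * f (axis i 1) (axis j 1))"
proof -
  have e: "w = w $ 1 *\<^sub>R axis 1 1 + w $ 2 *\<^sub>R axis 2 1 + w $ 3 *\<^sub>R axis 3 1" for w :: "real^3"
    by (simp add: vec_eq_iff forall_3 axis_def)
  have "f x y = f (x $ 1 *\<^sub>R axis 1 1 + x $ 2 *\<^sub>R axis 2 1 + x $ 3 *\<^sub>R axis 3 1)
     (y $ 1 *\<^sub>R axis 1 1 + y $ 2 *\<^sub>R axis 2 1 + y $ 3 *\<^sub>R axis 3 1)"
    using e[of x] e[of y] by simp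
  then show ?thesis
    unfolding sum_3
    by (simp add: bilinear_ladd[OF assms] bilinear_radd[OF assms] bilinear_lmul[OF assms]
        bilinear_rmul[OF assms] algebra_simps)
qed

text \<open>Linear relations between values of g pass to the derivatives by uniqueness of
  derivatives. In this way the right-hand side of the flow is bilinear without any computation with
  the Ricci form.\<close>

lemma bilinear_form_derivative:
  fixes g :: "real \<Rightarrow> form"
  assumes J: "open J" "t \<in> J" and g: "\<And>s. s \<in> J \<Longrightarrow> bilinear (g s)"
    and h: "\<And>x y. ((\<lambda>s. g s x y) has_real_derivative h x y) (at t)"
  shows "bilinear h"
proof -
  have u: "h x y = d" if "((\<lambda>s. f s) has_real_derivative d) (at t)" "\<And>s. s \<in> J \<Longrightarrow> f s = g s x y"
    for x y d f
    using has_field_derivative_transform_within_open[OF that(1) J that(2)] h DERIV_unique by blast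
  have "h (x + x') y = h x y + h x' y" for x x' y
    by (rule u[OF DERIV_add[OF h h]]) (simp add: g bilinear_ladd)
  moreover have "h y (x + x') = h y x + h y x'" for x x' y
    by (rule u[OF DERIV_add[OF h h]]) (simp add: g bilinear_radd)
  moreover have "h (c *\<^sub>R x) y = c * h x y" for c x y
    by (rule u[OF DERIV_cmult[OF h]]) (simp add: g bilinear_lmul)
  moreover have "h y (c *\<^sub>R x) = c * h y x" for c x y
    by (rule u[OF DERIV_cmult[OF h]]) (simp add: g bilinear_rmul)
  ultimately show ?thesis unfolding bilinear_def by (auto intro!: linearI)
qed

lemma bilinear_form_product_rule:
  fixes g :: "real \<Rightarrow> form"
  assumes J: "open J" "t \<in> J" and g: "\<And>s. s \<in> J \<Longrightarrow> bilinear (g s)"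
    and h: "\<And>x y. ((\<lambda>s. g s x y) has_real_derivative h x y) (at t)"
    and u: "(u has_vector_derivative u') (at t)" and v: "(v has_vector_derivative v') (at t)"
  shows "((\<lambda>s. g s (u s) (v s)) has_real_derivative
    h (u t) (v t) + g t u' (v t) + g t (u t) v') (at t)"
proof -
  have bh: "bilinear h" using bilinear_form_derivative[OF J g h] .
  have c: "((\<lambda>s. u s $ i) has_real_derivative u' $ i) (at t)"
    "((\<lambda>s. v s $ i) has_real_derivative v' $ i) (at t)" for i
    using u v by (simp_all add: has_vector_derivative_cart has_real_derivative_iff_has_vector_derivative)
  have "((\<lambda>s. \<Sum>i\<in>UNIV. \<Sum>j\<in>UNIV. u s $ i * v s $ j * g s (axis i 1) (axis j 1)) has_real_derivative
    (\<Sum>i\<in>UNIV. \<Sum>j\<in>UNIV. u t $ i * v t $ j * h (axis i 1) (axis j 1) +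
      (u' $ i * v t $ j * g t (axis i 1) (axis j 1) + u t $ i * v' $ j * g t (axis i 1) (axis j 1)))) (at t)"
    by (intro DERIV_sum)
      (auto intro!: derivative_eq_intros c h simp: algebra_simps)
  also have "(\<Sum>i\<in>UNIV. \<Sum>j\<in>UNIV. u t $ i * v t $ j * h (axis i 1) (axis j 1) +
      (u' $ i * v t $ j * g t (axis i 1) (axis j 1) + u t $ i * v' $ j * g t (axis i 1) (axis j 1)))
    = h (u t) (v t) + g t u' (v t) + g t (u t) v'"
    unfolding bilinear_form_expand[OF bh, of "u t" "v t"]
      bilinear_form_expand[OF g[OF J(2)], of u' "v t"] bilinear_form_expand[OF g[OF J(2)], of "u t" v']
    by (simp add: sum.distrib)
  finally show ?thesis
    by (rule has_field_derivative_transform_within_open[OF _ J])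
      (simp add: bilinear_form_expand[OF g])
qed

text \<open>Differentiate a_i = g([e_j, e_k], e_i). The metric contributes - 2 a_i r_i, the bracket
  a_i (r_j + r_k) and the last frame vector a_i r_i, in total a_i (r_j + r_k - r_i).\<close>

lemma ricci_flow_structure_constants:
  assumes J: "open J" "t \<in> J" and flow: "ricci_flow_on J br g"
    and mframe: "\<And>t. t \<in> J \<Longrightarrow> milnor_frame br (g t) (e t) (a t)"
    and diff: "\<And>i. (\<lambda>u. e u i) differentiable (at t)"
  shows "((\<lambda>s. a s $ i) has_real_derivative (a t \<bullet> a t) * milnor_field (a t) $ i) (at t)"
proof -
  have m: "(br, g s) \<in> metric_lie_algebras" if "s \<in> J" for s
    using flow that by (simp add: ricci_flow_on_def)
  interpret framed_mla br "g t" "e t" "a t"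
    by (rule framed_mla.intro[OF m[OF J(2)] mframe[OF J(2)]])
  have h: "((\<lambda>s. g s x y) has_real_derivative - 2 * ricci br (g t) x y) (at t)" for x y
  proof -
    have "((\<lambda>s. g s x y) has_real_derivative - 2 * ricci br (g t) x y) (at t within J)"
      using flow J(2) unfolding ricci_flow_on_def by blast
    then show ?thesis unfolding at_within_open[OF J(2,1)] .
  qed
  have g: "bilinear (g s)" if "s \<in> J" for s
    using m[OF that] by (auto simp: metric_lie_algebras_def inner_product_def)
  have sym: "g t x y = g t y x" for x y
    using inner_product by (auto simp: inner_product_def)
  define d where "d i = vector_derivative (\<lambda>u. e u i) (at t)" for i
  have d: "((\<lambda>u. e u i) has_vector_derivative d i) (at t)" for i
    using diff unfolding d_def by (rule vector_derivative_works[THEN iffD1])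
  \<comment> \<open>Differentiating g(e_i, e_i) = 1 determines the diagonal components of the frame
    derivative, whichever evolving frame was chosen.\<close>
  have gd: "g t (d i) (e t i) = milnor_ricci (a t) $ i" for i
  proof -
    have "((\<lambda>s. g s (e s i) (e s i)) has_real_derivative
      - 2 * ricci br (g t) (e t i) (e t i) + g t (d i) (e t i) + g t (e t i) (d i)) (at t)"
      by (rule bilinear_form_product_rule[OF J g h d d])
    moreover have "((\<lambda>s. g s (e s i) (e s i)) has_real_derivative 0) (at t)"
      by (rule has_field_derivative_transform_within_open[OF DERIV_const[of 1] J])
        (use mframe in \<open>simp add: milnor_frame_def\<close>)
    ultimately have "- 2 * ricci br (g t) (e t i) (e t i) + g t (d i) (e t i) + g t (e t i) (d i) = 0"
      by (rule DERIV_unique)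
    then show ?thesis using sym[of "e t i" "d i"] by (simp add: ricci_frame)
  qed
  have at: "a t \<bullet> a t \<noteq> 0" using milnor_frame_class(1)[OF mla frame] by simp
  obtain j k :: 3 where ijk: "(i, j, k) \<in> {(1, 2, 3), (2, 3, 1), (3, 1, 2)}"
    using exhaust_3[of i] by auto
  have brf: "br (e s j) (e s k) = a s $ i *\<^sub>R e s i" if "s \<in> J" for s
    using mframe[OF that] ijk by (auto simp: milnor_frame_def)
  have bb: "bounded_bilinear br" using bil(2) by (simp add: bilinear_conv_bounded_bilinear)
  have u: "((\<lambda>s. br (e s j) (e s k)) has_vector_derivative br (e t j) (d k) + br (d j) (e t k)) (at t)"
    by (rule bounded_bilinear.has_vector_derivative[OF bb d d])
  have D: "((\<lambda>s. g s (br (e s j) (e s k)) (e s i)) has_real_derivative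
      - 2 * ricci br (g t) (br (e t j) (e t k)) (e t i)
      + g t (br (e t j) (d k) + br (d j) (e t k)) (e t i) + g t (br (e t j) (e t k)) (d i)) (at t)"
    by (rule bilinear_form_product_rule[OF J g h u d])
  have f1: "ricci br (g t) (br (e t j) (e t k)) (e t i) = a t $ i * milnor_ricci (a t) $ i"
  proof -
    have "br (e t j) (e t k) = F (a t $ i *\<^sub>R axis i 1)"
      using brf[OF J(2)] by (simp add: linear_scale[OF linear_frame_map])
    then show ?thesis unfolding e_F[of i] using exhaust_3[of i] by (auto simp: ricci_F sum_3 axis_def)
  qed
  have f2: "g t (br (e t j) (d k) + br (d j) (e t k)) (e t i)
      = a t $ i * (milnor_ricci (a t) $ j + milnor_ricci (a t) $ k)"
    unfolding bilinear_ladd[OF bil(1)] bracket_component[OF ijk] gd by (simp add: algebra_simps)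
  have f3: "g t (br (e t j) (e t k)) (d i) = a t $ i * milnor_ricci (a t) $ i"
    using brf[OF J(2)] gd[of i] sym[of "e t i" "d i"] by (simp add: bilinear_lmul[OF bil(1)])
  have f4: "milnor_ricci (a t) $ i + milnor_ricci (a t) $ j + milnor_ricci (a t) $ k
      = (\<Sum>j\<in>UNIV. milnor_ricci (a t) $ j)"
    using ijk by (auto simp: sum_3)
  have f5: "(a t \<bullet> a t) * milnor_field (a t) $ i =
      a t $ i * ((\<Sum>j\<in>UNIV. milnor_ricci (a t) $ j) - 2 * milnor_ricci (a t) $ i)"
    using at by (simp add: milnor_field_ricci)
  have "- 2 * ricci br (g t) (br (e t j) (e t k)) (e t i)
      + g t (br (e t j) (d k) + br (d j) (e t k)) (e t i) + g t (br (e t j) (e t k)) (d i)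
      = (a t \<bullet> a t) * milnor_field (a t) $ i"
    unfolding f1 f2 f3 f5 f4[symmetric] by (simp add: algebra_simps)
  from D[unfolded this] show ?thesis
  proof (rule has_field_derivative_transform_within_open[OF _ J])
    fix s assume s: "s \<in> J"
    then show "g s (br (e s j) (e s k)) (e s i) = a s $ i"
      using mframe[OF s] brf[OF s] by (simp add: bilinear_lmul[OF g[OF s]] milnor_frame_def)
  qed
qed

text \<open>The derivative 1 / |a|^2 of the time change cancels the factor |a|^2 in the evolution of
  the structure constants. They then solve the autonomous equation, and uniqueness identifies them
  with \<open>milnor_flow\<close>.\<close>

lemma ricci_trajectory_flow:
  assumes "ricci_trajectory P"
  obtains a where "a \<noteq> 0" "\<And>s. P s = triple_class (milnor_flow s a)"
proof -
  obtain J br g e a \<sigma> where J: "open J" and flow: "ricci_flow_on J br g"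
    and fr: "\<And>t. t \<in> J \<Longrightarrow> milnor_frame br (g t) (e t) (a t)"
    and df: "\<And>t i. t \<in> J \<Longrightarrow> (\<lambda>u. e u i) differentiable (at t)"
    and \<sigma>: "\<And>s. \<sigma> s \<in> J" "\<And>s. (\<sigma> has_real_derivative 1 / (norm (a (\<sigma> s)))\<^sup>2) (at s)"
    and P: "\<And>s. P s = mla_class_of br (g (\<sigma> s))"
    using assms unfolding ricci_trajectory_def by blast
  have c: "a (\<sigma> s) \<noteq> 0" "P s = triple_class (a (\<sigma> s))" for s
    using milnor_frame_class[OF _ fr[OF \<sigma>(1)]] flow \<sigma>(1) P
    by (auto simp: ricci_flow_on_def)
  have "((\<lambda>s. a (\<sigma> s) $ i) has_real_derivative milnor_field (a (\<sigma> s)) $ i) (at s)" for i s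
  proof -
    have "((\<lambda>s. a (\<sigma> s) $ i) has_real_derivative
        (a (\<sigma> s) \<bullet> a (\<sigma> s)) * milnor_field (a (\<sigma> s)) $ i * (1 / (norm (a (\<sigma> s)))\<^sup>2)) (at s)"
      by (rule DERIV_chain2[OF ricci_flow_structure_constants[OF J \<sigma>(1) flow fr df[OF \<sigma>(1)]] \<sigma>(2)])
    then show ?thesis using c(1)[of s] by (simp add: dot_square_norm)
  qed
  then have "((\<lambda>s. a (\<sigma> s)) has_vector_derivative milnor_field (a (\<sigma> s))) (at s)" for s
    by (simp add: has_vector_derivative_cart has_real_derivative_iff_has_vector_derivative)
  from milnor_flow_unique[OF this] have "a (\<sigma> s) = milnor_flow s (a (\<sigma> 0))" for s .
  with c show ?thesis using that by metis
qed

text \<open>The bracket stays fixed and the metric stays diagonal. If K_i has derivative r_i in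
  Ricci flow time, then the diagonal metric with entries exp (- 2 K_i) solves the flow, the standard
  basis scaled by exp (K_i) is orthonormal, and its structure constants are a_i exp (K_j + K_k -
  K_i).\<close>

lemma ricci_trajectory_exists:
  assumes a: "a \<noteq> 0"
  shows "ricci_trajectory (\<lambda>s. triple_class (milnor_flow s a))"
proof -
  define \<alpha> where "\<alpha> s = milnor_flow s a" for s
  define n where "n s = \<alpha> s \<bullet> \<alpha> s" for s
  have n: "n s > 0" for s using milnor_flow_nonzero[OF a] by (simp add: n_def \<alpha>_def)
  have c\<alpha>': "continuous_on UNIV \<alpha>" unfolding \<alpha>_def
    using milnor_flow_has_vector_derivative
    by (meson continuous_at_imp_continuous_on has_vector_derivative_continuous)
  then have c\<alpha>: "continuous_on UNIV (\<lambda>s. \<alpha> s $ i)" for i by (intro continuous_intros)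
  have cn: "continuous_on UNIV n"
    unfolding n_def[abs_def] by (intro continuous_intros c\<alpha>')
  have nz: "n s \<noteq> 0" for s using n[of s] by simp
  \<comment> \<open>The division by n is the derivative dt/ds, since K is obtained by integrating in
    s.\<close>
  define k where "k i s = milnor_ricci (\<alpha> s) $ i / n s" for i s
  have "continuous_on UNIV (k i)" for i
  proof -
    have "continuous_on UNIV (\<lambda>s. milnor_ricci (\<alpha> s) $ i)"
      using exhaust_3[of i]
      by (elim disjE) (simp_all add: milnor_ricci_def continuous_on_diff continuous_on_power
          continuous_on_divide c\<alpha>)
    then show ?thesis unfolding k_def[abs_def] using cn nz by (intro continuous_on_divide) auto
  qed
  then have "\<exists>K. (\<forall>s. (K has_real_derivative k i s) (at s)) \<and> K 0 = 0" for i
    using antiderivative_exists[of "k i"]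
    by (metis has_real_derivative_iff_has_vector_derivative)
  then obtain K where K: "\<And>i s. (K i has_real_derivative k i s) (at s)" and K0: "\<And>i. K i 0 = 0"
    by metis
  have "continuous_on UNIV (\<lambda>s. 1 / n s)" using cn nz by (intro continuous_intros) auto
  \<comment> \<open>This is Ricci flow time as a function of s; its range is the interval on which
    the flow will be defined.\<close>
  then obtain \<theta> where \<theta>: "\<And>s. (\<theta> has_real_derivative 1 / n s) (at s)"
    using antiderivative_exists[of "\<lambda>s. 1 / n s"]
    by (metis has_real_derivative_iff_has_vector_derivative)
  obtain \<tau> where "\<And>s. s \<in> UNIV \<Longrightarrow> \<tau> (\<theta> s) = s"
    "\<And>s. s \<in> UNIV \<Longrightarrow> (\<tau> has_real_derivative 1 / (1 / n s)) (at (\<theta> s))"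
    and J: "open (range \<theta>)" "is_interval (range \<theta>)"
    by (rule increasing_inverse[OF open_UNIV is_interval_univ, of \<theta> "\<lambda>s. 1 / n s"])
      (use \<theta> n in auto)
  then have \<tau>: "\<And>s. \<tau> (\<theta> s) = s" "\<And>s. (\<tau> has_real_derivative n s) (at (\<theta> s))" by auto
  \<comment> \<open>Both sides solve the same linear equation with the same initial value; their
    quotient is differentiated in the form of an integrating factor.\<close>
  have \<alpha>K: "\<alpha> s $ i = a $ i * exp ((\<Sum>j\<in>UNIV. K j s) - 2 * K i s)" for i s
  proof -
    have d\<alpha>: "((\<lambda>s. \<alpha> s $ i) has_real_derivative \<alpha> s $ i * ((\<Sum>j\<in>UNIV. k j s) - 2 * k i s)) (at s)" for s
      unfolding k_def n_def milnor_field_ricci_divide[symmetric] \<alpha>_def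
      by (rule milnor_flow_component)
    have dE: "((\<lambda>s. (\<Sum>j\<in>UNIV. K j s) - 2 * K i s) has_real_derivative (\<Sum>j\<in>UNIV. k j s) - 2 * k i s) (at s)" for s
      by (intro DERIV_diff DERIV_sum DERIV_cmult K)
    have "((\<lambda>s. \<alpha> s $ i * exp (- ((\<Sum>j\<in>UNIV. K j s) - 2 * K i s))) has_real_derivative 0) (at s)" for s
      by (rule DERIV_cong[OF DERIV_mult[OF d\<alpha> DERIV_chain2[OF DERIV_exp DERIV_minus[OF dE]]]])
        (simp add: algebra_simps)
    then have "\<exists>c. \<forall>s\<in>UNIV. \<alpha> s $ i * exp (- ((\<Sum>j\<in>UNIV. K j s) - 2 * K i s)) = c"
      by (intro has_field_derivative_zero_constant) auto
    then have "\<alpha> s $ i * exp (- ((\<Sum>j\<in>UNIV. K j s) - 2 * K i s)) =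
      \<alpha> 0 $ i * exp (- ((\<Sum>j\<in>UNIV. K j 0) - 2 * K i 0))" by auto
    also have "\<dots> = a $ i" by (simp add: K0 \<alpha>_def)
    finally have c: "\<alpha> s $ i * exp (- ((\<Sum>j\<in>UNIV. K j s) - 2 * K i s)) = a $ i" .
    have "\<alpha> s $ i = \<alpha> s $ i * exp (- ((\<Sum>j\<in>UNIV. K j s) - 2 * K i s))
        * exp ((\<Sum>j\<in>UNIV. K j s) - 2 * K i s)"
      by (simp only: mult.assoc mult_exp_exp) simp
    then show ?thesis unfolding c .
  qed
  define br where "br = diag_bracket a"
  define e where "e t i = exp (K i (\<tau> t)) *\<^sub>R (axis i 1 :: real^3)" for t i
  define g :: "real \<Rightarrow> form" where "g t x y = (\<Sum>i\<in>UNIV. exp (- 2 * K i (\<tau> t)) * x $ i * y $ i)" for t x y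
  have mla: "(br, g t) \<in> metric_lie_algebras" for t
  proof -
    have "bilinear (g t)"
      by (auto simp: bilinear_def g_def sum_3 algebra_simps intro!: linearI)
    moreover have "g t x x > 0" if x: "x \<noteq> 0" for x
    proof -
      obtain i where i: "x $ i \<noteq> 0" using x by (auto simp: vec_eq_iff)
      have "0 < exp (- 2 * K i (\<tau> t)) * x $ i * x $ i"
        using i not_square_less_zero[of "x $ i"] by (simp add: mult.assoc less_le)
      then show ?thesis unfolding g_def
        by (intro sum_pos2[of _ i]) (auto simp: mult.assoc)
    qed
    moreover have "g t x y = g t y x" for x y by (simp add: g_def mult_ac)
    ultimately have "inner_product (g t)" by (simp add: inner_product_def)
    then show ?thesis using diag_bracket_mem[OF a] by (simp add: metric_lie_algebras_def br_def)
  qed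
  have frame: "milnor_frame br (g t) (e t) (\<alpha> (\<tau> t))" for t
  proof -
    have E: "a $ 1 * (exp (K 2 s) * exp (K 3 s)) = \<alpha> s $ 1 * exp (K 1 s)"
      "a $ 2 * (exp (K 3 s) * exp (K 1 s)) = \<alpha> s $ 2 * exp (K 2 s)"
      "a $ 3 * (exp (K 1 s) * exp (K 2 s)) = \<alpha> s $ 3 * exp (K 3 s)" for s
      unfolding \<alpha>K sum_3 mult.assoc mult_exp_exp by (simp_all add: algebra_simps)
    have "g t (e t i) (e t j) = (if i = j then 1 else 0)" for i j
      using exhaust_3[of i] exhaust_3[of j]
      by (auto simp: g_def e_def sum_3 axis_def mult_ac simp flip: exp_add)
    then show ?thesis
      unfolding milnor_frame_def
      by (simp add: br_def diag_bracket_def e_def vec_eq_iff forall_3 cross3_def axis_def)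
        (use E[of "\<tau> t"] in \<open>simp add: mult_ac\<close>)
  qed
  have dK: "((\<lambda>t. exp (c * K i (\<tau> t))) has_real_derivative
      c * milnor_ricci (\<alpha> s) $ i * exp (c * K i s)) (at (\<theta> s))" for c i s
  proof -
    have "((\<lambda>t. K i (\<tau> t)) has_real_derivative k i s * n s) (at (\<theta> s))"
      by (rule DERIV_chain2[OF _ \<tau>(2)]) (simp add: \<tau>(1) K)
    moreover have "k i s * n s = milnor_ricci (\<alpha> s) $ i" using nz[of s] by (simp add: k_def)
    ultimately show ?thesis by (auto intro!: derivative_eq_intros simp: \<tau>(1))
  qed
  have "ricci_flow_on (range \<theta>) br g"
    unfolding ricci_flow_on_def
  proof (intro ballI conjI allI mla)
    fix t x y assume "t \<in> range \<theta>"
    then obtain s where s: "t = \<theta> s" by blast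
    interpret framed_mla br "g t" "e t" "\<alpha> s"
      by (rule framed_mla.intro[OF mla]) (use frame[of t] in \<open>simp add: s \<tau>(1)\<close>)
    \<comment> \<open>Coordinates with respect to the evolving frame, in which the Ricci form is
      known.\<close>
    define r where "r z = (\<chi> i. z $ i * exp (- K i s))" for z :: "real^3"
    have r: "z = F (r z)" for z
      by (simp add: frame_map_def e_def r_def vec_eq_iff forall_3 sum_3 axis_def s \<tau>(1) exp_minus)
    have "ricci br (g t) x y = ricci br (g t) (F (r x)) (F (r y))" by (simp flip: r)
    also have "\<dots> = (\<Sum>i\<in>UNIV. milnor_ricci (\<alpha> s) $ i * exp (- 2 * K i s) * x $ i * y $ i)"
      unfolding ricci_F by (simp add: r_def sum_3 mult_ac flip: exp_add)
    finally have rc: "ricci br (g t) x y =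
      (\<Sum>i\<in>UNIV. milnor_ricci (\<alpha> s) $ i * exp (- 2 * K i s) * x $ i * y $ i)" .
    have "((\<lambda>t. g t x y) has_real_derivative
      (\<Sum>i\<in>UNIV. - 2 * milnor_ricci (\<alpha> s) $ i * exp (- 2 * K i s) * x $ i * y $ i)) (at (\<theta> s))"
      unfolding g_def by (intro DERIV_sum DERIV_cmult_right dK)
    also have "(\<Sum>i\<in>UNIV. - 2 * milnor_ricci (\<alpha> s) $ i * exp (- 2 * K i s) * x $ i * y $ i)
      = - 2 * ricci br (g t) x y" unfolding rc sum_distrib_left by (simp add: mult.assoc)
    finally show "((\<lambda>s. g s x y) has_real_derivative - 2 * ricci br (g t) x y) (at t within range \<theta>)"
      unfolding s by (rule has_field_derivative_at_within)
  qed
  moreover have "milnor_frame br (g t) (e t) (\<alpha> (\<tau> t)) \<and> (\<forall>i. (\<lambda>u. e u i) differentiable (at t))"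
    if t: "t \<in> range \<theta>" for t
  proof -
    obtain s where s: "t = \<theta> s" using t by blast
    have "((\<lambda>u. exp (1 * K i (\<tau> u)) *\<^sub>R (axis i 1 :: real^3)) has_vector_derivative
        (1 * milnor_ricci (\<alpha> s) $ i * exp (1 * K i s)) *\<^sub>R axis i 1) (at (\<theta> s))" for i
      using has_vector_derivative_scaleR[OF dK[of 1 i s] has_vector_derivative_const[of "axis i 1"]] by simp
    then show ?thesis unfolding s e_def[abs_def] using frame
      by (auto simp: e_def[abs_def] intro!: differentiableI_vector)
  qed
  moreover have "\<theta> s \<in> range \<theta> \<and> (\<theta> has_real_derivative 1 / (norm (\<alpha> (\<tau> (\<theta> s))))\<^sup>2) (at s) \<and>
      triple_class (milnor_flow s a) = mla_class_of br (g (\<theta> s))" for s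
    using \<theta>[of s] milnor_frame_class(2)[OF mla frame, of "\<theta> s"]
    by (simp add: \<tau>(1) n_def dot_square_norm \<alpha>_def)
  ultimately show ?thesis
    unfolding ricci_trajectory_def
    using J by (intro exI[of _ "range \<theta>"] exI[of _ br] exI[of _ g] exI[of _ e]
        exI[of _ "\<lambda>t. \<alpha> (\<tau> t)"] exI[of _ \<theta>]) simp
qed

text \<open>Two trajectories through the same class start at similar triples, and the flow preserves
  similarity. So exactly one class satisfies the definite description.\<close>

lemma ricci_dynamics_triple_class:
  assumes a: "a \<noteq> 0"
  shows "ricci_dynamics s (triple_class a) = triple_class (milnor_flow s a)"
  unfolding ricci_dynamics_def
proof (rule the_equality)
  show "\<exists>P. ricci_trajectory P \<and> P 0 = triple_class a \<and> P s = triple_class (milnor_flow s a)"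
    using ricci_trajectory_exists[OF a] by (intro exI[of _ "\<lambda>s. triple_class (milnor_flow s a)"]) simp
  fix q assume "\<exists>P. ricci_trajectory P \<and> P 0 = triple_class a \<and> P s = q"
  then obtain P where P: "ricci_trajectory P" "P 0 = triple_class a" "P s = q" by blast
  obtain b where b: "b \<noteq> 0" "\<And>s. P s = triple_class (milnor_flow s b)"
    using ricci_trajectory_flow[OF P(1)] by blast
  then have "similar_triples b a" using P(2) triple_class_eq_iff[OF b(1) a] by simp
  then have "similar_triples (milnor_flow s b) (milnor_flow s a)" by (rule similar_triples_flow)
  then show "q = triple_class (milnor_flow s a)"
    using P(3) b similar_triple_class milnor_flow_nonzero by metis
qed

section \<open>The planar system\<close>

text \<open>With the same integrating factor, u exp (- K) is strictly decreasing. This is the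
  one-way crossing principle for both sides of the wedge.\<close>

lemma linear_ode_pos_backward:
  fixes u k h :: "real \<Rightarrow> real"
  assumes S: "closed S" "convex S" and k: "continuous_on S k"
    and u: "\<And>s. s \<in> S \<Longrightarrow> (u has_real_derivative k s * u s - h s) (at s within S)"
    and h: "\<And>s. s \<in> S \<Longrightarrow> h s > 0"
    and st: "s \<in> S" "t \<in> S" "s < t" and ut: "u t \<ge> 0"
  shows "u s > 0"
proof -
  have "closedin (top_of_set UNIV) S" using S by simp
  from Tietze_unbounded[OF k this] obtain k' where k': "continuous_on UNIV k'"
    "\<And>s. s \<in> S \<Longrightarrow> k' s = k s" by metis
  from antiderivative_exists[OF k'(1)] obtain K
    where K: "\<And>s. (K has_vector_derivative k' s) (at s)" by metis
  have d: "((\<lambda>s. u s * exp (- K s)) has_real_derivative - h s * exp (- K s)) (at s within S)"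
    if "s \<in> S" for s
  proof -
    have "(K has_real_derivative k s) (at s within S)"
      using K[of s] k'(2)[OF that]
      by (simp add: has_real_derivative_iff_has_vector_derivative has_vector_derivative_at_within)
    from this u[OF that] show ?thesis
      by (auto intro!: derivative_eq_intros simp: algebra_simps)
  qed
  have sub: "{s..t} \<subseteq> S"
    using S(2) st by (metis closed_segment_eq_real_ivl closed_segment_subset less_imp_le)
  have "u t * exp (- K t) < u s * exp (- K s)"
  proof (rule DERIV_neg_imp_decreasing_open[OF st(3)])
    fix r assume r: "s < r" "r < t"
    then have "r \<in> S" using sub by auto
    have "((\<lambda>s. u s * exp (- K s)) has_real_derivative - h r * exp (- K r)) (at r within {s<..<t})"
      using d[OF \<open>r \<in> S\<close>] by (rule DERIV_subset) (use sub in auto)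
    then have "((\<lambda>s. u s * exp (- K s)) has_real_derivative - h r * exp (- K r)) (at r)"
      using r at_within_open[of r "{s<..<t}"] by simp
    moreover have "- h r * exp (- K r) < 0" using h[OF \<open>r \<in> S\<close>] by simp
    ultimately show "\<exists>y. ((\<lambda>s. u s * exp (- K s)) has_real_derivative y) (at r) \<and> y < 0" by blast
  next
    show "continuous_on {s..t} (\<lambda>s. u s * exp (- K s))"
      using DERIV_continuous_on[OF d] sub continuous_on_subset by blast
  qed
  moreover have "0 \<le> u t * exp (- K t)" using ut by simp
  ultimately show ?thesis by (smt (verit) exp_gt_zero zero_less_mult_pos2)
qed

text \<open>The positive factor \<open>c\<close> covers both the flow induced by the three-dimensional one and the solutions
  of the planar system on a half line that occur in the unstable manifold.\<close>

locale planar_curve =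
  fixes S :: "real set" and c x y :: "real \<Rightarrow> real"
  assumes closed: "closed S" and convex: "convex S" and cont_c: "continuous_on S c"
    and c_pos: "\<And>s. s \<in> S \<Longrightarrow> c s > 0"
    and dx: "\<And>s. s \<in> S \<Longrightarrow> (x has_real_derivative c s * fst (planar_field (x s, y s))) (at s within S)"
    and dy: "\<And>s. s \<in> S \<Longrightarrow> (y has_real_derivative c s * snd (planar_field (x s, y s))) (at s within S)"
begin

lemma cont: "continuous_on S x" "continuous_on S y"
  using DERIV_continuous_on[OF dx] DERIV_continuous_on[OF dy] by auto

text \<open>Here and in the next four lemmas, the function in question divides its own derivative
  along the field, so the lines x = 0, x = 1, y = 0, y = 1 and x = y cannot be crossed.\<close>

lemma sgn_x: "s \<in> S \<Longrightarrow> t \<in> S \<Longrightarrow> sgn (x s) = sgn (x t)"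
proof (rule linear_ode_sgn[OF closed convex, where u = "x" and s = s and t = t and k = "\<lambda>s. c s * (1 - x s) * (1 + x s - y s)"])
  show "continuous_on S (\<lambda>s. c s * (1 - x s) * (1 + x s - y s))" by (intro continuous_intros cont cont_c)
  show "(x has_real_derivative c s * (1 - x s) * (1 + x s - y s) * x s) (at s within S)" if "s \<in> S" for s
    using dx[OF that] by (simp add: planar_field_def mult_ac)
qed auto

lemma sgn_1_x: "s \<in> S \<Longrightarrow> t \<in> S \<Longrightarrow> sgn (1 - x s) = sgn (1 - x t)"
proof (rule linear_ode_sgn[OF closed convex, where u = "\<lambda>s. 1 - x s" and s = s and t = t and k = "\<lambda>s. - c s * x s * (1 + x s - y s)"])
  show "continuous_on S (\<lambda>s. - c s * x s * (1 + x s - y s))" by (intro continuous_intros cont cont_c)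
  show "((\<lambda>s. 1 - x s) has_real_derivative - c s * x s * (1 + x s - y s) * (1 - x s)) (at s within S)"
    if "s \<in> S" for s
    by (rule DERIV_cong[OF DERIV_diff[OF DERIV_const dx[OF that]]]) (simp add: planar_field_def)
qed auto

lemma sgn_y: "s \<in> S \<Longrightarrow> t \<in> S \<Longrightarrow> sgn (y s) = sgn (y t)"
proof (rule linear_ode_sgn[OF closed convex, where u = "y" and s = s and t = t and k = "\<lambda>s. c s * (1 - y s) * (1 - x s + y s)"])
  show "continuous_on S (\<lambda>s. c s * (1 - y s) * (1 - x s + y s))" by (intro continuous_intros cont cont_c)
  show "(y has_real_derivative c s * (1 - y s) * (1 - x s + y s) * y s) (at s within S)" if "s \<in> S" for s
    using dy[OF that] by (simp add: planar_field_def mult_ac)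
qed auto

lemma sgn_1_y: "s \<in> S \<Longrightarrow> t \<in> S \<Longrightarrow> sgn (1 - y s) = sgn (1 - y t)"
proof (rule linear_ode_sgn[OF closed convex, where u = "\<lambda>s. 1 - y s" and s = s and t = t and k = "\<lambda>s. - c s * y s * (1 - x s + y s)"])
  show "continuous_on S (\<lambda>s. - c s * y s * (1 - x s + y s))" by (intro continuous_intros cont cont_c)
  show "((\<lambda>s. 1 - y s) has_real_derivative - c s * y s * (1 - x s + y s) * (1 - y s)) (at s within S)"
    if "s \<in> S" for s
    by (rule DERIV_cong[OF DERIV_diff[OF DERIV_const dy[OF that]]]) (simp add: planar_field_def)
qed auto

lemma sgn_x_y: "s \<in> S \<Longrightarrow> t \<in> S \<Longrightarrow> sgn (x s - y s) = sgn (x t - y t)"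
proof (rule linear_ode_sgn[OF closed convex, where u = "\<lambda>s. x s - y s" and s = s and t = t and k = "\<lambda>s. c s * (1 - (x s)\<^sup>2 - (y s)\<^sup>2)"])
  show "continuous_on S (\<lambda>s. c s * (1 - (x s)\<^sup>2 - (y s)\<^sup>2))" by (intro continuous_intros cont cont_c)
  show "((\<lambda>s. x s - y s) has_real_derivative c s * (1 - (x s)\<^sup>2 - (y s)\<^sup>2) * (x s - y s)) (at s within S)"
    if "s \<in> S" for s
    by (rule DERIV_cong[OF DERIV_diff[OF dx[OF that] dy[OF that]]])
      (simp add: planar_field_def power2_eq_square algebra_simps)
qed auto

text \<open>On x = 0 the second equation becomes y' = c y (1 - y) (1 + y), which adds y = - 1 to the
  barriers there.\<close>

lemma sgn_1_plus_y:
  assumes "\<And>s. s \<in> S \<Longrightarrow> x s = 0" and "s \<in> S" "t \<in> S"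
  shows "sgn (1 + y s) = sgn (1 + y t)"
proof (rule linear_ode_sgn[OF closed convex, where u = "\<lambda>s. 1 + y s" and s = s and t = t and k = "\<lambda>s. c s * y s * (1 - y s)"])
  show "continuous_on S (\<lambda>s. c s * y s * (1 - y s))" by (intro continuous_intros cont cont_c)
  show "((\<lambda>s. 1 + y s) has_real_derivative c s * y s * (1 - y s) * (1 + y s)) (at s within S)"
    if "s \<in> S" for s
    by (rule DERIV_cong[OF DERIV_add[OF DERIV_const dy[OF that]]])
      (simp add: planar_field_def assms(1)[OF that])
qed (use assms in auto)

lemma strip:
  assumes "s \<in> S" "t \<in> S" "0 < x s" "x s < 1" "y s < 0"
  shows "0 < x t" "x t < 1" "y t < 0"
  using sgn_x[OF assms(1,2)] sgn_1_x[OF assms(1,2)] sgn_y[OF assms(1,2)] assms(3-)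
  by (metis sgn_1_pos sgn_1_neg diff_gt_0_iff_gt sgn_pos sgn_neg)+

text \<open>On the line y = x - 1 the second component of the field vanishes while x increases. The
  line is therefore crossed only from above to below, and backward trajectories stay above
  it.\<close>

lemma above_line_backward:
  assumes R: "r \<in> S" "0 < x r" "x r < 1" "y r < 0" and st: "s \<in> S" "t \<in> S" "s < t"
    and "x t - 1 \<le> y t"
  shows "x s - 1 < y s"
proof -
  have "1 - x s + y s > 0"
  proof (rule linear_ode_pos_backward[OF closed convex _ _ _ st,
      where u = "\<lambda>s. 1 - x s + y s" and k = "\<lambda>s. c s * y s * (1 - y s)" and h = "\<lambda>s. c s * x s * (1 - x s) * (1 + x s - y s)"])
    show "continuous_on S (\<lambda>s. c s * y s * (1 - y s))" by (intro continuous_intros cont cont_c)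
    show "((\<lambda>s. 1 - x s + y s) has_real_derivative c s * y s * (1 - y s) * (1 - x s + y s)
        - c s * x s * (1 - x s) * (1 + x s - y s)) (at s within S)" if "s \<in> S" for s
      by (rule DERIV_cong[OF DERIV_add[OF DERIV_diff[OF DERIV_const dx[OF that]] dy[OF that]]])
        (simp add: planar_field_def algebra_simps)
    show "0 < c s * x s * (1 - x s) * (1 + x s - y s)" if "s \<in> S" for s
      using strip[OF R(1) that R(2-)] c_pos[OF that] by simp
  qed (use assms in simp)
  then show ?thesis by simp
qed

text \<open>At y = - 1 the second component of the field is 2 x > 0, so this line is crossed only
  upwards.\<close>

lemma below_minus_1_backward:
  assumes R: "r \<in> S" "0 < x r" "x r < 1" "y r < 0" and st: "s \<in> S" "t \<in> S" "s < t"
    and "y t \<le> - 1"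
  shows "y s < - 1"
proof -
  have "- (1 + y s) > 0"
  proof (rule linear_ode_pos_backward[OF closed convex _ _ _ st,
      where u = "\<lambda>s. - (1 + y s)" and k = "\<lambda>s. c s * y s * (1 - y s)" and h = "\<lambda>s. c s * x s * (1 - y s) * (- y s)"])
    show "continuous_on S (\<lambda>s. c s * y s * (1 - y s))" by (intro continuous_intros cont cont_c)
    show "((\<lambda>s. - (1 + y s)) has_real_derivative c s * y s * (1 - y s) * (- (1 + y s))
        - c s * x s * (1 - y s) * (- y s)) (at s within S)" if "s \<in> S" for s
      by (rule DERIV_cong[OF DERIV_minus[OF DERIV_add[OF DERIV_const dy[OF that]]]])
        (simp add: planar_field_def algebra_simps)
    show "0 < c s * x s * (1 - y s) * (- y s)" if "s \<in> S" for s
      using strip[OF R(1) that R(2-)] c_pos[OF that] by (intro mult_pos_pos) auto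
  qed (use assms in simp)
  then show ?thesis by simp
qed

lemma nonincreasing_on:
  assumes f: "\<And>r. r \<in> S \<Longrightarrow> (f has_real_derivative f' r) (at r within S)"
    and "s \<in> S" "t \<in> S" "s \<le> t" and "\<And>r. s < r \<Longrightarrow> r < t \<Longrightarrow> f' r \<le> 0"
  shows "f t \<le> f s"
proof (rule DERIV_nonpos_imp_decreasing_open[OF assms(4)])
  have sub: "{s..t} \<subseteq> S"
    using convex assms(2-4) by (metis closed_segment_eq_real_ivl closed_segment_subset)
  show "continuous_on {s..t} f" using DERIV_continuous_on[OF f] sub continuous_on_subset by blast
  fix r assume r: "s < r" "r < t"
  then have "r \<in> S" using sub by auto
  have "(f has_real_derivative f' r) (at r within {s<..<t})"
    using f[OF \<open>r \<in> S\<close>] by (rule DERIV_subset) (use sub in auto)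
  then have "(f has_real_derivative f' r) (at r)" using r at_within_open[of r "{s<..<t}"] by simp
  then show "\<exists>y. (f has_real_derivative y) (at r) \<and> y \<le> 0" using assms(5)[OF r] by blast
qed

lemma nondecreasing_on:
  assumes f: "\<And>r. r \<in> S \<Longrightarrow> (f has_real_derivative f' r) (at r within S)"
    and "s \<in> S" "t \<in> S" "s \<le> t" and "\<And>r. s < r \<Longrightarrow> r < t \<Longrightarrow> f' r \<ge> 0"
  shows "f s \<le> f t"
proof -
  have "- f t \<le> - f s"
    by (rule nonincreasing_on[OF DERIV_minus[OF f] assms(2-4)]) (use assms(5) in auto)
  then show ?thesis by simp
qed

text \<open>A curve leaving the wedge \<open>- 1 < y < x - 1\<close> backwards in time is afterwards monotone in the
  direction away from \<open>y = - 1\<close>.\<close>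

lemma wedge:
  assumes R: "r \<in> S" "0 < x r" "x r < 1" "y r < 0" and S: "S = UNIV \<or> S = {..0}"
    and lim: "(y \<longlongrightarrow> - 1) at_bot" and s: "s \<in> S"
  shows "- 1 < y s" "y s < x s - 1"
proof -
  have down: "t \<in> S" if "t \<le> s" for t using S s that by auto
  have strip: "0 < x t" "x t < 1" "y t < 0" if "t \<le> s" for t
    using strip[OF R(1) down[OF that] R(2-)] by auto
  have pos: "c t > 0" if "t \<le> s" for t using c_pos[OF down[OF that]] .
  show "y s < x s - 1"
  proof (rule ccontr)
    assume "\<not> y s < x s - 1"
    then have above: "x t - 1 < y t" if "t < s" for t
      using above_line_backward[OF R down s that] that by simp
    \<comment> \<open>Strict position above the line is known only before s, hence the comparison at
      s - 1. As y is nonincreasing there, its backward limit - 1 would have to be at least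
      \<open>y (s - 1)\<close>, which exceeds - 1.\<close>
    have "y (s - 1) \<le> y t" if "t \<le> s - 1" for t
    proof (rule nonincreasing_on[OF dy])
      fix q assume "t < q" "q < s - 1"
      then show "c q * snd (planar_field (x q, y q)) \<le> 0"
        using pos[of q] strip[of q] above[of q]
        by (auto simp: planar_field_def mult_le_0_iff zero_le_mult_iff)
    qed (use that down in auto)
    then have "y (s - 1) \<le> - 1"
      by (intro tendsto_lowerbound[OF lim]) (auto simp: eventually_at_bot_linorder)
    then show False using above[of "s - 1"] strip(1)[of "s - 1"] by simp
  qed
  show "- 1 < y s"
  proof (rule ccontr)
    assume "\<not> - 1 < y s"
    then have below: "y t < - 1" if "t < s" for t
      using below_minus_1_backward[OF R down s that] that by simp
    have "y t \<le> y (s - 1)" if "t \<le> s - 1" for t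
    proof (rule nondecreasing_on[OF dy])
      fix q assume "t < q" "q < s - 1"
      then show "0 \<le> c q * snd (planar_field (x q, y q))"
        using pos[of q] strip[of q] below[of q]
        by (auto simp: planar_field_def mult_le_0_iff zero_le_mult_iff)
    qed (use that down in auto)
    then have "- 1 \<le> y (s - 1)"
      by (intro tendsto_upperbound[OF lim]) (auto simp: eventually_at_bot_linorder)
    then show False using below[of "s - 1"] by simp
  qed
qed

end

subsection \<open>The flow on the coordinate plane\<close>

text \<open>The time is that of the flow on triples, in which every trajectory exists for all s.
  Solutions of the planar system itself can escape in finite time.\<close>

definition planar_flow :: "real \<Rightarrow> real \<times> real \<Rightarrow> real \<times> real" where
  "planar_flow s m = (let a = milnor_flow s (vector [1, fst m, snd m]) in (a $ 2 / a $ 1, a $ 3 / a $ 1))"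

text \<open>Each component of the field is a multiple of the corresponding coordinate. In particular
  a positive first coordinate stays positive and may serve as a denominator.\<close>

lemma milnor_flow_sgn:
  assumes "a \<noteq> 0"
  shows "sgn (milnor_flow s a $ i) = sgn (a $ i)"
proof -
  define \<alpha> where "\<alpha> s = milnor_flow s a" for s
  define k where "k s = (2 * (\<alpha> s \<bullet> \<alpha> s) - (\<Sum>j\<in>UNIV. \<alpha> s $ j)\<^sup>2 + 4 * (\<Sum>j\<in>UNIV. \<alpha> s $ j) * \<alpha> s $ i
      - 8 * (\<alpha> s $ i)\<^sup>2) / (2 * (\<alpha> s \<bullet> \<alpha> s))" for s
  have nz: "\<alpha> s \<noteq> 0" for s unfolding \<alpha>_def by (rule milnor_flow_nonzero[OF assms])
  have c: "continuous_on UNIV \<alpha>" unfolding \<alpha>_def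
    using milnor_flow_has_vector_derivative
    by (meson continuous_at_imp_continuous_on has_vector_derivative_continuous)
  have "sgn (\<alpha> s $ i) = sgn (\<alpha> 0 $ i)"
  proof (rule linear_ode_sgn[where S = UNIV and k = k and u = "\<lambda>s. \<alpha> s $ i"])
    show "continuous_on UNIV k" unfolding k_def[abs_def]
      by (intro continuous_intros c) (use nz in auto)
    show "((\<lambda>s. \<alpha> s $ i) has_real_derivative k s * \<alpha> s $ i) (at s)" for s
      using milnor_flow_component[of a i s] by (simp add: \<alpha>_def k_def milnor_field_def mult_ac)
  qed auto
  then show ?thesis by (simp add: \<alpha>_def)
qed

lemma milnor_flow_1_pos: "milnor_flow s (vector [1, m2, m3]) $ 1 > 0"
  using milnor_flow_sgn[OF vector_1_nonzero, of s m2 m3 1] by (simp add: sgn_1_pos)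

lemma planar_flow_0 [simp]: "planar_flow 0 m = m"
  by (simp add: planar_flow_def)

lemma vector_planar_flow:
  "vector [1, fst (planar_flow s m), snd (planar_flow s m)] =
    (1 / milnor_flow s (vector [1, fst m, snd m]) $ 1) *\<^sub>R milnor_flow s (vector [1, fst m, snd m])"
  using milnor_flow_1_pos[of s "fst m" "snd m"]
  by (simp add: planar_flow_def Let_def vec_eq_iff forall_3)

lemma planar_flow_add: "planar_flow (s + t) m = planar_flow s (planar_flow t m)"
  unfolding planar_flow_def[of s] vector_planar_flow milnor_flow_scale milnor_flow_add[symmetric]
  using milnor_flow_1_pos[of t "fst m" "snd m"]
  by (simp add: planar_flow_def Let_def)

text \<open>Renormalising the first entry of the flowed triple to 1 does not change its class, so
  the planar flow covers the dynamics on the phase space.\<close>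

lemma ricci_dynamics_proj:
  "ricci_dynamics s (proj (Some m)) = proj (Some (planar_flow s m))"
proof -
  let ?a = "milnor_flow s (vector [1, fst m, snd m])"
  have "similar_triples ?a (vector [1, fst (planar_flow s m), snd (planar_flow s m)])"
    using milnor_flow_1_pos[of s "fst m" "snd m"]
    unfolding similar_triples_def vector_planar_flow
    by (intro exI[of _ "1 / ?a $ 1"] exI[of _ id]) simp
  from similar_triple_class[OF this milnor_flow_nonzero[OF vector_1_nonzero]] show ?thesis
    using ricci_dynamics_triple_class[OF vector_1_nonzero, of s "fst m" "snd m"]
    by (metis proj.simps(2) prod.collapse)
qed

lemma continuous_planar_flow: "continuous_on UNIV (planar_flow s)"
proof -
  have "(exp (300 * \<bar>s\<bar>))-lipschitz_on UNIV (milnor_flow s)"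
    using milnor_flow_dist by (auto simp: lipschitz_on_def dist_norm)
  then have "continuous_on UNIV (milnor_flow s)" by (rule lipschitz_on_continuous_on)
  moreover have "continuous_on UNIV (\<lambda>m::real \<times> real. vector [1, fst m, snd m] :: real^3)"
  proof -
    have "(\<lambda>m::real \<times> real. vector [1, fst m, snd m] :: real^3) =
      (\<lambda>m. axis 1 1 + fst m *\<^sub>R axis 2 1 + snd m *\<^sub>R axis 3 1)"
      by (simp add: fun_eq_iff vec_eq_iff forall_3 axis_def)
    then show ?thesis by (simp only:) (intro continuous_intros)
  qed
  ultimately have "continuous_on UNIV (\<lambda>m. milnor_flow s (vector [1, fst m, snd m]))"
    using continuous_on_compose2 by blast
  then show ?thesis
    unfolding planar_flow_def[abs_def] Let_def
    using milnor_flow_1_pos[of s] by (intro continuous_intros) (auto simp: less_imp_neq[symmetric])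
qed

text \<open>The time-change factor between the flow on triples and the planar system; the
  denominator is |a|^2 / a_1^2.\<close>

definition planar_speed :: "real \<times> real \<Rightarrow> real" where
  "planar_speed m = 2 / (1 + (fst m)\<^sup>2 + (snd m)\<^sup>2)"

lemma planar_speed_pos [simp]: "planar_speed m > 0"
  by (simp add: planar_speed_def add_pos_nonneg)

lemma planar_flow_derivative:
  shows "((\<lambda>s. fst (planar_flow s m)) has_real_derivative
      planar_speed (planar_flow s m) * fst (planar_field (planar_flow s m))) (at s)" (is ?x)
    and "((\<lambda>s. snd (planar_flow s m)) has_real_derivative
      planar_speed (planar_flow s m) * snd (planar_field (planar_flow s m))) (at s)" (is ?y)
proof -
  define \<alpha> where "\<alpha> s = milnor_flow s (vector [1, fst m, snd m])" for s
  define a1 where "a1 = \<alpha> s $ 1"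
  define x where "x = fst (planar_flow s m)"
  define y where "y = snd (planar_flow s m)"
  have a1: "a1 > 0" unfolding a1_def \<alpha>_def by (rule milnor_flow_1_pos)
  have a23: "\<alpha> s $ 2 = a1 * x" "\<alpha> s $ 3 = a1 * y"
    using a1 by (simp_all add: x_def y_def planar_flow_def a1_def \<alpha>_def Let_def)
  have d: "((\<lambda>s. \<alpha> s $ i) has_real_derivative milnor_field (\<alpha> s) $ i) (at s)" for i
    unfolding \<alpha>_def by (rule milnor_flow_component)
  have dd: "((\<lambda>s. \<alpha> s $ i / \<alpha> s $ 1) has_real_derivative
      (milnor_field (\<alpha> s) $ i * \<alpha> s $ 1 - \<alpha> s $ i * milnor_field (\<alpha> s) $ 1) / (\<alpha> s $ 1 * \<alpha> s $ 1)) (at s)" for i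
    by (rule DERIV_divide[OF d d]) (use a1 in \<open>simp add: a1_def\<close>)
  define n where "n = 1 + x\<^sup>2 + y\<^sup>2"
  have n: "n > 0" unfolding n_def by (simp add: add_pos_nonneg)
  have nn: "\<alpha> s \<bullet> \<alpha> s = a1\<^sup>2 * n"
    by (simp add: inner_vec_def sum_3 a23 n_def power2_eq_square algebra_simps flip: a1_def)
  have f: "milnor_field (\<alpha> s) $ i = \<alpha> s $ i * (2 * n - (1 + x + y)\<^sup>2 + 4 * (1 + x + y) * (\<alpha> s $ i / a1)
      - 8 * (\<alpha> s $ i / a1)\<^sup>2) / (2 * n)" for i
  proof -
    have "(\<Sum>j\<in>UNIV. \<alpha> s $ j) = a1 * (1 + x + y)"
      by (simp add: sum_3 a23 algebra_simps flip: a1_def)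
    then show ?thesis
      unfolding milnor_field_def nn using a1 n
      by (simp add: field_simps power2_eq_square)
  qed
  have fx: "(milnor_field (\<alpha> s) $ 2 * a1 - \<alpha> s $ 2 * milnor_field (\<alpha> s) $ 1) / (a1 * a1)
      = 2 / n * (x * (1 - x) * (1 + x - y))"
    unfolding f a1_def[symmetric] a23 using a1 n by (simp add: field_simps power2_eq_square)
  have fy: "(milnor_field (\<alpha> s) $ 3 * a1 - \<alpha> s $ 3 * milnor_field (\<alpha> s) $ 1) / (a1 * a1)
      = 2 / n * (y * (1 - y) * (1 - x + y))"
    unfolding f a1_def[symmetric] a23 using a1 n by (simp add: field_simps power2_eq_square)
  have pf: "planar_speed (planar_flow s m) = 2 / n"
    "planar_field (planar_flow s m) = (x * (1 - x) * (1 + x - y), y * (1 - y) * (1 - x + y))"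
    by (simp_all add: planar_speed_def n_def x_def y_def planar_field_def case_prod_beta)
  show ?x using dd[of 2] unfolding a1_def[symmetric] fx pf
    by (simp add: planar_flow_def Let_def \<alpha>_def)
  show ?y using dd[of 3] unfolding a1_def[symmetric] fy pf
    by (simp add: planar_flow_def Let_def \<alpha>_def)
qed

lemma continuous_planar_flow_time: "continuous_on A (\<lambda>s. planar_flow s m)"
proof -
  have "continuous_on UNIV (\<lambda>s. fst (planar_flow s m))" "continuous_on UNIV (\<lambda>s. snd (planar_flow s m))"
    by (rule DERIV_continuous_on, rule planar_flow_derivative)+
  from continuous_on_Pair[OF this] have "continuous_on UNIV (\<lambda>s. planar_flow s m)" by simp
  then show ?thesis by (rule continuous_on_subset) simp
qed

lemma continuous_planar_speed: "continuous_on A planar_speed"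
  unfolding planar_speed_def[abs_def]
  by (intro continuous_intros) (auto simp: add_pos_nonneg less_imp_neq[symmetric])

interpretation flow: planar_curve UNIV "\<lambda>s. planar_speed (planar_flow s m)"
  "\<lambda>s. fst (planar_flow s m)" "\<lambda>s. snd (planar_flow s m)" for m
proof
  show "continuous_on UNIV (\<lambda>s. planar_speed (planar_flow s m))"
    using continuous_on_compose2[OF continuous_planar_speed[of UNIV] continuous_planar_flow_time[of UNIV m]]
    by simp
qed (use planar_flow_derivative in auto)

subsection \<open>Limits of trajectories\<close>

text \<open>On \<open>S_m\<close> the factor 1 + x - y is at least 1, so the first component
  vanishes only on the edges x = 0 and x = 1.\<close>

lemma planar_equilibria:
  assumes "planar_field q = 0" "q \<in> S_m"
  shows "q \<in> {(0, 0), (0, - 1), (1, 0), (1, 1)}"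
proof -
  obtain x y where q: "q = (x, y)" by (cases q)
  have S: "0 \<le> x" "x \<le> 1" "y \<le> x" using assms(2) by (auto simp: q S_m_def)
  have "x = 0 \<or> x = 1" using assms(1) S by (auto simp: q planar_field_def prod_eq_iff)
  then show ?thesis using assms(1) S by (auto simp: q planar_field_def prod_eq_iff)
qed

lemma planar_flow_S_m:
  assumes "m \<in> S_m"
  shows "planar_flow s m \<in> S_m"
  using assms flow.sgn_x[of 0 s m] flow.sgn_1_x[of 0 s m] flow.sgn_x_y[of 0 s m]
  by (auto simp: S_m_def sgn_if case_prod_beta split: if_splits)

lemma closed_S_m: "closed S_m"
proof -
  have "S_m = {m. 0 \<le> fst m} \<inter> {m. fst m \<le> 1} \<inter> {m. snd m \<le> fst m}"
    by (auto simp: S_m_def)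
  moreover have "closed ({m::real \<times> real. 0 \<le> fst m} \<inter> {m. fst m \<le> 1} \<inter> {m. snd m \<le> fst m})"
    by (intro closed_Int closed_Collect_le continuous_intros)
  ultimately show ?thesis by simp
qed

lemma monotone_bounded_at_top:
  fixes f :: "real \<Rightarrow> real"
  assumes "(\<forall>s\<ge>a. \<forall>t\<ge>s. f s \<le> f t) \<or> (\<forall>s\<ge>a. \<forall>t\<ge>s. f t \<le> f s)" "\<And>s. s \<ge> a \<Longrightarrow> \<bar>f s\<bar> \<le> b"
  shows "\<exists>l. (f \<longlongrightarrow> l) at_top"
  using assms(1)
proof
  assume "\<forall>s\<ge>a. \<forall>t\<ge>s. f s \<le> f t"
  then show ?thesis
    using eventually_mono_bounded_tendsto[of a f b] assms(2) by (metis abs_le_D1)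
next
  assume "\<forall>s\<ge>a. \<forall>t\<ge>s. f t \<le> f s"
  moreover have "- b \<le> f s" if "a \<le> s" for s using assms(2)[OF that] by linarith
  ultimately show ?thesis using eventually_antimono_bounded_tendsto[of a f "- b"] by metis
qed

lemma monotone_bounded_at_bot:
  fixes f :: "real \<Rightarrow> real"
  assumes "(\<forall>t\<le>a. \<forall>s\<le>t. f s \<le> f t) \<or> (\<forall>t\<le>a. \<forall>s\<le>t. f t \<le> f s)" "\<And>s. s \<le> a \<Longrightarrow> \<bar>f s\<bar> \<le> b"
  shows "\<exists>l. (f \<longlongrightarrow> l) at_bot"
proof -
  have "\<exists>l. ((\<lambda>s. f (- s)) \<longlongrightarrow> l) at_top"
  proof (rule monotone_bounded_at_top)
    show "(\<forall>s\<ge>- a. \<forall>t\<ge>s. f (- s) \<le> f (- t)) \<or> (\<forall>s\<ge>- a. \<forall>t\<ge>s. f (- t) \<le> f (- s))"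
      using assms(1) by (metis le_imp_neg_le minus_minus)
    show "\<bar>f (- s)\<bar> \<le> b" if "s \<ge> - a" for s using assms(2)[of "- s"] that by simp
  qed
  then show ?thesis by (simp add: filterlim_at_bot_mirror)
qed

lemma planar_flow_fst_mono:
  assumes "m \<in> S_m" "s \<le> t"
  shows "fst (planar_flow s m) \<le> fst (planar_flow t m)"
proof (rule flow.nondecreasing_on[OF flow.dx])
  fix r
  have "planar_flow r m \<in> S_m" using planar_flow_S_m[OF assms(1)] .
  then show "0 \<le> planar_speed (planar_flow r m) *
      fst (planar_field (fst (planar_flow r m), snd (planar_flow r m)))"
    by (auto simp: S_m_def planar_field_def case_prod_beta intro!: mult_nonneg_nonneg less_imp_le[OF planar_speed_pos])
qed (use assms in auto)

lemma planar_flow_snd_mono: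
  assumes "\<And>r. s < r \<Longrightarrow> r < t \<Longrightarrow> 0 \<le> snd (planar_field (planar_flow r m))" "s \<le> t"
  shows "snd (planar_flow s m) \<le> snd (planar_flow t m)"
  by (rule flow.nondecreasing_on[OF flow.dy])
    (use assms in \<open>auto intro!: mult_nonneg_nonneg less_imp_le[OF planar_speed_pos]\<close>)

lemma planar_flow_snd_antimono:
  assumes "\<And>r. s < r \<Longrightarrow> r < t \<Longrightarrow> snd (planar_field (planar_flow r m)) \<le> 0" "s \<le> t"
  shows "snd (planar_flow t m) \<le> snd (planar_flow s m)"
  by (rule flow.nonincreasing_on[OF flow.dy])
    (use assms in \<open>auto intro!: mult_nonneg_nonpos less_imp_le[OF planar_speed_pos]\<close>)

lemma continuous_planar_field: "continuous_on A planar_field"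
  unfolding planar_field_def case_prod_beta by (intro continuous_intros)

text \<open>Along a converging trajectory the derivative converges to \<open>planar_speed\<close>
  times the field at the limit, and a convergent function cannot have a nonzero limit of
  derivatives.\<close>

lemma planar_flow_tendsto_equilibrium:
  assumes F: "F = at_top \<or> F = at_bot" and q: "((\<lambda>s. planar_flow s m) \<longlongrightarrow> q) F" and m: "m \<in> S_m"
  shows "q \<in> {(0, 0), (0, - 1), (1, 0), (1, 1)}"
proof (rule planar_equilibria)
  have nb: "F \<noteq> bot"
    using F trivial_limit_at_top_linorder trivial_limit_at_bot_linorder by metis
  show "q \<in> S_m"
    by (rule Lim_in_closed_set[OF closed_S_m _ nb q]) (simp add: planar_flow_S_m[OF m])
  have "isCont planar_field q" "isCont planar_speed q"
    using continuous_planar_field[of UNIV] continuous_planar_speed[of UNIV]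
    by (simp_all del: split_paired_All add: continuous_on_eq_continuous_at)
  then have l: "((\<lambda>s. planar_field (planar_flow s m)) \<longlongrightarrow> planar_field q) F"
    "((\<lambda>s. planar_speed (planar_flow s m)) \<longlongrightarrow> planar_speed q) F"
    using q by (auto intro: isCont_tendsto_compose)
  have z: "d = 0" if "(f \<longlongrightarrow> l) F" "(f' \<longlongrightarrow> d) F"
    "\<And>s. (f has_real_derivative f' s) (at s)" for f f' :: "real \<Rightarrow> real" and l d
    using F that tendsto_derivative_at_top_zero[OF _ _ that(3)]
      tendsto_derivative_at_bot_zero[OF _ _ that(3)] by blast
  have "planar_speed q * fst (planar_field q) = 0"
    by (rule z[OF tendsto_fst[OF q] tendsto_mult[OF l(2) tendsto_fst[OF l(1)]] planar_flow_derivative(1)])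
  moreover have "planar_speed q * snd (planar_field q) = 0"
    by (rule z[OF tendsto_snd[OF q] tendsto_mult[OF l(2) tendsto_snd[OF l(1)]] planar_flow_derivative(2)])
  ultimately show "planar_field q = 0"
    using planar_speed_pos[of q] by (simp add: prod_eq_iff)
qed

text \<open>On \<open>S_m\<close> the coordinate m2 is monotone in [0, 1] and m3 is bounded above by
  m2, so a lower bound and eventual monotonicity of m3 give convergence. The last conclusion keeps
  the monotonicity of m2, which later excludes equilibria on the edge m2 = 0.\<close>

lemma planar_flow_converges_top:
  assumes m: "m \<in> S_m"
    and "(\<forall>s\<ge>a. 0 \<le> snd (planar_field (planar_flow s m))) \<or> (\<forall>s\<ge>a. snd (planar_field (planar_flow s m)) \<le> 0)"
    and b: "\<And>s. s \<ge> a \<Longrightarrow> b \<le> snd (planar_flow s m)"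
  obtains q where "q \<in> {(0, 0), (0, - 1), (1, 0), (1, 1)}" "((\<lambda>s. planar_flow s m) \<longlongrightarrow> q) at_top"
    "\<And>r. fst (planar_flow r m) \<le> fst q"
proof -
  have S: "0 \<le> fst (planar_flow s m)" "fst (planar_flow s m) \<le> 1" "snd (planar_flow s m) \<le> fst (planar_flow s m)" for s
    using planar_flow_S_m[OF m, of s] by (auto simp: S_m_def)
  obtain lx where lx: "((\<lambda>s. fst (planar_flow s m)) \<longlongrightarrow> lx) at_top"
    using monotone_bounded_at_top[of 0 "\<lambda>s. fst (planar_flow s m)" 1] planar_flow_fst_mono[OF m] S(1,2)
    by (auto simp: abs_le_iff order_trans[OF _ S(1)])
  have "\<bar>snd (planar_flow s m)\<bar> \<le> \<bar>b\<bar> + 1" if "s \<ge> a" for s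
    using b[OF that] S[of s] by linarith
  moreover have "(\<forall>s\<ge>a. \<forall>t\<ge>s. snd (planar_flow s m) \<le> snd (planar_flow t m)) \<or>
      (\<forall>s\<ge>a. \<forall>t\<ge>s. snd (planar_flow t m) \<le> snd (planar_flow s m))"
    using assms(2)
  proof
    assume *: "\<forall>s\<ge>a. 0 \<le> snd (planar_field (planar_flow s m))"
    then have "\<forall>s\<ge>a. \<forall>t\<ge>s. snd (planar_flow s m) \<le> snd (planar_flow t m)"
      by (intro allI impI planar_flow_snd_mono) auto
    then show ?thesis ..
  next
    assume *: "\<forall>s\<ge>a. snd (planar_field (planar_flow s m)) \<le> 0"
    then have "\<forall>s\<ge>a. \<forall>t\<ge>s. snd (planar_flow t m) \<le> snd (planar_flow s m)"
      by (intro allI impI planar_flow_snd_antimono) auto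
    then show ?thesis ..
  qed
  ultimately obtain ly where ly: "((\<lambda>s. snd (planar_flow s m)) \<longlongrightarrow> ly) at_top"
    using monotone_bounded_at_top[of a "\<lambda>s. snd (planar_flow s m)" "\<bar>b\<bar> + 1"] by blast
  have q: "((\<lambda>s. planar_flow s m) \<longlongrightarrow> (lx, ly)) at_top"
    using tendsto_Pair[OF lx ly] by simp
  have "fst (planar_flow r m) \<le> lx" for r
    by (rule tendsto_lowerbound[OF lx])
      (use planar_flow_fst_mono[OF m] in \<open>auto simp: eventually_at_top_linorder\<close>)
  moreover have "(lx, ly) \<in> {(0, 0), (0, - 1), (1, 0), (1, 1)}"
    using planar_flow_tendsto_equilibrium[OF _ q m] by blast
  ultimately show ?thesis using that[OF _ q] by simp
qed

lemma planar_flow_converges_bot: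
  assumes m: "m \<in> S_m"
    and "(\<forall>s\<le>a. 0 \<le> snd (planar_field (planar_flow s m))) \<or> (\<forall>s\<le>a. snd (planar_field (planar_flow s m)) \<le> 0)"
    and b: "\<And>s. s \<le> a \<Longrightarrow> b \<le> snd (planar_flow s m)"
  obtains q where "q \<in> {(0, 0), (0, - 1), (1, 0), (1, 1)}" "((\<lambda>s. planar_flow s m) \<longlongrightarrow> q) at_bot"
    "\<And>r. fst q \<le> fst (planar_flow r m)"
proof -
  have S: "0 \<le> fst (planar_flow s m)" "fst (planar_flow s m) \<le> 1" "snd (planar_flow s m) \<le> fst (planar_flow s m)" for s
    using planar_flow_S_m[OF m, of s] by (auto simp: S_m_def)
  obtain lx where lx: "((\<lambda>s. fst (planar_flow s m)) \<longlongrightarrow> lx) at_bot"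
    using monotone_bounded_at_bot[of 0 "\<lambda>s. fst (planar_flow s m)" 1] planar_flow_fst_mono[OF m] S(1,2)
    by (auto simp: abs_le_iff order_trans[OF _ S(1)])
  have "\<bar>snd (planar_flow s m)\<bar> \<le> \<bar>b\<bar> + 1" if "s \<le> a" for s
    using b[OF that] S[of s] by linarith
  moreover have "(\<forall>t\<le>a. \<forall>s\<le>t. snd (planar_flow s m) \<le> snd (planar_flow t m)) \<or>
      (\<forall>t\<le>a. \<forall>s\<le>t. snd (planar_flow t m) \<le> snd (planar_flow s m))"
    using assms(2)
  proof
    assume *: "\<forall>s\<le>a. 0 \<le> snd (planar_field (planar_flow s m))"
    then have "\<forall>t\<le>a. \<forall>s\<le>t. snd (planar_flow s m) \<le> snd (planar_flow t m)"
      by (intro allI impI planar_flow_snd_mono) auto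
    then show ?thesis ..
  next
    assume *: "\<forall>s\<le>a. snd (planar_field (planar_flow s m)) \<le> 0"
    then have "\<forall>t\<le>a. \<forall>s\<le>t. snd (planar_flow t m) \<le> snd (planar_flow s m)"
      by (intro allI impI planar_flow_snd_antimono) auto
    then show ?thesis ..
  qed
  ultimately obtain ly where ly: "((\<lambda>s. snd (planar_flow s m)) \<longlongrightarrow> ly) at_bot"
    using monotone_bounded_at_bot[of a "\<lambda>s. snd (planar_flow s m)" "\<bar>b\<bar> + 1"] by blast
  have q: "((\<lambda>s. planar_flow s m) \<longlongrightarrow> (lx, ly)) at_bot"
    using tendsto_Pair[OF lx ly] by simp
  have "lx \<le> fst (planar_flow r m)" for r
    by (rule tendsto_upperbound[OF lx])
      (use planar_flow_fst_mono[OF m] in \<open>auto simp: eventually_at_bot_linorder\<close>)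
  moreover have "(lx, ly) \<in> {(0, 0), (0, - 1), (1, 0), (1, 1)}"
    using planar_flow_tendsto_equilibrium[OF _ q m] by blast
  ultimately show ?thesis using that[OF _ q] by simp
qed

lemma planar_flow_sgn:
  shows "sgn (fst (planar_flow s m)) = sgn (fst m)" "sgn (1 - fst (planar_flow s m)) = sgn (1 - fst m)"
    "sgn (snd (planar_flow s m)) = sgn (snd m)" "sgn (1 - snd (planar_flow s m)) = sgn (1 - snd m)"
    "sgn (fst (planar_flow s m) - snd (planar_flow s m)) = sgn (fst m - snd m)"
    "fst m = 0 \<Longrightarrow> sgn (1 + snd (planar_flow s m)) = sgn (1 + snd m)"
proof -
  show x: "sgn (fst (planar_flow s m)) = sgn (fst m)" for s
    using flow.sgn_x[of s 0 m] by simp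
  show "fst m = 0 \<Longrightarrow> sgn (1 + snd (planar_flow s m)) = sgn (1 + snd m)"
    using flow.sgn_1_plus_y[of m s 0] x by (metis UNIV_I planar_flow_0 sgn_0_0)
qed (use flow.sgn_1_x[of s 0 m] flow.sgn_y[of s 0 m] flow.sgn_1_y[of s 0 m] flow.sgn_x_y[of s 0 m] in auto)

lemma planar_flow_cmp:
  shows "0 < fst (planar_flow s m) \<longleftrightarrow> 0 < fst m" "fst (planar_flow s m) < 1 \<longleftrightarrow> fst m < 1"
    "fst (planar_flow s m) = 0 \<longleftrightarrow> fst m = 0" "fst (planar_flow s m) = 1 \<longleftrightarrow> fst m = 1"
    "0 < snd (planar_flow s m) \<longleftrightarrow> 0 < snd m" "snd (planar_flow s m) < 0 \<longleftrightarrow> snd m < 0"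
    "snd (planar_flow s m) = 0 \<longleftrightarrow> snd m = 0" "snd (planar_flow s m) < 1 \<longleftrightarrow> snd m < 1"
    "snd (planar_flow s m) = 1 \<longleftrightarrow> snd m = 1"
    "snd (planar_flow s m) < fst (planar_flow s m) \<longleftrightarrow> snd m < fst m"
    "snd (planar_flow s m) = fst (planar_flow s m) \<longleftrightarrow> snd m = fst m"
    "fst m = 0 \<Longrightarrow> - 1 < snd (planar_flow s m) \<longleftrightarrow> - 1 < snd m"
    "fst m = 0 \<Longrightarrow> snd (planar_flow s m) = - 1 \<longleftrightarrow> snd m = - 1"
proof -
  have *: "(0 < a \<longleftrightarrow> 0 < b) \<and> (a < 0 \<longleftrightarrow> b < 0) \<and> (a = 0 \<longleftrightarrow> b = 0)"
    if "sgn a = sgn b" for a b :: real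
    using that by (auto simp: sgn_if split: if_splits)
  note sg = planar_flow_sgn[where s = s and m = m, THEN *]
  show "0 < fst (planar_flow s m) \<longleftrightarrow> 0 < fst m" "fst (planar_flow s m) < 1 \<longleftrightarrow> fst m < 1"
    "fst (planar_flow s m) = 0 \<longleftrightarrow> fst m = 0" "fst (planar_flow s m) = 1 \<longleftrightarrow> fst m = 1"
    using sg(1,2) by auto
  show "0 < snd (planar_flow s m) \<longleftrightarrow> 0 < snd m" "snd (planar_flow s m) < 0 \<longleftrightarrow> snd m < 0"
    "snd (planar_flow s m) = 0 \<longleftrightarrow> snd m = 0" "snd (planar_flow s m) < 1 \<longleftrightarrow> snd m < 1"
    "snd (planar_flow s m) = 1 \<longleftrightarrow> snd m = 1"
    using sg(3,4) by auto
  show "snd (planar_flow s m) < fst (planar_flow s m) \<longleftrightarrow> snd m < fst m"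
    "snd (planar_flow s m) = fst (planar_flow s m) \<longleftrightarrow> snd m = fst m"
    using sg(5) by (smt (verit))+
  show "fst m = 0 \<Longrightarrow> - 1 < snd (planar_flow s m) \<longleftrightarrow> - 1 < snd m"
    "fst m = 0 \<Longrightarrow> snd (planar_flow s m) = - 1 \<longleftrightarrow> snd m = - 1"
    using sg(6) by (smt (verit))+
qed

text \<open>For m3 \<ge> 0 both components of the field are nonnegative on \<open>S_m\<close>.
  Forward limits thus dominate the initial point in both coordinates, backward limits are dominated
  by it, and the invariant lines leave a single equilibrium in each case.\<close>

lemma planar_flow_quadrant_limits:
  assumes m: "m \<in> S_m" "0 \<le> snd m"
  shows "0 < fst m \<Longrightarrow> 0 < snd m \<Longrightarrow> ((\<lambda>s. planar_flow s m) \<longlongrightarrow> (1, 1)) at_top"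
    and "0 < fst m \<Longrightarrow> snd m = 0 \<Longrightarrow> ((\<lambda>s. planar_flow s m) \<longlongrightarrow> (1, 0)) at_top"
    and "fst m < 1 \<Longrightarrow> ((\<lambda>s. planar_flow s m) \<longlongrightarrow> (0, 0)) at_bot"
    and "fst m = 1 \<Longrightarrow> snd m < 1 \<Longrightarrow> ((\<lambda>s. planar_flow s m) \<longlongrightarrow> (1, 0)) at_bot"
proof -
  have y: "0 \<le> snd (planar_flow s m)" for s
    using m(2) planar_flow_cmp(6)[where s = s and m = m] by linarith
  have f: "0 \<le> snd (planar_field (planar_flow s m))" for s
    using planar_flow_S_m[OF m(1), of s] y[of s]
    by (auto simp: planar_field_def case_prod_beta S_m_def intro!: mult_nonneg_nonneg)
  have mono: "s \<le> t \<Longrightarrow> snd (planar_flow s m) \<le> snd (planar_flow t m)" for s t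
    using f by (intro planar_flow_snd_mono)
  obtain q where q: "q \<in> {(0, 0), (0, - 1), (1, 0), (1, 1)}" "((\<lambda>s. planar_flow s m) \<longlongrightarrow> q) at_top"
    "\<And>r. fst (planar_flow r m) \<le> fst q"
    using planar_flow_converges_top[OF m(1), of 0 0] f y by metis
  have q2: "snd m \<le> snd q"
    by (rule tendsto_lowerbound[OF tendsto_snd[OF q(2)]])
      (use mono[of 0] in \<open>auto simp: eventually_at_top_linorder\<close>)
  show "((\<lambda>s. planar_flow s m) \<longlongrightarrow> (1, 1)) at_top" if "0 < fst m" "0 < snd m"
    using q q(3)[of 0] q2 that by auto
  show "((\<lambda>s. planar_flow s m) \<longlongrightarrow> (1, 0)) at_top" if "0 < fst m" "snd m = 0"
  proof -
    have "snd q \<le> 0"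
      by (rule tendsto_upperbound[OF tendsto_snd[OF q(2)]]) (use planar_flow_cmp(7)[where m = m] that in auto)
    then show ?thesis using q q(3)[of 0] that by auto
  qed
  obtain q where q: "q \<in> {(0, 0), (0, - 1), (1, 0), (1, 1)}" "((\<lambda>s. planar_flow s m) \<longlongrightarrow> q) at_bot"
    "\<And>r. fst q \<le> fst (planar_flow r m)"
    using planar_flow_converges_bot[OF m(1), of 0 0] f y by metis
  have q2: "snd q \<le> snd m"
    by (rule tendsto_upperbound[OF tendsto_snd[OF q(2)]])
      (use mono[of _ 0] in \<open>auto simp: eventually_at_bot_linorder\<close>)
  have q3: "0 \<le> snd q"
    by (rule tendsto_lowerbound[OF tendsto_snd[OF q(2)]]) (use y in auto)
  show "((\<lambda>s. planar_flow s m) \<longlongrightarrow> (0, 0)) at_bot" if "fst m < 1"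
    using q q(3)[of 0] q3 that by auto
  show "((\<lambda>s. planar_flow s m) \<longlongrightarrow> (1, 0)) at_bot" if "fst m = 1" "snd m < 1"
  proof -
    have "1 \<le> fst q"
      by (rule tendsto_lowerbound[OF tendsto_fst[OF q(2)]]) (use planar_flow_cmp(4)[where m = m] that in auto)
    then show ?thesis using q q2 that by auto
  qed
qed

text \<open>On the edge m2 = 0 the second component of the field is m3 (1 - m3^2), which is negative
  between - 1 and 0.\<close>

lemma planar_flow_left_edge_limits:
  assumes m: "fst m = 0" "- 1 < snd m" "snd m < 0"
  shows "((\<lambda>s. planar_flow s m) \<longlongrightarrow> (0, - 1)) at_top" "((\<lambda>s. planar_flow s m) \<longlongrightarrow> (0, 0)) at_bot"
proof -
  have S: "m \<in> S_m" using m by (auto simp: S_m_def case_prod_beta)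
  have xy: "fst (planar_flow s m) = 0" "- 1 < snd (planar_flow s m)" "snd (planar_flow s m) < 0" for s
    using m planar_flow_cmp[where s = s and m = m] by auto
  have f: "snd (planar_field (planar_flow s m)) \<le> 0" for s
    using xy[of s] by (auto simp: planar_field_def case_prod_beta intro!: mult_nonpos_nonneg)
  have mono: "s \<le> t \<Longrightarrow> snd (planar_flow t m) \<le> snd (planar_flow s m)" for s t
    using f by (intro planar_flow_snd_antimono)
  obtain q where q: "q \<in> {(0, 0), (0, - 1), (1, 0), (1, 1)}" "((\<lambda>s. planar_flow s m) \<longlongrightarrow> q) at_top"
    using planar_flow_converges_top[OF S, of 0 "- 1"] f xy by (metis less_imp_le)
  have "snd q \<le> snd m"
    by (rule tendsto_upperbound[OF tendsto_snd[OF q(2)]])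
      (use mono[of 0] in \<open>auto simp: eventually_at_top_linorder\<close>)
  then show "((\<lambda>s. planar_flow s m) \<longlongrightarrow> (0, - 1)) at_top" using q m by auto
  obtain q where q: "q \<in> {(0, 0), (0, - 1), (1, 0), (1, 1)}" "((\<lambda>s. planar_flow s m) \<longlongrightarrow> q) at_bot"
    "\<And>r. fst q \<le> fst (planar_flow r m)"
    using planar_flow_converges_bot[OF S, of 0 "- 1"] f xy by (metis less_imp_le)
  have "snd m \<le> snd q"
    by (rule tendsto_lowerbound[OF tendsto_snd[OF q(2)]])
      (use mono[of _ 0] in \<open>auto simp: eventually_at_bot_linorder\<close>)
  then show "((\<lambda>s. planar_flow s m) \<longlongrightarrow> (0, 0)) at_bot" using q q(3)[of 0] m by auto
qed

text \<open>Otherwise m3 would be bounded and the trajectory would converge backwards to an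
  equilibrium whose m3 is at most the value at a. On the edge m2 = 1 the equilibria have m3 \<ge> 0,
  and none lies below - 1.\<close>

lemma planar_flow_diverges:
  assumes S: "m \<in> S_m" and f: "\<And>s. s \<le> a \<Longrightarrow> 0 \<le> snd (planar_field (planar_flow s m))"
    and y: "snd (planar_flow a m) < 0" and no: "fst m = 1 \<or> snd (planar_flow a m) < - 1"
  shows "filterlim (\<lambda>s. snd (planar_flow s m)) at_bot at_bot"
proof -
  have mono: "s \<le> t \<Longrightarrow> t \<le> a \<Longrightarrow> snd (planar_flow s m) \<le> snd (planar_flow t m)" for s t
    using f by (intro planar_flow_snd_mono) auto
  have "\<exists>s\<le>a. snd (planar_flow s m) < b" for b
  proof (rule ccontr)
    assume "\<not> ?thesis"
    then have b: "\<And>s. s \<le> a \<Longrightarrow> b \<le> snd (planar_flow s m)" by (simp add: not_less)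
    obtain q where q: "q \<in> {(0, 0), (0, - 1), (1, 0), (1, 1)}" "((\<lambda>s. planar_flow s m) \<longlongrightarrow> q) at_bot"
      using planar_flow_converges_bot[OF S, of a b] f b by metis
    have "snd q \<le> snd (planar_flow a m)"
      by (rule tendsto_upperbound[OF tendsto_snd[OF q(2)]])
        (use mono[of _ a] in \<open>auto simp: eventually_at_bot_linorder\<close>)
    moreover have "fst q = 1" if "fst m = 1"
      by (rule tendsto_unique[OF _ tendsto_fst[OF q(2)]]) (use planar_flow_cmp(4)[where m = m] that in auto)
    ultimately show False using q(1) no y by auto
  qed
  then show ?thesis
    unfolding filterlim_at_bot eventually_at_bot_linorder
    using mono by (meson less_imp_le order_trans)
qed

lemma planar_flow_right_edge_limits:
  assumes m: "fst m = 1" "snd m < 0"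
  shows "((\<lambda>s. planar_flow s m) \<longlongrightarrow> (1, 0)) at_top"
    "filterlim (\<lambda>s. snd (planar_flow s m)) at_bot at_bot"
proof -
  have S: "m \<in> S_m" using m by (auto simp: S_m_def case_prod_beta)
  have xy: "fst (planar_flow s m) = 1" "snd (planar_flow s m) < 0" for s
    using m planar_flow_cmp[where s = s and m = m] by auto
  have f: "0 \<le> snd (planar_field (planar_flow s m))" for s
    using xy[of s] by (auto simp: planar_field_def case_prod_beta mult.assoc zero_le_mult_iff mult_le_0_iff)
  have mono: "s \<le> t \<Longrightarrow> snd (planar_flow s m) \<le> snd (planar_flow t m)" for s t
    using f by (intro planar_flow_snd_mono)
  obtain q where q: "q \<in> {(0, 0), (0, - 1), (1, 0), (1, 1)}" "((\<lambda>s. planar_flow s m) \<longlongrightarrow> q) at_top"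
    "\<And>r. fst (planar_flow r m) \<le> fst q"
    using planar_flow_converges_top[OF S, of 0 "snd m"] f mono[of 0] by (metis planar_flow_0)
  have "snd q \<le> 0"
    by (rule tendsto_upperbound[OF tendsto_snd[OF q(2)]]) (simp_all add: xy less_imp_le)
  then show "((\<lambda>s. planar_flow s m) \<longlongrightarrow> (1, 0)) at_top" using q q(3)[of 0] m by auto
  show "filterlim (\<lambda>s. snd (planar_flow s m)) at_bot at_bot"
    by (rule planar_flow_diverges[OF S, of 0]) (use f m in auto)
qed

subsection \<open>The separatrix\<close>

definition strip :: "(real \<times> real) set" where
  "strip = {m. 0 < fst m \<and> fst m < 1 \<and> snd m < 0}"

text \<open>A single time is enough because being above the line persists backwards. The existential
  form makes the set invariant under the flow and open; the same holds for
  \<open>below_separatrix\<close>.\<close>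

definition above_separatrix :: "(real \<times> real) set" where
  "above_separatrix = {m \<in> strip. \<exists>s. fst (planar_flow s m) - 1 < snd (planar_flow s m)}"

definition below_separatrix :: "(real \<times> real) set" where
  "below_separatrix = {m \<in> strip. \<exists>s. snd (planar_flow s m) < - 1}"

definition separatrix :: "(real \<times> real) set" where
  "separatrix = {m \<in> strip. \<forall>s. - 1 < snd (planar_flow s m) \<and> snd (planar_flow s m) < fst (planar_flow s m) - 1}"

lemma strip_S_m: "strip \<subseteq> S_m"
  by (auto simp: strip_def S_m_def)

lemma planar_flow_strip: "planar_flow s m \<in> strip \<longleftrightarrow> m \<in> strip"
  using planar_flow_cmp[where s = s and m = m] by (simp add: strip_def)

lemma above_backward:
  assumes "m \<in> strip" "s < t" "fst (planar_flow t m) - 1 \<le> snd (planar_flow t m)"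
  shows "fst (planar_flow s m) - 1 < snd (planar_flow s m)"
  by (rule flow.above_line_backward[where m = m and r = 0 and t = t])
    (use assms in \<open>auto simp: strip_def\<close>)

lemma below_backward:
  assumes "m \<in> strip" "s < t" "snd (planar_flow t m) \<le> - 1"
  shows "snd (planar_flow s m) < - 1"
  by (rule flow.below_minus_1_backward[where m = m and r = 0 and t = t])
    (use assms in \<open>auto simp: strip_def\<close>)

lemma strip_cases: "strip = above_separatrix \<union> below_separatrix \<union> separatrix"
proof -
  have "m \<in> above_separatrix \<union> below_separatrix" if m: "m \<in> strip" "m \<notin> separatrix" for m
  proof -
    obtain s where "snd (planar_flow s m) \<le> - 1 \<or> fst (planar_flow s m) - 1 \<le> snd (planar_flow s m)"
      using m by (auto simp: separatrix_def not_less)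
    \<comment> \<open>Touching a boundary line at s means being strictly across it at any earlier
      time.\<close>
    then have "snd (planar_flow (s - 1) m) < - 1 \<or> fst (planar_flow (s - 1) m) - 1 < snd (planar_flow (s - 1) m)"
      using above_backward[OF m(1), of "s - 1" s] below_backward[OF m(1), of "s - 1" s] by auto
    then show ?thesis using m by (auto simp: above_separatrix_def below_separatrix_def)
  qed
  then show ?thesis by (auto simp: above_separatrix_def below_separatrix_def separatrix_def)
qed

lemma separatrix_disjoint:
  "above_separatrix \<inter> below_separatrix = {}" "above_separatrix \<inter> separatrix = {}"
  "below_separatrix \<inter> separatrix = {}"
proof -
  show "above_separatrix \<inter> below_separatrix = {}"
  proof (rule ccontr)
    assume "above_separatrix \<inter> below_separatrix \<noteq> {}"
    then obtain m s t where m: "m \<in> strip" "fst (planar_flow s m) - 1 < snd (planar_flow s m)"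
      "snd (planar_flow t m) < - 1"
      by (auto simp: above_separatrix_def below_separatrix_def)
    \<comment> \<open>Before both times the two conditions hold together, so that x - 1 < y < - 1,
      against x > 0.\<close>
    define r where "r = min s t - 1"
    have "fst (planar_flow r m) - 1 < snd (planar_flow r m)"
      by (rule above_backward[OF m(1), of r s]) (use m(2) in \<open>auto simp: r_def\<close>)
    moreover have "snd (planar_flow r m) < - 1"
      by (rule below_backward[OF m(1), of r t]) (use m(3) in \<open>auto simp: r_def\<close>)
    moreover have "0 < fst (planar_flow r m)"
      using m(1) planar_flow_strip[of r m] by (simp add: strip_def)
    ultimately show False by linarith
  qed
  show "above_separatrix \<inter> separatrix = {}" "below_separatrix \<inter> separatrix = {}"
    by (auto simp: above_separatrix_def below_separatrix_def separatrix_def) (meson less_asym)+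
qed

lemma planar_flow_separatrix:
  "planar_flow t m \<in> above_separatrix \<longleftrightarrow> m \<in> above_separatrix"
  "planar_flow t m \<in> below_separatrix \<longleftrightarrow> m \<in> below_separatrix"
  "planar_flow t m \<in> separatrix \<longleftrightarrow> m \<in> separatrix"
proof -
  have s: "s = (s - t) + t" for s by simp
  show "planar_flow t m \<in> above_separatrix \<longleftrightarrow> m \<in> above_separatrix"
    unfolding above_separatrix_def mem_Collect_eq planar_flow_strip planar_flow_add[symmetric]
    by (metis s)
  show "planar_flow t m \<in> below_separatrix \<longleftrightarrow> m \<in> below_separatrix"
    unfolding below_separatrix_def mem_Collect_eq planar_flow_strip planar_flow_add[symmetric]
    by (metis s)
  show "planar_flow t m \<in> separatrix \<longleftrightarrow> m \<in> separatrix"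
    unfolding separatrix_def mem_Collect_eq planar_flow_strip planar_flow_add[symmetric]
    by (metis s)
qed

lemma open_strip: "open strip"
proof -
  have "strip = {m. 0 < fst m} \<inter> {m. fst m < 1} \<inter> {m. snd m < 0}" by (auto simp: strip_def)
  moreover have "open ({m::real \<times> real. 0 < fst m} \<inter> {m. fst m < 1} \<inter> {m. snd m < 0})"
    by (intro open_Int open_Collect_less continuous_intros)
  ultimately show ?thesis by simp
qed

text \<open>Each side is a union over all times of preimages of an open half plane under the
  continuous time maps.\<close>

lemma open_separatrix_sides: "open above_separatrix" "open below_separatrix"
proof -
  have c: "open (planar_flow s -` A)" if "open A" for s A
    using continuous_planar_flow[of s] that by (simp add: continuous_on_open_vimage)
  have "above_separatrix = strip \<inter> (\<Union>s. planar_flow s -` {p. fst p - 1 < snd p})"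
    by (auto simp: above_separatrix_def)
  moreover have "open {p::real \<times> real. fst p - 1 < snd p}"
    by (intro open_Collect_less continuous_intros)
  then have "open (strip \<inter> (\<Union>s. planar_flow s -` {p. fst p - 1 < snd p}))"
    by (intro open_Int open_UN ballI c open_strip)
  ultimately show "open above_separatrix" by simp
  have "below_separatrix = strip \<inter> (\<Union>s. planar_flow s -` {p. snd p < - 1})"
    by (auto simp: below_separatrix_def)
  moreover have "open {p::real \<times> real. snd p < - 1}"
    by (intro open_Collect_less continuous_intros)
  then have "open (strip \<inter> (\<Union>s. planar_flow s -` {p. snd p < - 1}))"
    by (intro open_Int open_UN ballI c open_strip)
  ultimately show "open below_separatrix" by simp
qed

lemma separatrix_sides_easy:
  assumes "m \<in> strip"
  shows "fst m - 1 < snd m \<Longrightarrow> m \<in> above_separatrix" "snd m < - 1 \<Longrightarrow> m \<in> below_separatrix"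
  using assms by (auto simp: above_separatrix_def below_separatrix_def intro!: exI[of _ 0])

text \<open>Shooting: on a vertical line the two open sides of the separatrix cannot exhaust the connected
  segment \<open>y < 0\<close>.\<close>

lemma separatrix_exists:
  assumes x: "0 < x" "x < 1"
  shows "\<exists>y. (x, y) \<in> separatrix"
proof (rule ccontr)
  assume no: "\<not> ?thesis"
  define A where "A = {y. (x, y) \<in> above_separatrix}"
  define B where "B = {y. (x, y) \<in> below_separatrix}"
  have o: "open {y. (x, y) \<in> C}" if "open C" for C :: "(real \<times> real) set"
  proof -
    have "open ((\<lambda>y. (x, y)) -` C)" by (intro open_vimage that continuous_intros)
    then show ?thesis by (simp add: vimage_def)
  qed
  have st: "(x, y) \<in> strip \<longleftrightarrow> y < 0" for y using x by (simp add: strip_def)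
  have "connected {..<0::real}" by simp
  moreover have "open A" "open B" unfolding A_def B_def by (intro o open_separatrix_sides)+
  moreover have "{..<0} \<subseteq> A \<union> B"
    using st no strip_cases by (auto simp: A_def B_def)
  moreover have "A \<inter> B \<inter> {..<0} = {}" using separatrix_disjoint(1) by (auto simp: A_def B_def)
  moreover have "(x - 1) / 2 \<in> A \<inter> {..<0}"
    using separatrix_sides_easy(1)[of "(x, (x - 1) / 2)"] x st by (simp add: A_def field_simps)
  moreover have "- 2 \<in> B \<inter> {..<0}"
    using separatrix_sides_easy(2)[of "(x, - 2)"] st by (simp add: B_def)
  ultimately show False unfolding connected_def by blast
qed

text \<open>Once on or below the line y = x - 1, a trajectory stays there and y increases; if it is
  above the line forever, y decreases and stays above - 1. In both cases there is a limit with
  positive m2 and nonpositive m3, and (1, 0) is the only such equilibrium.\<close>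

lemma strip_limit_top:
  assumes m: "m \<in> strip"
  shows "((\<lambda>s. planar_flow s m) \<longlongrightarrow> (1, 0)) at_top"
proof -
  have st: "0 < fst (planar_flow s m)" "fst (planar_flow s m) < 1" "snd (planar_flow s m) < 0" for s
    using m planar_flow_strip[of s m] by (auto simp: strip_def)
  have f: "snd (planar_field (planar_flow s m)) =
      (- snd (planar_flow s m)) * (1 - snd (planar_flow s m)) * (fst (planar_flow s m) - 1 - snd (planar_flow s m))" for s
    by (simp add: planar_field_def case_prod_beta algebra_simps)
  have S: "m \<in> S_m" using m strip_S_m by blast
  obtain q where q: "q \<in> {(0, 0), (0, - 1), (1, 0), (1, 1)}" "((\<lambda>s. planar_flow s m) \<longlongrightarrow> q) at_top"
    "\<And>r. fst (planar_flow r m) \<le> fst q"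
  proof (cases "\<exists>a. snd (planar_flow a m) \<le> fst (planar_flow a m) - 1")
    case True
    then obtain a where a: "snd (planar_flow a m) \<le> fst (planar_flow a m) - 1" by blast
    have b: "snd (planar_flow s m) \<le> fst (planar_flow s m) - 1" if "a \<le> s" for s
    proof (rule ccontr)
      assume *: "\<not> ?thesis"
      then have "s \<noteq> a" using a by auto
      then have "fst (planar_flow a m) - 1 < snd (planar_flow a m)"
        using above_backward[OF m, of a s] that * by simp
      then show False using a by simp
    qed
    have g: "\<forall>s\<ge>a. 0 \<le> snd (planar_field (planar_flow s m))"
    proof (intro allI impI)
      fix s assume "s \<ge> a"
      then show "0 \<le> snd (planar_field (planar_flow s m))"
        unfolding f using st(3)[of s] b[of s] by (intro mult_nonneg_nonneg) auto
    qed
    have "snd (planar_flow a m) \<le> snd (planar_flow s m)" if "s \<ge> a" for s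
      by (rule planar_flow_snd_mono) (use g that in auto)
    then show ?thesis using planar_flow_converges_top[OF S] g that by metis
  next
    case False
    have g: "\<forall>s\<ge>0. snd (planar_field (planar_flow s m)) \<le> 0"
    proof (intro allI impI)
      fix s :: real
      show "snd (planar_field (planar_flow s m)) \<le> 0"
        unfolding f using st(3)[of s] False
        by (intro mult_nonneg_nonpos mult_nonneg_nonneg) (auto simp: not_le less_imp_le)
    qed
    have "- 1 \<le> snd (planar_flow s m)" for s
      using False st(1)[of s] by (metis not_le diff_gt_0_iff_gt less_diff_eq add.commute add_0 less_imp_le
          less_trans minus_diff_eq diff_0 neg_less_iff_less diff_less_eq add_strict_increasing)
    then show ?thesis using planar_flow_converges_top[OF S] g that by metis
  qed
  have "snd q \<le> 0"
    by (rule tendsto_upperbound[OF tendsto_snd[OF q(2)]]) (simp_all add: st less_imp_le)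
  then show ?thesis using q q(3)[of 0] st(1)[of 0] by auto
qed

text \<open>Up to time a the trajectory is above the line, so y grows backwards and is bounded. The
  limit has m2 < 1 and m3 at least the value at a, which exceeds - 1; this rules out (0, -
  1).\<close>

lemma above_separatrix_limit_bot:
  assumes m: "m \<in> above_separatrix"
  shows "((\<lambda>s. planar_flow s m) \<longlongrightarrow> (0, 0)) at_bot"
proof -
  have ms: "m \<in> strip" using m by (simp add: above_separatrix_def)
  have st: "0 < fst (planar_flow s m)" "fst (planar_flow s m) < 1" "snd (planar_flow s m) < 0" for s
    using ms planar_flow_strip[of s m] by (auto simp: strip_def)
  obtain a where a: "fst (planar_flow a m) - 1 < snd (planar_flow a m)"
    using m by (auto simp: above_separatrix_def)
  have b: "fst (planar_flow s m) - 1 < snd (planar_flow s m)" if "s \<le> a" for s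
    using above_backward[OF ms, of s a] a that by (cases "s = a") auto
  have f: "\<forall>s\<le>a. snd (planar_field (planar_flow s m)) \<le> 0"
  proof (intro allI impI)
    fix s assume "s \<le> a"
    then have "0 \<le> (- snd (planar_flow s m)) * (1 - snd (planar_flow s m)) * (1 - fst (planar_flow s m) + snd (planar_flow s m))"
      using st(3)[of s] b[of s] by (intro mult_nonneg_nonneg) auto
    then show "snd (planar_field (planar_flow s m)) \<le> 0"
      by (simp add: planar_field_def case_prod_beta)
  qed
  have "- 1 \<le> snd (planar_flow s m)" if "s \<le> a" for s using b[OF that] st(1)[of s] by linarith
  moreover have "m \<in> S_m" using ms strip_S_m by blast
  ultimately obtain q where q: "q \<in> {(0, 0), (0, - 1), (1, 0), (1, 1)}" "((\<lambda>s. planar_flow s m) \<longlongrightarrow> q) at_bot"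
    "\<And>r. fst q \<le> fst (planar_flow r m)"
    using planar_flow_converges_bot[of m a "- 1"] f by blast
  have "snd (planar_flow a m) \<le> snd q"
  proof (rule tendsto_lowerbound[OF tendsto_snd[OF q(2)]])
    have "snd (planar_flow a m) \<le> snd (planar_flow s m)" if "s \<le> a" for s
      by (rule planar_flow_snd_antimono) (use f that in auto)
    then show "\<forall>\<^sub>F s in at_bot. snd (planar_flow a m) \<le> snd (planar_flow s m)"
      by (auto simp: eventually_at_bot_linorder)
  qed simp
  then show ?thesis using q(1,2) q(3)[of 0] st(2)[of 0] a st(1)[of a] by auto
qed

text \<open>Below - 1 the coordinate m3 increases in time, and no equilibrium lies there from which
  it could start.\<close>

lemma below_separatrix_limit_bot:
  assumes m: "m \<in> below_separatrix"
  shows "filterlim (\<lambda>s. snd (planar_flow s m)) at_bot at_bot"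
proof -
  have ms: "m \<in> strip" using m by (simp add: below_separatrix_def)
  have st: "0 < fst (planar_flow s m)" "fst (planar_flow s m) < 1" "snd (planar_flow s m) < 0" for s
    using ms planar_flow_strip[of s m] by (auto simp: strip_def)
  obtain a where a: "snd (planar_flow a m) < - 1"
    using m by (auto simp: below_separatrix_def)
  have b: "snd (planar_flow s m) < - 1" if "s \<le> a" for s
    using below_backward[OF ms, of s a] a that by (cases "s = a") auto
  have f: "0 \<le> snd (planar_field (planar_flow s m))" if "s \<le> a" for s
  proof -
    have "0 \<le> snd (planar_flow s m) * (1 - snd (planar_flow s m)) * (1 - fst (planar_flow s m) + snd (planar_flow s m))"
      using st[of s] b[OF that] by (intro mult_nonpos_nonpos mult_nonpos_nonneg) auto
    then show ?thesis by (simp add: planar_field_def case_prod_beta)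
  qed
  show ?thesis
    by (rule planar_flow_diverges[of m a]) (use f a ms strip_S_m st in auto)
qed

text \<open>In the wedge m3 increases in time and stays above - 1, so the trajectory converges
  backwards. Its limit has m3 < 0, and (0, - 1) is the only such equilibrium.\<close>

lemma separatrix_limit_bot:
  assumes m: "m \<in> separatrix"
  shows "((\<lambda>s. planar_flow s m) \<longlongrightarrow> (0, - 1)) at_bot"
proof -
  have ms: "m \<in> strip" using m by (simp add: separatrix_def)
  have st: "0 < fst (planar_flow s m)" "fst (planar_flow s m) < 1" "snd (planar_flow s m) < 0" for s
    using ms planar_flow_strip[of s m] by (auto simp: strip_def)
  have w: "- 1 < snd (planar_flow s m)" "snd (planar_flow s m) < fst (planar_flow s m) - 1" for s
    using m by (auto simp: separatrix_def)
  have f: "0 \<le> snd (planar_field (planar_flow s m))" for s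
  proof -
    have "0 \<le> snd (planar_flow s m) * (1 - snd (planar_flow s m)) * (1 - fst (planar_flow s m) + snd (planar_flow s m))"
      using st[of s] w[of s] by (intro mult_nonpos_nonpos mult_nonpos_nonneg) auto
    then show ?thesis by (simp add: planar_field_def case_prod_beta)
  qed
  obtain q where q: "q \<in> {(0, 0), (0, - 1), (1, 0), (1, 1)}" "((\<lambda>s. planar_flow s m) \<longlongrightarrow> q) at_bot"
    "\<And>r. fst q \<le> fst (planar_flow r m)"
    using planar_flow_converges_bot[of m 0 "- 1"] f w(1)[THEN less_imp_le] ms strip_S_m by blast
  have "snd q \<le> snd (planar_flow 0 m)"
  proof (rule tendsto_upperbound[OF tendsto_snd[OF q(2)]])
    have "snd (planar_flow s m) \<le> snd (planar_flow 0 m)" if "s \<le> 0" for s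
      by (rule planar_flow_snd_mono) (use f that in auto)
    then show "\<forall>\<^sub>F s in at_bot. snd (planar_flow s m) \<le> snd (planar_flow 0 m)"
      by (auto simp: eventually_at_bot_linorder)
  qed simp
  then show ?thesis using q(1,2) q(3)[of 0] st[of 0] by auto
qed

subsection \<open>The separatrix is the unstable manifold\<close>

text \<open>The trajectory is reparametrised by the time of the planar system. A lower bound for the
  speed ensures that the new time reaches all t \<le> 0.\<close>

lemma separatrix_unstable:
  assumes m: "m \<in> separatrix"
  shows "m \<in> planar_T23"
proof -
  have w: "- 1 < snd (planar_flow s m)" "snd (planar_flow s m) < fst (planar_flow s m) - 1"
    "0 < fst (planar_flow s m)" "fst (planar_flow s m) < 1" for s
    using m planar_flow_strip[of s m] by (auto simp: separatrix_def strip_def)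
  define c where "c s = planar_speed (planar_flow s m)" for s
  \<comment> \<open>In the wedge x^2 and y^2 are at most 1, so the denominator 1 + x^2 + y^2 is at
    most 3.\<close>
  have c: "c s \<ge> 2 / 3" for s
  proof -
    have "(fst (planar_flow s m))\<^sup>2 \<le> 1" "(snd (planar_flow s m))\<^sup>2 \<le> 1"
      using w[of s] by (simp_all add: abs_square_le_1 abs_le_iff)
    then show ?thesis unfolding c_def planar_speed_def
      by (intro divide_left_mono) (auto simp: add_pos_nonneg)
  qed
  have "continuous_on UNIV c" unfolding c_def by (rule flow.cont_c)
  then obtain \<theta> where \<theta>': "\<And>s. (\<theta> has_vector_derivative c s) (at s)" and \<theta>0: "\<theta> 0 = 0"
    using antiderivative_exists[of c] by blast
  then have \<theta>: "\<And>s. (\<theta> has_real_derivative c s) (at s)"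
    by (simp add: has_real_derivative_iff_has_vector_derivative)
  have c0: "c s > 0" for s using c[of s] by linarith
  obtain \<tau> where "\<And>s. s \<in> UNIV \<Longrightarrow> \<tau> (\<theta> s) = s"
    "\<And>s. s \<in> UNIV \<Longrightarrow> (\<tau> has_real_derivative 1 / c s) (at (\<theta> s))"
    and J: "is_interval (range \<theta>)" and sm: "strict_mono_on UNIV \<theta>"
    by (rule increasing_inverse[OF open_UNIV is_interval_univ, of \<theta> c]) (use \<theta> c0 in auto)
  then have \<tau>: "\<And>s. \<tau> (\<theta> s) = s" "\<And>s. (\<tau> has_real_derivative 1 / c s) (at (\<theta> s))" by auto
  have lin: "\<theta> s \<le> 2 / 3 * s" if "s \<le> 0" for s
  proof -
    have "\<theta> s - 2 / 3 * s \<le> \<theta> 0 - 2 / 3 * 0"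
      by (rule DERIV_nonneg_imp_nondecreasing[OF that])
        (use c in \<open>auto intro!: exI derivative_eq_intros \<theta>\<close>)
    then show ?thesis by (simp add: \<theta>0)
  qed
  have rng: "\<exists>s. t = \<theta> s" if "t \<le> 0" for t
  proof -
    have "\<theta> (3 / 2 * t) \<le> t" using lin[of "3 / 2 * t"] that by simp
    then have "t \<in> range \<theta>"
      using mem_is_interval_1_I[OF J, of "\<theta> (3 / 2 * t)" "\<theta> 0" t] that \<theta>0 by auto
    then show ?thesis by blast
  qed
  have mono: "\<tau> t \<le> s" if "t \<le> \<theta> s" "t \<le> 0" for s t
  proof -
    obtain r where r: "t = \<theta> r" using rng \<open>t \<le> 0\<close> by blast
    then have "r \<le> s" using that(1) strict_mono_onD[OF sm, of s r] by (metis UNIV_I not_le)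
    then show ?thesis by (simp add: r \<tau>(1))
  qed
  define \<mu> where "\<mu> t = planar_flow (\<tau> t) m" for t
  have "\<mu> 0 = m" using \<tau>(1)[of 0] by (simp add: \<mu>_def \<theta>0)
  moreover have "(\<mu> has_vector_derivative planar_field (\<mu> t)) (at t within {..0})" if t: "t \<le> 0" for t
  proof -
    obtain s where s: "t = \<theta> s" using rng t by blast
    have cs: "c s * z * (1 / c s) = z" for z using c0[of s] by simp
    have "((\<lambda>t. fst (\<mu> t)) has_real_derivative fst (planar_field (\<mu> t))) (at t)"
      using DERIV_chain2[OF _ \<tau>(2)[of s], of "\<lambda>s. fst (planar_flow s m)"] planar_flow_derivative(1)[of m s]
      unfolding s \<mu>_def \<tau>(1) c_def[symmetric] by (metis cs \<tau>(1))
    moreover have "((\<lambda>t. snd (\<mu> t)) has_real_derivative snd (planar_field (\<mu> t))) (at t)"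
      using DERIV_chain2[OF _ \<tau>(2)[of s], of "\<lambda>s. snd (planar_flow s m)"] planar_flow_derivative(2)[of m s]
      unfolding s \<mu>_def \<tau>(1) c_def[symmetric] by (metis cs \<tau>(1))
    ultimately have "((\<lambda>t. (fst (\<mu> t), snd (\<mu> t))) has_vector_derivative
        (fst (planar_field (\<mu> t)), snd (planar_field (\<mu> t)))) (at t)"
      by (intro has_vector_derivative_Pair) (simp_all add: has_real_derivative_iff_has_vector_derivative)
    then show ?thesis by (simp add: has_vector_derivative_at_within)
  qed
  moreover have "(\<mu> \<longlongrightarrow> (0, - 1)) at_bot"
  proof -
    have "filterlim \<tau> at_bot at_bot"
      unfolding filterlim_at_bot
    proof
      fix s
      show "\<forall>\<^sub>F t in at_bot. \<tau> t \<le> s"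
        unfolding eventually_at_bot_linorder by (rule exI[of _ "min 0 (\<theta> s)"]) (use mono in auto)
    qed
    then show ?thesis unfolding \<mu>_def[abs_def]
      by (rule filterlim_compose[OF separatrix_limit_bot[OF m]])
  qed
  ultimately have "m \<in> unstable_manifold (0, - 1)" unfolding unstable_manifold_def by blast
  then show ?thesis using w(3,4)[of 0] by (auto simp: planar_T23_def case_prod_beta)
qed

text \<open>The derivative dm3/dm2 along trajectories of the planar system.\<close>

definition planar_slope :: "real \<Rightarrow> real \<Rightarrow> real" where
  "planar_slope x y = y * (1 - y) * (1 - x + y) / (x * (1 - x) * (1 + x - y))"

text \<open>For fixed x the slope is a positive multiple of the product of (- y) / (1 + x - y), 1 -
  y and x - 1 - y. On the wedge these factors are nonnegative and each decreases in y.\<close>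

lemma planar_slope_antimono:
  assumes x: "0 < x" "x < 1" and y: "- 1 < y" "y \<le> y'" "y' < x - 1"
  shows "planar_slope x y' \<le> planar_slope x y"
proof -
  have e: "planar_slope x z = ((- z) / (1 + x - z) * (1 - z) * (x - 1 - z)) / (x * (1 - x))" for z
  proof -
    have num: "z * (1 - z) * (1 - x + z) = (- z) * (1 - z) * (x - 1 - z)"
      by (simp add: algebra_simps)
    show ?thesis unfolding planar_slope_def num by (simp add: mult_ac)
  qed
  have "(- y') / (1 + x - y') \<le> (- y) / (1 + x - y)"
  proof -
    have "(- y') * (1 + x - y) - (- y) * (1 + x - y') = - ((1 + x) * (y' - y))"
      by (simp add: algebra_simps)
    also have "\<dots> \<le> 0" using x y by simp
    finally show ?thesis using x y by (subst frac_le_eq) (auto intro!: divide_nonpos_pos)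
  qed
  then have "(- y') / (1 + x - y') * (1 - y') * (x - 1 - y') \<le> (- y) / (1 + x - y) * (1 - y) * (x - 1 - y)"
    using x y
    by (intro mult_mono mult_nonneg_nonneg divide_nonneg_nonneg) auto
  then show ?thesis unfolding e using x by (intro divide_right_mono) auto
qed

text \<open>In the wedge m2 is strictly increasing and can replace time as parameter. The curve
  becomes a solution of the scalar slope equation. Its two ends appear as one-sided limits, since
  the equilibrium is only approached and the solution is only given up to t = 0.\<close>

lemma unstable_manifold_graph:
  assumes "(x0, y0) \<in> planar_T23"
  obtains g where "\<And>\<xi>. 0 < \<xi> \<Longrightarrow> \<xi> < x0 \<Longrightarrow> (g has_real_derivative planar_slope \<xi> (g \<xi>)) (at \<xi>)"
    "\<And>\<xi>. 0 < \<xi> \<Longrightarrow> \<xi> < x0 \<Longrightarrow> - 1 < g \<xi> \<and> g \<xi> < \<xi> - 1"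
    "(g \<longlongrightarrow> - 1) (at_right 0)" "(g \<longlongrightarrow> y0) (at_left x0)"
proof -
  have x0: "0 < x0" "x0 < 1" and "(x0, y0) \<in> unstable_manifold (0, - 1)"
    using assms by (auto simp: planar_T23_def)
  then obtain m where m0: "m 0 = (x0, y0)"
    and d: "\<And>t. t \<le> 0 \<Longrightarrow> (m has_vector_derivative planar_field (m t)) (at t within {..0})"
    and lim: "(m \<longlongrightarrow> (0, - 1)) at_bot"
    by (auto simp: unstable_manifold_def)
  define x where "x t = fst (m t)" for t
  define y where "y t = snd (m t)" for t
  have xy0: "x 0 = x0" "y 0 = y0" by (simp_all add: x_def y_def m0)
  interpret planar_curve "{..0}" "\<lambda>_. 1" x y
  proof
    fix t :: real assume "t \<in> {..0}"
    then have "(m has_vector_derivative planar_field (m t)) (at t within {..0})" using d by simp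
    from bounded_linear.has_vector_derivative[OF bounded_linear_fst this]
      bounded_linear.has_vector_derivative[OF bounded_linear_snd this]
    show "(x has_real_derivative 1 * fst (planar_field (x t, y t))) (at t within {..0})"
      "(y has_real_derivative 1 * snd (planar_field (x t, y t))) (at t within {..0})"
      by (simp_all add: has_real_derivative_iff_has_vector_derivative x_def[abs_def] y_def[abs_def])
  qed (auto intro: convex_real_interval)
  have limx: "(x \<longlongrightarrow> 0) at_bot" and limy: "(y \<longlongrightarrow> - 1) at_bot"
    using tendsto_fst[OF lim] tendsto_snd[OF lim] by (simp_all add: x_def[abs_def] y_def[abs_def])
  \<comment> \<open>Near minus infinity y is close to - 1, and the sign of y never changes.\<close>
  have y0: "y 0 < 0"
  proof -
    have "\<forall>\<^sub>F t in at_bot. y t < 0" using order_tendstoD(2)[OF limy, of 0] by simp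
    moreover have "\<forall>\<^sub>F t in at_bot. t \<le> (0::real)" by (rule eventually_le_at_bot)
    ultimately have "\<forall>\<^sub>F t in at_bot. y t < 0 \<and> t \<le> 0" by (rule eventually_conj)
    then obtain t where "y t < 0" "t \<le> 0"
      using eventually_happens'[OF trivial_limit_at_bot_linorder] by blast
    then show ?thesis using sgn_y[of t 0] by (auto simp: sgn_if split: if_splits)
  qed
  have st: "0 < x t" "x t < 1" "y t < 0" if "t \<le> 0" for t
    using strip[of 0 t] that x0 y0 by (auto simp: xy0)
  have w: "- 1 < y t" "y t < x t - 1" if "t \<le> 0" for t
    using wedge[of 0 t] limy that x0 y0 by (auto simp: xy0)
  define k where "k t = fst (planar_field (x t, y t))" for t
  have k: "k t > 0" if "t \<le> 0" for t
    using st[OF that] w[OF that] by (simp add: k_def planar_field_def)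
  \<comment> \<open>Two-sided derivatives are available only for t < 0; the value at t = 0 is
    recovered below as a left limit.\<close>
  have at: "(x has_real_derivative k t) (at t)" "(y has_real_derivative snd (planar_field (x t, y t))) (at t)"
    if "t < 0" for t
  proof -
    have "at t within {..0} = at t"
      by (rule at_within_open_subset[of _ "{..<0}"]) (use that in auto)
    then show "(x has_real_derivative k t) (at t)" "(y has_real_derivative snd (planar_field (x t, y t))) (at t)"
      using dx[of t] dy[of t] that by (simp_all add: k_def)
  qed
  obtain \<sigma> where \<sigma>: "\<And>s. s \<in> {..<0} \<Longrightarrow> \<sigma> (x s) = s"
    "\<And>s. s \<in> {..<0} \<Longrightarrow> (\<sigma> has_real_derivative 1 / k s) (at (x s))"
    and sm: "strict_mono_on {..<0} x"
    by (rule increasing_inverse[of "{..<0}" x k]) (use at k in \<open>auto intro: is_interval_io\<close>)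
  have mono: "x s \<le> x t" if "s \<le> t" "t \<le> 0" for s t
    by (rule nondecreasing_on[OF dx]) (use that k in \<open>auto simp: k_def less_imp_le\<close>)
  have surj: "\<exists>s<0. x s = \<xi>" if \<xi>: "0 < \<xi>" "\<xi> < x0" for \<xi>
  proof -
    have "\<forall>\<^sub>F t in at_bot. x t < \<xi> \<and> t \<le> 0"
      using order_tendstoD(2)[OF limx, of \<xi>] \<xi>(1) eventually_le_at_bot by (auto intro: eventually_conj)
    then obtain t where t: "x t < \<xi>" "t \<le> 0"
      using eventually_happens'[OF trivial_limit_at_bot_linorder] by blast
    have "continuous_on {t..0} x" using cont(1) by (rule continuous_on_subset) auto
    then obtain s where "t \<le> s" "s \<le> 0" "x s = \<xi>"
      using IVT'[of x t \<xi> 0] t \<xi> xy0 by auto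
    then show ?thesis using \<xi> xy0 by (metis less_le less_irrefl)
  qed
  have \<sigma>lt: "\<sigma> \<xi> < t" if \<xi>: "0 < \<xi>" "\<xi> < x0" "\<xi> < x t" "t \<le> 0" for \<xi> t
  proof -
    obtain s where s: "s < 0" "x s = \<xi>" using surj \<xi> by blast
    then have "s < t" using mono[of t s] \<xi> by (metis not_le less_imp_le)
    then show ?thesis using \<sigma>(1)[of s] s by simp
  qed
  have \<sigma>gt: "t < \<sigma> \<xi>" if \<xi>: "x t < \<xi>" "\<xi> < x0" "t \<le> 0" for \<xi> t
  proof -
    have "0 < \<xi>" using st(1)[OF \<xi>(3)] \<xi> by simp
    then obtain s where s: "s < 0" "x s = \<xi>" using surj \<xi> by blast
    then have "t < s" using mono[of s t] \<xi> by (metis not_le)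
    then show ?thesis using \<sigma>(1)[of s] s by simp
  qed
  have \<sigma>0: "\<sigma> \<xi> < 0" "x (\<sigma> \<xi>) = \<xi>" if "0 < \<xi>" "\<xi> < x0" for \<xi>
    using surj[OF that] \<sigma>(1) by auto
  show thesis
  proof (rule that[of "\<lambda>\<xi>. y (\<sigma> \<xi>)"])
    fix \<xi> assume \<xi>: "0 < \<xi>" "\<xi> < x0"
    obtain s where s: "s < 0" "\<xi> = x s" using surj[OF \<xi>] by blast
    have "((\<lambda>\<xi>. y (\<sigma> \<xi>)) has_real_derivative snd (planar_field (x s, y s)) * (1 / k s)) (at (x s))"
      by (rule DERIV_chain2[OF _ \<sigma>(2)]) (use s \<sigma>(1)[of s] at(2)[of s] in auto)
    moreover have "snd (planar_field (x s, y s)) * (1 / k s) = planar_slope \<xi> (y (\<sigma> \<xi>))"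
      using s \<sigma>(1)[of s] by (simp add: k_def planar_field_def planar_slope_def)
    ultimately show "((\<lambda>\<xi>. y (\<sigma> \<xi>)) has_real_derivative planar_slope \<xi> (y (\<sigma> \<xi>))) (at \<xi>)"
      using s by simp
    show "- 1 < y (\<sigma> \<xi>) \<and> y (\<sigma> \<xi>) < \<xi> - 1"
      using w[of "\<sigma> \<xi>"] \<sigma>0[OF \<xi>] by auto
  next
    show "((\<lambda>\<xi>. y (\<sigma> \<xi>)) \<longlongrightarrow> - 1) (at_right 0)"
    proof (rule tendstoI)
      fix e :: real assume "e > 0"
      then have "\<forall>\<^sub>F t in at_bot. dist (y t) (- 1) < e" using limy by (rule tendstoD[rotated])
      then obtain t0 where t0: "\<And>t. t \<le> t0 \<Longrightarrow> dist (y t) (- 1) < e"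
        by (auto simp: eventually_at_bot_linorder)
      define t where "t = min t0 (- 1)"
      have t: "t \<le> t0" "t \<le> 0" by (auto simp: t_def)
      have "dist (y (\<sigma> \<xi>)) (- 1) < e" if "0 < \<xi>" "\<xi> < min x0 (x t)" for \<xi>
        using t0[of "\<sigma> \<xi>"] \<sigma>lt[of \<xi> t] that t by simp
      moreover have "0 < min x0 (x t)" using x0 st(1)[of t] t by simp
      ultimately show "\<forall>\<^sub>F \<xi> in at_right 0. dist (y (\<sigma> \<xi>)) (- 1) < e"
        unfolding eventually_at_right_field by blast
    qed
    show "((\<lambda>\<xi>. y (\<sigma> \<xi>)) \<longlongrightarrow> y0) (at_left x0)"
    proof (rule tendstoI)
      fix e :: real assume e: "e > 0"
      have "continuous (at 0 within {..0}) y" using cont(2) by (simp add: continuous_on_eq_continuous_within)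
      then obtain \<delta> where \<delta>: "\<delta> > 0" "\<And>t. t \<le> 0 \<Longrightarrow> dist t 0 < \<delta> \<Longrightarrow> dist (y t) (y 0) < e"
        unfolding continuous_within_eps_delta using e by (auto simp: dist_commute)
      define t where "t = - \<delta> / 2"
      have t: "t < 0" using \<delta>(1) by (simp add: t_def)
      have xt: "x t < x0"
      proof -
        have "x t < x (t / 2)" by (rule strict_mono_onD[OF sm]) (use t in auto)
        also have "\<dots> \<le> x 0" by (rule mono) (use t in auto)
        finally show ?thesis by (simp add: xy0)
      qed
      have "dist (y (\<sigma> \<xi>)) y0 < e" if "x t < \<xi>" "\<xi> < x0" for \<xi>
      proof -
        have "t < \<sigma> \<xi>" using \<sigma>gt[of t \<xi>] that t by simp
        moreover have "\<sigma> \<xi> < 0" using \<sigma>0(1)[of \<xi>] that st(1)[of t] t by simp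
        ultimately show ?thesis using \<delta>(2)[of "\<sigma> \<xi>"] \<delta>(1) by (simp add: xy0 t_def dist_real_def)
      qed
      then show "\<forall>\<^sub>F \<xi> in at_left x0. dist (y (\<sigma> \<xi>)) y0 < e"
        unfolding eventually_at_left_field using xt by blast
    qed
  qed
qed

text \<open>The slope is antitone in m3, so the squared difference of two such graphs is
  nonincreasing in m2. It tends to 0 as m2 tends to 0, hence it vanishes, and both graphs end at the
  same point.\<close>

lemma planar_T23_unique:
  assumes "(x0, y1) \<in> planar_T23" "(x0, y2) \<in> planar_T23"
  shows "y1 = y2"
proof -
  have x0: "0 < x0" "x0 < 1" using assms by (auto simp: planar_T23_def)
  obtain g where g: "\<And>\<xi>. 0 < \<xi> \<Longrightarrow> \<xi> < x0 \<Longrightarrow> (g has_real_derivative planar_slope \<xi> (g \<xi>)) (at \<xi>)"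
    "\<And>\<xi>. 0 < \<xi> \<Longrightarrow> \<xi> < x0 \<Longrightarrow> - 1 < g \<xi> \<and> g \<xi> < \<xi> - 1"
    "(g \<longlongrightarrow> - 1) (at_right 0)" "(g \<longlongrightarrow> y1) (at_left x0)"
    using unstable_manifold_graph[OF assms(1)] by blast
  obtain h where h: "\<And>\<xi>. 0 < \<xi> \<Longrightarrow> \<xi> < x0 \<Longrightarrow> (h has_real_derivative planar_slope \<xi> (h \<xi>)) (at \<xi>)"
    "\<And>\<xi>. 0 < \<xi> \<Longrightarrow> \<xi> < x0 \<Longrightarrow> - 1 < h \<xi> \<and> h \<xi> < \<xi> - 1"
    "(h \<longlongrightarrow> - 1) (at_right 0)" "(h \<longlongrightarrow> y2) (at_left x0)"
    using unstable_manifold_graph[OF assms(2)] by blast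
  define D where "D \<xi> = (g \<xi> - h \<xi>)\<^sup>2" for \<xi>
  have dD: "(D has_real_derivative 2 * (g \<xi> - h \<xi>) * (planar_slope \<xi> (g \<xi>) - planar_slope \<xi> (h \<xi>))) (at \<xi>)"
    if "0 < \<xi>" "\<xi> < x0" for \<xi>
    unfolding D_def[abs_def]
    by (rule DERIV_cong[OF DERIV_power[OF DERIV_diff[OF g(1)[OF that] h(1)[OF that]], of 2]]) simp
  have neg: "2 * (g \<xi> - h \<xi>) * (planar_slope \<xi> (g \<xi>) - planar_slope \<xi> (h \<xi>)) \<le> 0"
    if "0 < \<xi>" "\<xi> < x0" for \<xi>
    using planar_slope_antimono[of \<xi> "g \<xi>" "h \<xi>"] planar_slope_antimono[of \<xi> "h \<xi>" "g \<xi>"]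
      g(2)[OF that] h(2)[OF that] that x0
    by (cases "g \<xi> \<le> h \<xi>") (auto simp: mult_le_0_iff)
  have D_le: "D \<xi> \<le> D \<eta>" if "0 < \<eta>" "\<eta> \<le> \<xi>" "\<xi> < x0" for \<xi> \<eta>
    by (rule DERIV_nonpos_imp_nonincreasing[OF that(2)]) (use dD neg that in force)
  have "D \<xi> = 0" if "0 < \<xi>" "\<xi> < x0" for \<xi>
  proof -
    have "((\<lambda>\<eta>. D \<eta>) \<longlongrightarrow> (- 1 - - 1)\<^sup>2) (at_right 0)"
      unfolding D_def by (intro tendsto_intros g h)
    then have "D \<xi> \<le> (- 1 - - 1)\<^sup>2"
    proof (rule tendsto_lowerbound)
      show "\<forall>\<^sub>F \<eta> in at_right 0. D \<xi> \<le> D \<eta>"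
        unfolding eventually_at_right_field using D_le that by (intro exI[of _ \<xi>]) auto
    qed simp
    then show ?thesis using zero_le_power2[of "g \<xi> - h \<xi>"] by (simp add: D_def)
  qed
  then have eq: "g \<xi> = h \<xi>" if "0 < \<xi>" "\<xi> < x0" for \<xi> using that by (simp add: D_def)
  have "(h \<longlongrightarrow> y1) (at_left x0)"
  proof (rule Lim_transform_eventually[OF g(4)])
    show "\<forall>\<^sub>F \<xi> in at_left x0. g \<xi> = h \<xi>"
      unfolding eventually_at_left_field using eq x0 by (intro exI[of _ 0]) auto
  qed
  then show ?thesis using h(4) tendsto_unique[OF trivial_limit_at_left_real] by blast
qed

text \<open>The separatrix lies in the unstable manifold and meets every vertical line, while the
  unstable manifold meets each at most once.\<close>

lemma planar_T23_eq: "planar_T23 = separatrix"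
proof
  show "separatrix \<subseteq> planar_T23" using separatrix_unstable by blast
  show "planar_T23 \<subseteq> separatrix"
  proof
    fix m assume m: "m \<in> planar_T23"
    obtain x y where xy: "m = (x, y)" by (cases m)
    have "0 < x" "x < 1" using m by (auto simp: xy planar_T23_def)
    then obtain z where z: "(x, z) \<in> separatrix" using separatrix_exists by blast
    then have "z = y" using planar_T23_unique[of x z y] m separatrix_unstable by (simp add: xy)
    then show "m \<in> separatrix" using z xy by simp
  qed
qed

section \<open>The separatrix as a continuous graph\<close>

definition separatrix_height :: "real \<Rightarrow> real" where
  "separatrix_height x = (THE y. (x, y) \<in> separatrix)"

lemma separatrix_iff:
  "(x, y) \<in> separatrix \<longleftrightarrow> 0 < x \<and> x < 1 \<and> y = separatrix_height x"
proof -
  have "separatrix_height x = y" if "(x, y) \<in> separatrix" for x y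
    unfolding separatrix_height_def
    using that planar_T23_unique by (auto simp: planar_T23_eq)
  moreover have "0 < x \<and> x < 1" if "(x, y) \<in> separatrix" for x y
    using that by (simp add: separatrix_def strip_def)
  ultimately show ?thesis using separatrix_exists by metis
qed

lemma separatrix_height_bounds:
  assumes "0 < x" "x < 1"
  shows "- 1 < separatrix_height x" "separatrix_height x < x - 1"
proof -
  have "(x, separatrix_height x) \<in> separatrix" using assms separatrix_iff by blast
  then have "- 1 < snd (planar_flow 0 (x, separatrix_height x)) \<and>
      snd (planar_flow 0 (x, separatrix_height x)) < fst (planar_flow 0 (x, separatrix_height x)) - 1"
    unfolding separatrix_def by blast
  then show "- 1 < separatrix_height x" "separatrix_height x < x - 1" by simp_all
qed

text \<open>A connected piece of a vertical line in the strip that avoids the graph lies entirely in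
  one of the two disjoint open sides. One test point above and one below the graph decide
  which.\<close>

lemma separatrix_sides_iff:
  shows "(x, y) \<in> above_separatrix \<longleftrightarrow> 0 < x \<and> x < 1 \<and> y < 0 \<and> separatrix_height x < y" (is ?A)
    and "(x, y) \<in> below_separatrix \<longleftrightarrow> 0 < x \<and> x < 1 \<and> y < separatrix_height x" (is ?B)
proof -
  have o: "open {y. (x, y) \<in> C}" if "open C" for C :: "(real \<times> real) set"
  proof -
    have "open ((\<lambda>y. (x, y)) -` C)" by (intro open_vimage that continuous_intros)
    then show ?thesis by (simp add: vimage_def)
  qed
  have key: "(\<forall>y\<in>I. (x, y) \<in> above_separatrix) \<or> (\<forall>y\<in>I. (x, y) \<in> below_separatrix)"
    if "connected I" "0 < x" "x < 1" "\<And>y. y \<in> I \<Longrightarrow> y < 0 \<and> y \<noteq> separatrix_height x" for I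
  proof -
    have "I \<subseteq> {y. (x, y) \<in> above_separatrix} \<union> {y. (x, y) \<in> below_separatrix}"
    proof
      fix y assume "y \<in> I"
      then have "(x, y) \<in> strip" "(x, y) \<notin> separatrix" using that by (auto simp: strip_def separatrix_iff)
      then show "y \<in> {y. (x, y) \<in> above_separatrix} \<union> {y. (x, y) \<in> below_separatrix}"
        using strip_cases by blast
    qed
    moreover have "{y. (x, y) \<in> above_separatrix} \<inter> {y. (x, y) \<in> below_separatrix} \<inter> I = {}"
      using separatrix_disjoint(1) by auto
    ultimately show ?thesis
      using connectedD[OF that(1) o[OF open_separatrix_sides(1)] o[OF open_separatrix_sides(2)]]
      by blast
  qed
  have x: "0 < x \<and> x < 1 \<and> y < 0" if "(x, y) \<in> above_separatrix \<or> (x, y) \<in> below_separatrix" for y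
    using that by (auto simp: above_separatrix_def below_separatrix_def strip_def)
  have up: "(x, y) \<in> above_separatrix" if "0 < x" "x < 1" "y < 0" "separatrix_height x < y" for y
  proof -
    \<comment> \<open>This test point lies between the line y = x - 1 and the axis y = 0.\<close>
    have "(x, (x - 1) / 2) \<in> above_separatrix"
      using that by (intro separatrix_sides_easy) (auto simp: strip_def field_simps)
    moreover have "(x - 1) / 2 \<in> {separatrix_height x<..<0}"
      using separatrix_height_bounds[OF that(1,2)] that by auto
    ultimately have "\<not> (\<forall>y\<in>{separatrix_height x<..<0}. (x, y) \<in> below_separatrix)"
      using separatrix_disjoint(1) by blast
    then show ?thesis using key[of "{separatrix_height x<..<0}"] that by auto
  qed
  have down: "(x, y) \<in> below_separatrix" if "0 < x" "x < 1" "y < separatrix_height x" for y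
  proof -
    have "(x, - 2) \<in> below_separatrix"
      using that by (intro separatrix_sides_easy) (auto simp: strip_def)
    moreover have "- 2 \<in> {..<separatrix_height x}"
      using separatrix_height_bounds[OF that(1,2)] that by auto
    ultimately have "\<not> (\<forall>y\<in>{..<separatrix_height x}. (x, y) \<in> above_separatrix)"
      using separatrix_disjoint(1) by blast
    then show ?thesis
      using key[of "{..<separatrix_height x}"] that separatrix_height_bounds[OF that(1,2)] by auto
  qed
  have sep: "(x, y) \<notin> above_separatrix \<and> (x, y) \<notin> below_separatrix" if "y = separatrix_height x" for y
    using that x[of y] separatrix_iff[of x y] separatrix_disjoint by blast
  show ?A using up[of y] down[of y] sep[of y] x[of y] separatrix_disjoint(1)
    by (metis disjoint_iff linorder_cases)
  show ?B using up[of y] down[of y] sep[of y] x[of y] separatrix_disjoint(1)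
    by (metis disjoint_iff linorder_cases)
qed

text \<open>The conditions a < height and height < a say that the point (x, a) lies in one of the
  two open sides, so they persist for nearby x.\<close>

lemma continuous_separatrix_height: "continuous_on {0<..<1} separatrix_height"
proof -
  have o: "\<forall>\<^sub>F z in at x within {0<..<1}. (z, y) \<in> C" if "open C" "(x, y) \<in> C"
    for C :: "(real \<times> real) set" and x y
  proof -
    have "open ((\<lambda>z. (z, y)) -` C)" by (intro open_vimage that(1) continuous_intros)
    then have "\<forall>\<^sub>F z in nhds x. z \<in> (\<lambda>z. (z, y)) -` C"
      using that(2) by (intro eventually_nhds_in_open) auto
    then show ?thesis by (simp add: eventually_at_filter eventually_mono)
  qed
  have "((separatrix_height \<longlongrightarrow> separatrix_height x) (at x within {0<..<1}))" if x: "0 < x" "x < 1" for x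
  proof (rule order_tendstoI)
    fix a assume "a < separatrix_height x"
    then have "(x, a) \<in> below_separatrix" using x separatrix_sides_iff(2) by blast
    from o[OF open_separatrix_sides(2) this]
    show "\<forall>\<^sub>F z in at x within {0<..<1}. a < separatrix_height z"
      by (rule eventually_mono) (simp add: separatrix_sides_iff)
  next
    fix a assume a: "separatrix_height x < a"
    \<comment> \<open>The upper side contains only points with negative second coordinate; a is
      therefore lowered to a negative value that is still above the graph.\<close>
    define b where "b = min a (separatrix_height x / 2)"
    have "separatrix_height x < 0" using separatrix_height_bounds[OF x] x by linarith
    then have "(x, b) \<in> above_separatrix" using x a by (simp add: separatrix_sides_iff b_def min_less_iff_disj)
    from o[OF open_separatrix_sides(1) this]
    show "\<forall>\<^sub>F z in at x within {0<..<1}. separatrix_height z < a"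
      by (rule eventually_mono) (auto simp: separatrix_sides_iff b_def)
  qed
  then show ?thesis by (auto simp: continuous_on_def)
qed

section \<open>Topology of the phase space\<close>

lemma openin_phase_top:
  "openin phase_top U \<longleftrightarrow> U \<subseteq> phase_space \<and> openin S_m_bar {x \<in> topspace S_m_bar. proj x \<in> U}"
proof -
  let ?pre = "\<lambda>U. {x \<in> topspace S_m_bar. proj x \<in> U}"
  have "?pre (U \<inter> V) = ?pre U \<inter> ?pre V" for U V by auto
  moreover have "?pre (\<Union>K) = (\<Union>U\<in>K. ?pre U)" for K by auto
  ultimately have "istopology (\<lambda>U. U \<subseteq> phase_space \<and> openin S_m_bar (?pre U))"
    unfolding istopology_def by (auto simp del: topspace_Alexandroff_compactification)
  then show ?thesis unfolding phase_top_def by (simp only: topology_inverse')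
qed

lemma proj_mem: "x \<in> topspace S_m_bar \<Longrightarrow> proj x \<in> phase_space"
  by (auto simp: phase_space_eq[symmetric] intro!: triple_class_mem)

lemma topspace_phase_top [simp]: "topspace phase_top = phase_space"
proof
  show "topspace phase_top \<subseteq> phase_space"
    using openin_phase_top[of "topspace phase_top"] by simp
  have "{x \<in> topspace S_m_bar. proj x \<in> phase_space} = topspace S_m_bar"
    using proj_mem by blast
  then have "openin phase_top phase_space"
    unfolding openin_phase_top by (simp only: openin_topspace) simp
  then show "phase_space \<subseteq> topspace phase_top" by (rule openin_subset)
qed

lemma continuous_map_proj: "continuous_map S_m_bar phase_top proj"
  unfolding continuous_map_def topspace_phase_top
  using proj_mem openin_phase_top by blast

abbreviation planar_class :: "real \<times> real \<Rightarrow> mla_class" where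
  "planar_class m \<equiv> proj (Some m)"

lemma in_phase_space_image: "in_phase_space X = planar_class ` X"
  by (simp add: in_phase_space_def image_image)

lemma continuous_map_planar_class: "continuous_map (top_of_set S_m) phase_top planar_class"
  using continuous_map_compose[OF continuous_map_Some continuous_map_proj]
  by (simp add: o_def)

lemma planar_class_eq_iff:
  assumes "m \<in> S_m" "n \<in> S_m"
  shows "planar_class m = planar_class n \<longleftrightarrow> m = n \<or> fst m = 0 \<and> fst n = 0 \<and> snd m * snd n = 1"
  using proj_eq_iff[of "fst m" "snd m" "fst n" "snd n"] assms by (simp add: prod_eq_iff)

lemma proj_None: "proj None = planar_class (0, 0)"
  by simp

text \<open>A set closed under the gluing (0, m3), (0, 1 / m3) and avoiding the origin equals the
  preimage of its image. The point at infinity stays outside this preimage because it is glued to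
  the origin.\<close>

lemma openin_phase_top_saturated:
  assumes V: "openin (top_of_set S_m) V" and 0: "(0, 0) \<notin> V"
    and sat: "\<And>m n. m \<in> V \<Longrightarrow> n \<in> S_m \<Longrightarrow> fst m = 0 \<Longrightarrow> fst n = 0 \<Longrightarrow> snd m * snd n = 1 \<Longrightarrow> n \<in> V"
  shows "openin phase_top (in_phase_space V)"
proof -
  have VS: "V \<subseteq> S_m" using openin_subset[OF V] by simp
  have fib: "n \<in> V" if "n \<in> S_m" "planar_class n = planar_class m" "m \<in> V" for m n
  proof -
    have "m \<in> S_m" using that(3) VS by blast
    then have "n = m \<or> fst n = 0 \<and> fst m = 0 \<and> snd n * snd m = 1"
      using planar_class_eq_iff[OF that(1)] that(2) by blast
    then show ?thesis using sat[OF that(3,1)] that(3) by (auto simp: mult.commute)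
  qed
  have "{x \<in> topspace S_m_bar. proj x \<in> in_phase_space V} = Some ` V"
  proof
    show "{x \<in> topspace S_m_bar. proj x \<in> in_phase_space V} \<subseteq> Some ` V"
    proof
      fix x assume x: "x \<in> {x \<in> topspace S_m_bar. proj x \<in> in_phase_space V}"
      then obtain m where m: "m \<in> V" "proj x = planar_class m" by (auto simp: in_phase_space_image)
      consider "x = None" | n where "x = Some n" "n \<in> S_m" using x by auto
      then show "x \<in> Some ` V"
      proof cases
        case 1
        then have "planar_class (0, 0) = planar_class m" using m(2) proj_None by metis
        then have "(0, 0) \<in> V" by (rule fib[OF _ _ m(1), rotated]) (simp add: S_m_def)
        then show ?thesis using 0 by simp
      next
        case 2
        then show ?thesis using fib[of n m] m by simp
      qed
    qed
    show "Some ` V \<subseteq> {x \<in> topspace S_m_bar. proj x \<in> in_phase_space V}"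
      using VS by (auto simp: in_phase_space_image simp del: proj.simps)
  qed
  moreover have "in_phase_space V \<subseteq> phase_space"
    using VS unfolding phase_space_eq in_phase_space_def by blast
  ultimately show ?thesis using V by (simp add: openin_phase_top del: topspace_Alexandroff_compactification)
qed

lemma openin_phase_top_interior:
  assumes "openin (top_of_set S_m) V" "\<And>m. m \<in> V \<Longrightarrow> 0 < fst m"
  shows "openin phase_top (in_phase_space V)"
  by (rule openin_phase_top_saturated[OF assms(1)]) (use assms(2) in force)+

text \<open>On the open part m2 > 0 no points are glued, so the quotient map is injective,
  continuous and open there, hence an embedding. Restriction then also covers sets X that are not
  open in \<open>S_m\<close>, such as curves.\<close>

lemma planar_class_homeomorphic_map:
  assumes X: "X \<subseteq> S_m" "\<And>m. m \<in> X \<Longrightarrow> 0 < fst m"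
  shows "homeomorphic_map (top_of_set X) (subtopology phase_top (in_phase_space X)) planar_class"
proof -
  define N where "N = S_m \<inter> {m. 0 < fst m}"
  have "open {m::real \<times> real. 0 < fst m}" by (intro open_Collect_less continuous_intros)
  then have N: "openin (top_of_set S_m) N" unfolding N_def by (intro openin_open_Int)
  have XN: "X \<subseteq> N" using X by (auto simp: N_def)
  have inj: "inj_on planar_class N"
    by (rule inj_onI) (use planar_class_eq_iff in \<open>auto simp: N_def simp del: proj.simps\<close>)
  have c: "continuous_map (top_of_set N) phase_top planar_class"
    using continuous_map_from_subtopology[OF continuous_map_planar_class, of N]
    by (simp add: subtopology_subtopology N_def Int_assoc[symmetric])
  have o: "open_map (top_of_set N) phase_top planar_class"
    unfolding open_map_def
  proof (intro allI impI)
    fix U assume "openin (top_of_set N) U"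
    then have "openin (top_of_set S_m) U" "U \<subseteq> N" using N openin_trans openin_imp_subset by blast+
    then show "openin phase_top (planar_class ` U)"
      using openin_phase_top_interior[of U] unfolding in_phase_space_image N_def by blast
  qed
  have "embedding_map (top_of_set N) phase_top planar_class"
    using injective_open_imp_embedding_map[OF c o] inj by simp
  then have h: "homeomorphic_map (top_of_set N) (subtopology phase_top (planar_class ` N)) planar_class"
    by (simp add: embedding_map_def)
  have sub: "planar_class ` X \<subseteq> planar_class ` N" using XN by blast
  have "planar_class ` N \<subseteq> phase_space" unfolding phase_space_eq N_def by blast
  then have "planar_class ` (topspace (top_of_set N) \<inter> X) =
      topspace (subtopology phase_top (planar_class ` N)) \<inter> (planar_class ` X)"
    using XN sub by (simp add: Int_absorb1 Int_absorb2 del: proj.simps)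
  from homeomorphic_map_subtopologies[OF h this] show ?thesis
    using XN sub by (simp add: subtopology_subtopology in_phase_space_image Int_absorb1 del: proj.simps)
qed

lemma limitin_planar_class:
  assumes "(f \<longlongrightarrow> q) F" "\<And>s. f s \<in> S_m" "q \<in> S_m"
  shows "limitin phase_top (\<lambda>s. planar_class (f s)) (planar_class q) F"
proof -
  have "limitin (top_of_set S_m) f q F" using assms by (simp add: limitin_subtopology)
  from continuous_map_limit[OF continuous_map_planar_class this] show ?thesis by (simp add: o_def)
qed

text \<open>A neighbourhood of infinity is the complement of a compact set, on which m3 is bounded.
  So the curve converges to infinity in the compactification, and infinity represents the class of
  the origin.\<close>

lemma limitin_planar_class_infinity:
  assumes lim: "filterlim (\<lambda>s. snd (f s)) at_bot F" and f: "\<And>s. f s \<in> S_m"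
  shows "limitin phase_top (\<lambda>s. planar_class (f s)) (planar_class (0, 0)) F"
proof -
  have "limitin S_m_bar (\<lambda>s. Some (f s)) None F"
    unfolding limitin_def
  proof (intro conjI allI impI)
    fix U assume U: "openin S_m_bar U \<and> None \<in> U"
    then obtain C where C: "compactin (top_of_set S_m) C" "U = insert None (Some ` (S_m - C))"
      unfolding openin_Alexandroff_compactification by auto
    have "compact (snd ` C)" using C(1)
      by (intro compact_continuous_image continuous_intros) (simp add: compactin_subtopology)
    then obtain b where b: "\<And>m. m \<in> C \<Longrightarrow> \<bar>snd m\<bar> \<le> b"
      using compact_imp_bounded[of "snd ` C"] by (auto simp: bounded_iff)
    have "\<forall>\<^sub>F s in F. snd (f s) \<le> - b - 1" using lim unfolding filterlim_at_bot by blast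
    then show "\<forall>\<^sub>F s in F. Some (f s) \<in> U"
    proof (rule eventually_mono)
      fix s assume "snd (f s) \<le> - b - 1"
      then have "f s \<notin> C" using b[of "f s"] by force
      then show "Some (f s) \<in> U" using f C(2) by simp
    qed
  qed simp
  from continuous_map_limit[OF continuous_map_proj this] show ?thesis
    unfolding proj_None o_def .
qed

subsection \<open>Dimension and connectedness\<close>

text \<open>A single global chart suffices. \<open>Euclidean_space n\<close> consists of the
  sequences vanishing from index n on; f and g identify the ambient space of U with it.\<close>

lemma has_dimension_chart:
  fixes U :: "'a::topological_space set" and f :: "'a \<Rightarrow> nat \<Rightarrow> real"
  assumes X: "X homeomorphic_space top_of_set U" and U: "open U" "U \<noteq> {}"
    and f: "continuous_on UNIV f" and g: "continuous_on UNIV g" and gf: "\<And>x. g (f x) = x"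
    and fE: "\<And>x i. i \<ge> n \<Longrightarrow> f x i = 0" and fg: "\<And>v. (\<And>i. i \<ge> n \<Longrightarrow> v i = 0) \<Longrightarrow> f (g v) = v"
  shows "has_dimension X n"
proof -
  have E: "Euclidean_space n = top_of_set {v. \<forall>i\<ge>n. v i = 0}"
    by (simp add: Euclidean_space_def euclidean_product_topology)
  have img: "f ` U = {v. \<forall>i\<ge>n. v i = 0} \<inter> g -` U"
    using gf fg fE by (auto simp: image_iff) (metis fg)
  have "open (g -` U)" using g U(1) by (simp add: continuous_on_open_vimage)
  then have V: "openin (Euclidean_space n) (f ` U)"
    unfolding E img by (rule openin_open_Int)
  have "homeomorphic_maps (top_of_set U) (top_of_set (f ` U)) f g"
    using f g gf by (auto simp: homeomorphic_maps_def intro: continuous_on_subset)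
  then have "top_of_set U homeomorphic_space top_of_set (f ` U)"
    unfolding homeomorphic_space_def by blast
  then have hom: "X homeomorphic_space top_of_set (f ` U)" using X homeomorphic_space_trans by blast
  have "f ` U \<subseteq> {v. \<forall>i\<ge>n. v i = 0}" using fE by auto
  then have "subtopology (Euclidean_space n) (f ` U) = top_of_set (f ` U)"
    unfolding E by (simp add: subtopology_subtopology Int_absorb1)
  then have hom: "subtopology X (topspace X) homeomorphic_space subtopology (Euclidean_space n) (f ` U)"
    using hom by simp
  have "topspace X \<noteq> {}"
    using X U(2)
    by (metis homeomorphic_empty_space null_topspace_iff_trivial topspace_euclidean_subtopology)
  then show ?thesis
    unfolding has_dimension_def using hom V openin_topspace by blast
qed

lemma has_dimension_1:
  fixes U :: "real set"
  assumes "X homeomorphic_space top_of_set U" "open U" "U \<noteq> {}"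
  shows "has_dimension X 1"
proof (rule has_dimension_chart[OF assms, where f = "\<lambda>x i. if i = 0 then x else 0" and g = "\<lambda>v. v 0"])
  show "continuous_on UNIV (\<lambda>(x::real) (i::nat). if i = 0 then x else 0)"
  proof (rule continuous_on_coordinatewise_then_product)
    show "continuous_on UNIV (\<lambda>x::real. if i = 0 then x else 0)" for i :: nat
      by (cases "i = 0") auto
  qed
  show "(\<lambda>i::nat. if i = 0 then v 0 else 0) = v" if "\<And>i. i \<ge> 1 \<Longrightarrow> v i = 0" for v :: "nat \<Rightarrow> real"
    using that by (auto simp: fun_eq_iff Suc_le_eq)
qed auto

lemma has_dimension_2:
  fixes U :: "(real \<times> real) set"
  assumes "X homeomorphic_space top_of_set U" "open U" "U \<noteq> {}"
  shows "has_dimension X 2"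
proof (rule has_dimension_chart[OF assms,
    where f = "\<lambda>m i. if i = 0 then fst m else if i = 1 then snd m else 0" and g = "\<lambda>v. (v 0, v 1)"])
  show "continuous_on UNIV (\<lambda>(m::real \<times> real) (i::nat). if i = 0 then fst m else if i = 1 then snd m else 0)"
  proof (rule continuous_on_coordinatewise_then_product)
    show "continuous_on UNIV (\<lambda>m::real \<times> real. if i = 0 then fst m else if i = 1 then snd m else 0)" for i :: nat
      by (cases "i = 0"; cases "i = 1") (auto intro!: continuous_intros)
  qed
  show "continuous_on UNIV (\<lambda>v::nat \<Rightarrow> real. (v 0, v 1))"
    by (intro continuous_on_Pair continuous_on_product_coordinates)
  show "(\<lambda>i::nat. if i = 0 then fst (v 0, v 1) else if i = 1 then snd (v 0, v 1) else 0) = v"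
    if "\<And>i. i \<ge> 2 \<Longrightarrow> v i = 0" for v :: "nat \<Rightarrow> real"
  proof
    show "(if i = 0 then fst (v 0, v 1) else if i = 1 then snd (v 0, v 1) else 0) = v i" for i
      using that[of i] by (cases "i \<ge> 2") (auto simp: not_le less_2_cases_iff)
  qed
qed auto

text \<open>The curve is parametrised by one of its coordinates, and the projection h inverts the
  parametrisation.\<close>

lemma curve_dimension:
  fixes \<gamma> :: "real \<Rightarrow> real \<times> real"
  assumes "open I" "I \<noteq> {}" and \<gamma>: "continuous_on I \<gamma>" and "continuous_on UNIV h"
    and "\<And>t. t \<in> I \<Longrightarrow> h (\<gamma> t) = t" and X: "X = \<gamma> ` I" "X \<subseteq> S_m" "\<And>m. m \<in> X \<Longrightarrow> 0 < fst m"
  shows "has_dimension (subtopology phase_top (in_phase_space X)) 1"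
proof -
  have "homeomorphic_maps (top_of_set X) (top_of_set I) h \<gamma>"
    unfolding X(1) homeomorphic_maps_def using assms(4,5) \<gamma>
    by (auto intro: continuous_on_subset)
  then have "top_of_set X homeomorphic_space top_of_set I" unfolding homeomorphic_space_def by blast
  moreover have "subtopology phase_top (in_phase_space X) homeomorphic_space top_of_set X"
    using planar_class_homeomorphic_map[OF X(2,3)] homeomorphic_map_imp_homeomorphic_space
      homeomorphic_space_sym by blast
  ultimately show ?thesis
    using has_dimension_1 assms(1,2) homeomorphic_space_trans by blast
qed

lemma open_set_dimension:
  assumes "open X" "X \<noteq> {}" "X \<subseteq> S_m" "\<And>m. m \<in> X \<Longrightarrow> 0 < fst m" "connected X"
  shows "openin phase_top (in_phase_space X)" "connectedin phase_top (in_phase_space X)"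
    "has_dimension (subtopology phase_top (in_phase_space X)) 2"
proof -
  show "openin phase_top (in_phase_space X)"
    by (rule openin_phase_top_interior) (use assms in \<open>auto intro: open_subset\<close>)
  have "connectedin (top_of_set S_m) X" using assms(3,5) by (simp add: connectedin_subtopology)
  from connectedin_continuous_map_image[OF continuous_map_planar_class this]
  show "connectedin phase_top (in_phase_space X)" by (simp add: in_phase_space_image)
  have "subtopology phase_top (in_phase_space X) homeomorphic_space top_of_set X"
    using planar_class_homeomorphic_map[OF assms(3,4)] homeomorphic_map_imp_homeomorphic_space
      homeomorphic_space_sym by blast
  then show "has_dimension (subtopology phase_top (in_phase_space X)) 2"
    using has_dimension_2 assms(1,2) by blast
qed

text \<open>On the edge \<open>m\<^sub>2 = 0\<close> the map to the phase space is two to one, so open sets have to be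
  saturated under \<open>m\<^sub>3 \<mapsto> 1 / m\<^sub>3\<close>.\<close>

lemma left_edge_dimension:
  "has_dimension (subtopology phase_top (in_phase_space {(m2, m3). m2 = 0 \<and> -1 < m3 \<and> m3 < 0})) 1"
proof -
  define X :: "(real \<times> real) set" where "X = {(m2, m3). m2 = 0 \<and> -1 < m3 \<and> m3 < 0}"
  define f where "f t = planar_class (0, t)" for t
  define I :: "real set" where "I = {-1<..<0}"
  have XI: "X = Pair 0 ` I" by (auto simp: X_def I_def)
  have XS: "X \<subseteq> S_m" by (auto simp: X_def S_m_def)
  have fI: "f ` I = in_phase_space X" unfolding XI in_phase_space_image f_def image_image ..
  have sub: "in_phase_space X \<subseteq> phase_space" unfolding phase_space_eq in_phase_space_def using XS by blast
  have "homeomorphic_map (top_of_set I) (subtopology phase_top (in_phase_space X)) f"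
  proof (rule bijective_open_imp_homeomorphic_map)
    have "continuous_map (top_of_set I) (top_of_set S_m) (Pair 0)"
      using XS by (auto simp: XI intro!: continuous_intros)
    from continuous_map_compose[OF this continuous_map_planar_class]
    have "continuous_map (top_of_set I) phase_top f" by (simp add: f_def[abs_def] o_def)
    then show "continuous_map (top_of_set I) (subtopology phase_top (in_phase_space X)) f"
      using fI by (auto simp: continuous_map_in_subtopology)
    show "f ` topspace (top_of_set I) = topspace (subtopology phase_top (in_phase_space X))"
      using fI sub by auto
    show "inj_on f (topspace (top_of_set I))"
    proof (rule inj_onI)
      fix s t assume st: "s \<in> topspace (top_of_set I)" "t \<in> topspace (top_of_set I)" "f s = f t"
      then have I: "-1 < s" "s < 0" "-1 < t" "t < 0" by (auto simp: I_def)
      then have "(- s) * (- t) < 1 * 1" by (intro mult_strict_mono) auto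
      then have "s * t \<noteq> 1" by simp
      then show "s = t"
        using st(3) I planar_class_eq_iff[of "(0, s)" "(0, t)"] by (auto simp: f_def S_m_def simp del: proj.simps)
    qed
    show "open_map (top_of_set I) (subtopology phase_top (in_phase_space X)) f"
      unfolding open_map_def
    proof (intro allI impI)
      fix U assume "openin (top_of_set I) U"
      then have U: "open U" "U \<subseteq> I" by (auto simp: openin_open_eq I_def)
      define U' where "U' = U \<union> inverse ` U"
      \<comment> \<open>Whole horizontal bands are taken to obtain an open set of
        \<open>S_m\<close>; their points with m2 > 0 are not glued to the edge, so they contribute
        nothing to the intersection with the edge.\<close>
      define V where "V = S_m \<inter> snd -` U'"
      have U0: "0 \<notin> U" using U(2) by (auto simp: I_def)
      have "open (inverse ` U)"
      proof -
        have "inverse ` U = (- {0}) \<inter> inverse -` U"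
          using U0 by (auto simp: image_iff) (metis inverse_inverse_eq)
        moreover have "open ((- {0}) \<inter> inverse -` U)"
          by (rule continuous_open_preimage[OF _ _ U(1)]) (auto intro!: continuous_intros)
        ultimately show ?thesis by simp
      qed
      then have "open (snd -` U' :: (real \<times> real) set)"
        unfolding U'_def using U(1) by (intro open_vimage open_Un continuous_intros)
      then have V: "openin (top_of_set S_m) V" unfolding V_def by (rule openin_open_Int)
      have 0: "0 \<notin> U'" using U0 by (auto simp: U'_def)
      have inv: "b \<in> U'" if "a \<in> U'" "a * b = 1" for a b
      proof -
        have "b = inverse a" using that(2) inverse_unique by auto
        then show ?thesis using that(1) by (auto simp: U'_def)
      qed
      have W: "openin phase_top (in_phase_space V)"
        by (rule openin_phase_top_saturated[OF V]) (use 0 inv in \<open>auto simp: V_def\<close>)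
      have "f ` U = in_phase_space V \<inter> in_phase_space X"
      proof
        have "f t \<in> in_phase_space V \<inter> in_phase_space X" if "t \<in> U" for t
        proof -
          have "(0, t) \<in> X" using that U(2) by (auto simp: XI)
          moreover from this have "(0, t) \<in> V" using XS that by (auto simp: V_def U'_def)
          ultimately show ?thesis unfolding f_def in_phase_space_image by blast
        qed
        then show "f ` U \<subseteq> in_phase_space V \<inter> in_phase_space X" by blast
        show "in_phase_space V \<inter> in_phase_space X \<subseteq> f ` U"
        proof
          fix p assume p: "p \<in> in_phase_space V \<inter> in_phase_space X"
          then obtain m t where m: "m \<in> V" "p = planar_class m" and t: "t \<in> I" "p = planar_class (0, t)"
            unfolding in_phase_space_image XI by blast
          have tS: "(0, t) \<in> S_m" using t(1) XS XI by blast
          have "m = (0, t) \<or> snd m * t = 1"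
            using planar_class_eq_iff[of m "(0, t)"] m t tS by (auto simp: V_def)
          then have "t \<in> U'" using m(1) inv[of "snd m" t] by (auto simp: V_def)
          moreover have "t \<notin> inverse ` U"
          proof
            assume "t \<in> inverse ` U"
            then obtain u where u: "u \<in> U" "t = inverse u" by blast
            then have "-1 < u" "u < 0" using U(2) by (auto simp: I_def)
            then have "inverse u < -1" by (simp add: field_simps)
            then show False using t(1) u by (simp add: I_def)
          qed
          ultimately show "p \<in> f ` U" using t(2) by (auto simp: U'_def f_def)
        qed
      qed
      then show "openin (subtopology phase_top (in_phase_space X)) (f ` U)"
        using W by (metis openin_subtopology)
    qed
  qed
  then have "subtopology phase_top (in_phase_space X) homeomorphic_space top_of_set I"
    using homeomorphic_map_imp_homeomorphic_space homeomorphic_space_sym by blast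
  then show ?thesis unfolding X_def[symmetric]
    by (rule has_dimension_1) (auto simp: I_def)
qed

section \<open>The phase portrait\<close>

text \<open>A fundamental domain: of the two points \<open>(0, m\<^sub>3)\<close> and \<open>(0, 1 / m\<^sub>3)\<close> only one is kept.\<close>

definition reduced_domain :: "(real \<times> real) set" where
  "reduced_domain = {m \<in> S_m. fst m = 0 \<longrightarrow> - 1 \<le> snd m}"

lemma inj_on_reduced_domain: "inj_on planar_class reduced_domain"
proof (rule inj_onI)
  fix m n assume m: "m \<in> reduced_domain" and n: "n \<in> reduced_domain"
    and eq: "planar_class m = planar_class n"
  have S: "m \<in> S_m" "n \<in> S_m" using m n by (auto simp: reduced_domain_def)
  show "m = n"
  proof (rule ccontr)
    assume "m \<noteq> n"
    then have *: "fst m = 0" "fst n = 0" "snd m * snd n = 1"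
      using planar_class_eq_iff[OF S] eq by auto
    then have b: "- 1 \<le> snd m" "snd m \<le> 0" "- 1 \<le> snd n" "snd n \<le> 0"
      using m n by (auto simp: reduced_domain_def S_m_def case_prod_beta)
    \<comment> \<open>Two numbers in [0, 1] have product 1 only if both equal 1, so the sole glued
      pair left is (0, - 1) with itself.\<close>
    have "(- snd m) * (- snd n) \<le> (- snd m) * 1" "(- snd m) * (- snd n) \<le> 1 * (- snd n)"
      using b by (intro mult_left_mono mult_right_mono; simp)+
    then have "snd m = - 1" "snd n = - 1" using * b by auto
    then show False using * \<open>m \<noteq> n\<close> by (simp add: prod_eq_iff)
  qed
qed

lemma reduced_domain_surj: "in_phase_space reduced_domain = phase_space"
proof
  show "in_phase_space reduced_domain \<subseteq> phase_space"
    unfolding phase_space_eq in_phase_space_def reduced_domain_def by blast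
  show "phase_space \<subseteq> in_phase_space reduced_domain"
  proof
    fix p assume "p \<in> phase_space"
    then obtain m where m: "m \<in> S_m" "p = planar_class m" unfolding phase_space_eq by blast
    show "p \<in> in_phase_space reduced_domain"
    proof (cases "m \<in> reduced_domain")
      case True
      then show ?thesis using m(2) by (auto simp: in_phase_space_image simp del: proj.simps)
    next
      case False
      then have *: "fst m = 0" "snd m < - 1" using m(1) by (auto simp: reduced_domain_def)
      define n where "n = (0 :: real, 1 / snd m)"
      have n: "n \<in> reduced_domain" using * by (simp add: n_def reduced_domain_def S_m_def field_simps)
      then have "planar_class m = planar_class n"
        using planar_class_eq_iff[OF m(1), of n] * by (simp add: n_def reduced_domain_def del: proj.simps)
      then show ?thesis using m(2) n by (auto simp: in_phase_space_image simp del: proj.simps)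
    qed
  qed
qed

text \<open>Injectivity on the fundamental domain carries disjointness from the plane to the
  quotient.\<close>

lemma in_phase_space_disjnt:
  assumes "X \<subseteq> reduced_domain" "Y \<subseteq> reduced_domain" "disjnt X Y"
  shows "disjnt (in_phase_space X) (in_phase_space Y)"
  using inj_on_image_Int[OF inj_on_reduced_domain assms(1,2)] assms(3)
  by (simp add: in_phase_space_image disjnt_def del: proj.simps)

text \<open>The order is that of the theorem, so that its list can be rewritten as one image. The
  pieces given there through the unstable manifold appear here through the backward behaviour of
  trajectories, for which invariance is immediate.\<close>

definition planar_pieces :: "(real \<times> real) set list" where
  "planar_pieces = [{(0, 0)}, {(0, - 1)}, {(1, 0)}, {(1, 1)},
    {(m2, m3). m2 = 0 \<and> -1 < m3 \<and> m3 < 0}, {(m2, m3). m3 = 0 \<and> 0 < m2 \<and> m2 < 1},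
    {(m2, m3). m2 = 1 \<and> m3 < 0}, {(m2, m3). m2 = m3 \<and> 0 < m2 \<and> m2 < 1}, separatrix,
    {(m2, m3). m2 = 1 \<and> 0 < m3 \<and> m3 < 1}, {(m2, m3). 0 < m2 \<and> m2 < 1 \<and> 0 < m3 \<and> m3 < m2},
    above_separatrix, below_separatrix]"

lemma separatrix_sides_eq:
  "{(m2, m3). 0 < m2 \<and> m2 < 1 \<and> m3 < 0 \<and> (\<exists>s<m3. (m2, s) \<in> planar_T23)} = above_separatrix"
  "{(m2, m3). 0 < m2 \<and> m2 < 1 \<and> m3 < 0 \<and> (\<exists>s>m3. (m2, s) \<in> planar_T23)} = below_separatrix"
proof -
  have "separatrix_height x < 0" if "0 < x" "x < 1" for x
    using separatrix_height_bounds[OF that] that by linarith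
  then show "{(m2, m3). 0 < m2 \<and> m2 < 1 \<and> m3 < 0 \<and> (\<exists>s<m3. (m2, s) \<in> planar_T23)} = above_separatrix"
    "{(m2, m3). 0 < m2 \<and> m2 < 1 \<and> m3 < 0 \<and> (\<exists>s>m3. (m2, s) \<in> planar_T23)} = below_separatrix"
    by (force simp: planar_T23_eq separatrix_iff separatrix_sides_iff)+
qed

lemma pieces_eq:
  "[{p1}, {p2}, {p3}, {p4}] @ [T12, T13, T13', T14, T23, T34] @ [B14, B13, B13'] =
    map in_phase_space planar_pieces"
  unfolding planar_pieces_def T12_def T13_def T13'_def T14_def T23_def T34_def B14_def B13_def B13'_def
    separatrix_sides_eq
  unfolding planar_T23_eq
  by (simp add: p1_def p2_def p3_def p4_def in_phase_space_def)

lemma strip_pieces: "above_separatrix \<subseteq> strip" "below_separatrix \<subseteq> strip" "separatrix \<subseteq> strip"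
  by (auto simp: above_separatrix_def below_separatrix_def separatrix_def)

lemma planar_pieces_disjnt: "sorted_wrt disjnt planar_pieces"
proof -
  have h: "separatrix_height x < 0" if "0 < x" "x < 1" for x
    using separatrix_height_bounds[OF that] that by linarith
  have "(x, y) \<in> separatrix \<longleftrightarrow> 0 < x \<and> x < 1 \<and> y < 0 \<and> y = separatrix_height x"
    "(x, y) \<in> below_separatrix \<longleftrightarrow> 0 < x \<and> x < 1 \<and> y < 0 \<and> y < separatrix_height x" for x y
    using h[of x] by (auto simp: separatrix_iff separatrix_sides_iff)
  then show ?thesis unfolding planar_pieces_def
    by (simp add: disjnt_iff separatrix_sides_iff(1))
qed

lemma planar_pieces_subset: "X \<in> set planar_pieces \<Longrightarrow> X \<subseteq> reduced_domain"
proof -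
  have "strip \<subseteq> reduced_domain" by (auto simp: strip_def reduced_domain_def S_m_def)
  then have "above_separatrix \<subseteq> reduced_domain" "below_separatrix \<subseteq> reduced_domain" "separatrix \<subseteq> reduced_domain"
    using strip_pieces by auto
  moreover assume "X \<in> set planar_pieces"
  ultimately show ?thesis by (auto simp: planar_pieces_def reduced_domain_def S_m_def)
qed

lemma planar_pieces_cover: "reduced_domain \<subseteq> \<Union> (set planar_pieces)"
proof
  fix m assume m: "m \<in> reduced_domain"
  obtain x y where xy: "m = (x, y)" by (cases m)
  have b: "0 \<le> x" "x \<le> 1" "y \<le> x" "x = 0 \<longrightarrow> - 1 \<le> y"
    using m by (auto simp: xy reduced_domain_def S_m_def)
  show "m \<in> \<Union> (set planar_pieces)"
  proof (cases "m \<in> strip")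
    case True
    then have "m \<in> above_separatrix \<or> m \<in> below_separatrix \<or> m \<in> separatrix"
      using strip_cases by blast
    then show ?thesis by (auto simp: planar_pieces_def)
  next
    case False
    then have "\<not> (0 < x \<and> x < 1 \<and> y < 0)" by (simp add: xy strip_def)
    then have "m \<in> {(0, 0)} \<or> m \<in> {(0, - 1)} \<or> m \<in> {(1, 0)} \<or> m \<in> {(1, 1)} \<or>
      m \<in> {(m2, m3). m2 = 0 \<and> -1 < m3 \<and> m3 < 0} \<or> m \<in> {(m2, m3). m3 = 0 \<and> 0 < m2 \<and> m2 < 1} \<or>
      m \<in> {(m2, m3). m2 = 1 \<and> m3 < 0} \<or> m \<in> {(m2, m3). m2 = m3 \<and> 0 < m2 \<and> m2 < 1} \<or>
      m \<in> {(m2, m3). m2 = 1 \<and> 0 < m3 \<and> m3 < 1} \<or>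
      m \<in> {(m2, m3). 0 < m2 \<and> m2 < 1 \<and> 0 < m3 \<and> m3 < m2}"
      using b unfolding xy by (cases "x = 0"; cases "x = 1"; cases "y = 0"; cases "y = x"; force)
    then show ?thesis
      unfolding planar_pieces_def by (elim disjE) (simp_all only: list.set Union_insert Un_iff simp_thms)
  qed
qed

lemma planar_pieces_invariant:
  assumes "X \<in> set planar_pieces"
  shows "planar_flow s m \<in> X \<longleftrightarrow> m \<in> X"
proof -
  note c = planar_flow_cmp[where s = s and m = m]
  have p: "n = (a, b) \<longleftrightarrow> fst n = a \<and> snd n = b" for n :: "real \<times> real" and a b
    by (auto simp: prod_eq_iff)
  have "fst (planar_flow s m) = snd (planar_flow s m) \<longleftrightarrow> fst m = snd m" using c(11) by auto
  then show ?thesis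
    using assms unfolding planar_pieces_def list.set
    by (elim insertE emptyE)
      (simp_all add: p c planar_flow_separatrix case_prod_beta mem_Times_iff eq_commute[of "fst _" "snd _"] cong: conj_cong)
qed

section \<open>Transfer of invariance, limits and orbits to the phase space\<close>

lemma ricci_dynamics_image:
  assumes X: "\<And>s m. planar_flow s m \<in> X \<longleftrightarrow> m \<in> X"
  shows "ricci_dynamics t ` in_phase_space X = in_phase_space X"
proof -
  have "planar_flow t ` X = X"
  proof
    show "planar_flow t ` X \<subseteq> X" using X by auto
    show "X \<subseteq> planar_flow t ` X"
    proof
      fix m assume "m \<in> X"
      then have "planar_flow (- t) m \<in> X" using X by simp
      moreover have "planar_flow t (planar_flow (- t) m) = m"
        unfolding planar_flow_add[symmetric] by simp
      ultimately show "m \<in> planar_flow t ` X" by (metis imageI)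
    qed
  qed
  moreover have "ricci_dynamics t ` planar_class ` X = planar_class ` planar_flow t ` X"
    by (simp only: image_image ricci_dynamics_proj)
  ultimately show ?thesis by (simp only: in_phase_space_image)
qed

lemma limit_in_phase_space:
  assumes "\<And>m. m \<in> X \<Longrightarrow> ((\<lambda>s. planar_flow s m) \<longlongrightarrow> q) F" "X \<subseteq> S_m" "q \<in> S_m" "p \<in> in_phase_space X"
  shows "limitin phase_top (\<lambda>t. ricci_dynamics t p) (planar_class q) F"
proof -
  obtain m where m: "m \<in> X" "p = planar_class m" using assms(4) by (auto simp: in_phase_space_image)
  show ?thesis unfolding m(2) ricci_dynamics_proj
    using assms(2) m(1) by (intro limitin_planar_class assms(1,3) planar_flow_S_m) auto
qed

lemma limit_infinity_in_phase_space:
  assumes "\<And>m. m \<in> X \<Longrightarrow> filterlim (\<lambda>s. snd (planar_flow s m)) at_bot F" "X \<subseteq> S_m" "p \<in> in_phase_space X"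
  shows "limitin phase_top (\<lambda>t. ricci_dynamics t p) (planar_class (0, 0)) F"
proof -
  obtain m where m: "m \<in> X" "p = planar_class m" using assms(3) by (auto simp: in_phase_space_image)
  show ?thesis unfolding m(2) ricci_dynamics_proj
    using assms(2) m(1) by (intro limitin_planar_class_infinity assms(1) planar_flow_S_m) auto
qed

text \<open>The coordinate k is continuous along the trajectory and takes values below and above
  every k n, hence all of them. Injectivity of k on the invariant set X turns equal values into
  equal points.\<close>

lemma orbit_in_phase_space:
  assumes X: "\<And>s m. planar_flow s m \<in> X \<longleftrightarrow> m \<in> X" "X \<subseteq> S_m" and m: "m \<in> X"
    and k: "continuous_on UNIV k" "inj_on k X"
    and lo: "\<And>n. n \<in> X \<Longrightarrow> \<exists>s. k (planar_flow s m) < (k n :: real)"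
    and hi: "\<And>n. n \<in> X \<Longrightarrow> \<exists>s. k n < k (planar_flow s m)"
  shows "\<exists>p \<in> phase_space. in_phase_space X = orbit p"
proof
  show "planar_class m \<in> phase_space" unfolding phase_space_eq using m X(2) by blast
  have "range (\<lambda>s. planar_flow s m) = X"
  proof
    show "range (\<lambda>s. planar_flow s m) \<subseteq> X"
      using X(1) m by (simp add: image_subset_iff)
    show "X \<subseteq> range (\<lambda>s. planar_flow s m)"
    proof
      fix n assume n: "n \<in> X"
      obtain s t where st: "k (planar_flow s m) < k n" "k n < k (planar_flow t m)"
        using lo hi n by blast
      have "continuous_on UNIV (\<lambda>s. k (planar_flow s m))"
        using continuous_on_compose2[OF k(1) continuous_planar_flow_time[of UNIV m]] by simp
      then have "connected (range (\<lambda>s. k (planar_flow s m)))"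
        by (rule connected_continuous_image) simp
      then have "k n \<in> range (\<lambda>s. k (planar_flow s m))"
        using connected_contains_Icc[of _ "k (planar_flow s m)" "k (planar_flow t m)"] st
        by (meson atLeastAtMost_iff less_imp_le rangeI subsetD)
      then obtain r where "k n = k (planar_flow r m)" by blast
      then have "n = planar_flow r m" using inj_onD[OF k(2) _ n] m X(1)[of r m] by blast
      then show "n \<in> range (\<lambda>s. planar_flow s m)" by blast
    qed
  qed
  then have "planar_class ` X = range (\<lambda>s. planar_class (planar_flow s m))"
    by (metis image_image)
  then show "in_phase_space X = orbit (planar_class m)"
    by (simp add: in_phase_space_image orbit_def ricci_dynamics_proj del: proj.simps)
qed

lemma tendsto_exceeds:
  fixes f :: "'a \<Rightarrow> real"
  assumes "(f \<longlongrightarrow> l) F" "F \<noteq> bot"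
  shows "l < y \<Longrightarrow> \<exists>s. f s < y" "y < l \<Longrightarrow> \<exists>s. y < f s"
  using eventually_happens'[OF assms(2)] order_tendstoD[OF assms(1)] by blast+

text \<open>The limits at the two ends bound k strictly on the piece, so every value in between is
  exceeded in both senses. The filters are left open because k may increase in either direction of
  time.\<close>

lemma planar_pieces_orbit:
  assumes "X \<in> set planar_pieces" "X \<subseteq> S_m" "m \<in> X" "k = fst \<or> k = snd" "inj_on k X"
    and lim: "((\<lambda>s. planar_flow s m) \<longlongrightarrow> q) F" "((\<lambda>s. planar_flow s m) \<longlongrightarrow> q') F'" "F \<noteq> bot" "F' \<noteq> bot"
    and "\<And>n. n \<in> X \<Longrightarrow> k q < k n \<and> k n < k q'"
  shows "\<exists>p \<in> phase_space. in_phase_space X = orbit p"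
proof (rule orbit_in_phase_space[OF planar_pieces_invariant[OF assms(1)] assms(2,3) _ assms(5)])
  have l: "((\<lambda>s. k (planar_flow s m)) \<longlongrightarrow> k q) F" "((\<lambda>s. k (planar_flow s m)) \<longlongrightarrow> k q') F'"
    using assms(4) lim(1,2) by (auto intro: tendsto_intros)
  show "continuous_on UNIV k" using assms(4) by (auto intro: continuous_intros)
  show "\<exists>s. k (planar_flow s m) < k n" if "n \<in> X" for n
    using tendsto_exceeds(1)[OF l(1) lim(3)] assms(10)[OF that] by blast
  show "\<exists>s. k n < k (planar_flow s m)" if "n \<in> X" for n
    using tendsto_exceeds(2)[OF l(2) lim(4)] assms(10)[OF that] by blast
qed

lemma filters_nontrivial: "(at_top :: real filter) \<noteq> bot" "(at_bot :: real filter) \<noteq> bot"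
  by simp_all

text \<open>Each side is a continuous image of a product of intervals: above the graph the height is
  multiplied by a factor in (0, 1), below it a positive number is subtracted.\<close>

lemma connected_separatrix_sides: "connected above_separatrix" "connected below_separatrix"
proof -
  have h: "separatrix_height x < 0" if "0 < x" "x < 1" for x
    using separatrix_height_bounds[OF that] that by linarith
  have c: "continuous_on ({0<..<1} \<times> A) (\<lambda>p. separatrix_height (fst p))" for A :: "real set"
    by (rule continuous_on_compose2[OF continuous_separatrix_height]) (auto intro!: continuous_intros)
  have "above_separatrix = (\<lambda>p. (fst p, snd p * separatrix_height (fst p))) ` ({0<..<1} \<times> {0<..<1})"
  proof
    show "above_separatrix \<subseteq> (\<lambda>p. (fst p, snd p * separatrix_height (fst p))) ` ({0<..<1} \<times> {0<..<1})"
    proof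
      fix m assume m: "m \<in> above_separatrix"
      obtain x y where xy: "m = (x, y)" by (cases m)
      have b: "0 < x" "x < 1" "y < 0" "separatrix_height x < y"
        using m by (auto simp: xy separatrix_sides_iff)
      have "m = (\<lambda>p. (fst p, snd p * separatrix_height (fst p))) (x, y / separatrix_height x)"
        using h b by (simp add: xy)
      moreover have "(x, y / separatrix_height x) \<in> {0<..<1} \<times> {0<..<1}"
        using b by (auto simp: zero_less_divide_iff divide_less_eq_1)
      ultimately show "m \<in> (\<lambda>p. (fst p, snd p * separatrix_height (fst p))) ` ({0<..<1} \<times> {0<..<1})"
        by blast
    qed
    show "(\<lambda>p. (fst p, snd p * separatrix_height (fst p))) ` ({0<..<1} \<times> {0<..<1}) \<subseteq> above_separatrix"
    proof clarify
      fix x u :: real assume "x \<in> {0<..<1}" "u \<in> {0<..<1}"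
      then have "0 < x" "x < 1" "0 < u" "u < 1" by auto
      moreover from this have "u * separatrix_height x < 0" using h by (simp add: mult_pos_neg)
      moreover have "1 * separatrix_height x < u * separatrix_height x"
        using h[of x] calculation by (intro mult_strict_right_mono_neg)
      ultimately show "(fst (x, u), snd (x, u) * separatrix_height (fst (x, u))) \<in> above_separatrix"
        by (simp add: separatrix_sides_iff)
    qed
  qed
  moreover have "connected ((\<lambda>p. (fst p, snd p * separatrix_height (fst p))) ` ({0<..<1} \<times> {0<..<1}))"
    by (intro connected_continuous_image continuous_intros c connected_Times) auto
  ultimately show "connected above_separatrix" by simp
  have "below_separatrix = (\<lambda>p. (fst p, separatrix_height (fst p) - snd p)) ` ({0<..<1} \<times> {0<..})"
  proof
    show "below_separatrix \<subseteq> (\<lambda>p. (fst p, separatrix_height (fst p) - snd p)) ` ({0<..<1} \<times> {0<..})"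
    proof
      fix m assume m: "m \<in> below_separatrix"
      obtain x y where xy: "m = (x, y)" by (cases m)
      have "m = (\<lambda>p. (fst p, separatrix_height (fst p) - snd p)) (x, separatrix_height x - y)"
        by (simp add: xy)
      moreover have "(x, separatrix_height x - y) \<in> {0<..<1} \<times> {0<..}"
        using m by (simp add: xy separatrix_sides_iff)
      ultimately show "m \<in> (\<lambda>p. (fst p, separatrix_height (fst p) - snd p)) ` ({0<..<1} \<times> {0<..})"
        by blast
    qed
    show "(\<lambda>p. (fst p, separatrix_height (fst p) - snd p)) ` ({0<..<1} \<times> {0<..}) \<subseteq> below_separatrix"
      by (auto simp: separatrix_sides_iff)
  qed
  moreover have "connected ((\<lambda>p. (fst p, separatrix_height (fst p) - snd p)) ` ({0<..<1} \<times> {0<..}))"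
    by (intro connected_continuous_image continuous_intros c connected_Times) auto
  ultimately show "connected below_separatrix" by simp
qed

lemma p_eq: "p1 = planar_class (0, 0)" "p2 = planar_class (0, - 1)" "p3 = planar_class (1, 0)"
  "p4 = planar_class (1, 1)"
  by (simp_all only: p1_def p2_def p3_def p4_def)

lemma equilibria_S_m: "(0, 0) \<in> S_m" "(0, - 1) \<in> S_m" "(1, 0) \<in> S_m" "(1, 1) \<in> S_m"
  by (simp_all add: S_m_def)

lemma planar_pieces_S_m: "X \<in> set planar_pieces \<Longrightarrow> X \<subseteq> S_m"
  using planar_pieces_subset by (auto simp: reduced_domain_def)

section \<open>The individual trajectories and open sets\<close>

lemma T12_facts:
  shows "\<exists>p \<in> phase_space. T12 = orbit p" "has_dimension (subtopology phase_top T12) 1"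
    "p \<in> T12 \<Longrightarrow> limitin phase_top (\<lambda>t. ricci_dynamics t p) p1 at_bot"
    "p \<in> T12 \<Longrightarrow> limitin phase_top (\<lambda>t. ricci_dynamics t p) p2 at_top"
proof -
  let ?X = "{(m2 :: real, m3 :: real). m2 = 0 \<and> -1 < m3 \<and> m3 < 0}"
  have X: "?X \<in> set planar_pieces" by (simp add: planar_pieces_def)
  note S = planar_pieces_S_m[OF X]
  have lim: "((\<lambda>s. planar_flow s m) \<longlongrightarrow> (0, 0)) at_bot" "((\<lambda>s. planar_flow s m) \<longlongrightarrow> (0, - 1)) at_top"
    if "m \<in> ?X" for m
    using planar_flow_left_edge_limits[of m] that by auto
  have m: "(0, - (1/2)) \<in> ?X" by simp
  show "\<exists>p \<in> phase_space. T12 = orbit p" unfolding T12_def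
    \<comment> \<open>On this edge m3 decreases in time, so the lower end is the limit for t tending
      to plus infinity.\<close>
    by (rule planar_pieces_orbit[OF X S m, where k = snd, OF _ _ lim(2,1)[OF m] filters_nontrivial])
      (auto simp: inj_on_def)
  show "has_dimension (subtopology phase_top T12) 1"
    unfolding T12_def by (rule left_edge_dimension)
  show "p \<in> T12 \<Longrightarrow> limitin phase_top (\<lambda>t. ricci_dynamics t p) p1 at_bot"
    unfolding T12_def p_eq by (rule limit_in_phase_space[OF lim(1) S]; simp add: equilibria_S_m)
  show "p \<in> T12 \<Longrightarrow> limitin phase_top (\<lambda>t. ricci_dynamics t p) p2 at_top"
    unfolding T12_def p_eq by (rule limit_in_phase_space[OF lim(2) S]; simp add: equilibria_S_m)
qed

lemma T13_facts:
  shows "\<exists>p \<in> phase_space. T13 = orbit p" "has_dimension (subtopology phase_top T13) 1"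
    "p \<in> T13 \<Longrightarrow> limitin phase_top (\<lambda>t. ricci_dynamics t p) p1 at_bot"
    "p \<in> T13 \<Longrightarrow> limitin phase_top (\<lambda>t. ricci_dynamics t p) p3 at_top"
proof -
  let ?X = "{(m2 :: real, m3 :: real). m3 = 0 \<and> 0 < m2 \<and> m2 < 1}"
  have X: "?X \<in> set planar_pieces" by (simp add: planar_pieces_def)
  note S = planar_pieces_S_m[OF X]
  have lim: "((\<lambda>s. planar_flow s m) \<longlongrightarrow> (0, 0)) at_bot" "((\<lambda>s. planar_flow s m) \<longlongrightarrow> (1, 0)) at_top"
    if m: "m \<in> ?X" for m
  proof -
    have "m \<in> S_m" using m S by blast
    then show "((\<lambda>s. planar_flow s m) \<longlongrightarrow> (0, 0)) at_bot" "((\<lambda>s. planar_flow s m) \<longlongrightarrow> (1, 0)) at_top"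
      using planar_flow_quadrant_limits[of m] m by auto
  qed
  have m: "(1/2, 0) \<in> ?X" by simp
  show "\<exists>p \<in> phase_space. T13 = orbit p" unfolding T13_def
    by (rule planar_pieces_orbit[OF X S m, where k = fst, OF _ _ lim[OF m] filters_nontrivial(2,1)])
      (auto simp: inj_on_def)
  show "has_dimension (subtopology phase_top T13) 1" unfolding T13_def
    by (rule curve_dimension[of "{0<..<1}" "\<lambda>t. (t, 0)" fst]) (use S in \<open>auto intro!: continuous_intros\<close>)
  show "p \<in> T13 \<Longrightarrow> limitin phase_top (\<lambda>t. ricci_dynamics t p) p1 at_bot"
    unfolding T13_def p_eq by (rule limit_in_phase_space[OF lim(1) S]; simp add: equilibria_S_m)
  show "p \<in> T13 \<Longrightarrow> limitin phase_top (\<lambda>t. ricci_dynamics t p) p3 at_top"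
    unfolding T13_def p_eq by (rule limit_in_phase_space[OF lim(2) S]; simp add: equilibria_S_m)
qed

lemma T14_facts:
  shows "\<exists>p \<in> phase_space. T14 = orbit p" "has_dimension (subtopology phase_top T14) 1"
    "p \<in> T14 \<Longrightarrow> limitin phase_top (\<lambda>t. ricci_dynamics t p) p1 at_bot"
    "p \<in> T14 \<Longrightarrow> limitin phase_top (\<lambda>t. ricci_dynamics t p) p4 at_top"
proof -
  let ?X = "{(m2 :: real, m3 :: real). m2 = m3 \<and> 0 < m2 \<and> m2 < 1}"
  have X: "?X \<in> set planar_pieces" by (simp add: planar_pieces_def)
  note S = planar_pieces_S_m[OF X]
  have lim: "((\<lambda>s. planar_flow s m) \<longlongrightarrow> (0, 0)) at_bot" "((\<lambda>s. planar_flow s m) \<longlongrightarrow> (1, 1)) at_top"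
    if m: "m \<in> ?X" for m
  proof -
    have "m \<in> S_m" using m S by blast
    then show "((\<lambda>s. planar_flow s m) \<longlongrightarrow> (0, 0)) at_bot" "((\<lambda>s. planar_flow s m) \<longlongrightarrow> (1, 1)) at_top"
      using planar_flow_quadrant_limits[of m] m by auto
  qed
  have m: "(1/2, 1/2) \<in> ?X" by simp
  show "\<exists>p \<in> phase_space. T14 = orbit p" unfolding T14_def
    by (rule planar_pieces_orbit[OF X S m, where k = fst, OF _ _ lim[OF m] filters_nontrivial(2,1)])
      (auto simp: inj_on_def)
  show "has_dimension (subtopology phase_top T14) 1" unfolding T14_def
    by (rule curve_dimension[of "{0<..<1}" "\<lambda>t. (t, t)" fst]) (use S in \<open>auto intro!: continuous_intros\<close>)
  show "p \<in> T14 \<Longrightarrow> limitin phase_top (\<lambda>t. ricci_dynamics t p) p1 at_bot"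
    unfolding T14_def p_eq by (rule limit_in_phase_space[OF lim(1) S]; simp add: equilibria_S_m)
  show "p \<in> T14 \<Longrightarrow> limitin phase_top (\<lambda>t. ricci_dynamics t p) p4 at_top"
    unfolding T14_def p_eq by (rule limit_in_phase_space[OF lim(2) S]; simp add: equilibria_S_m)
qed

lemma T34_facts:
  shows "\<exists>p \<in> phase_space. T34 = orbit p" "has_dimension (subtopology phase_top T34) 1"
    "p \<in> T34 \<Longrightarrow> limitin phase_top (\<lambda>t. ricci_dynamics t p) p3 at_bot"
    "p \<in> T34 \<Longrightarrow> limitin phase_top (\<lambda>t. ricci_dynamics t p) p4 at_top"
proof -
  let ?X = "{(m2 :: real, m3 :: real). m2 = 1 \<and> 0 < m3 \<and> m3 < 1}"
  have X: "?X \<in> set planar_pieces" by (simp add: planar_pieces_def)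
  note S = planar_pieces_S_m[OF X]
  have lim: "((\<lambda>s. planar_flow s m) \<longlongrightarrow> (1, 0)) at_bot" "((\<lambda>s. planar_flow s m) \<longlongrightarrow> (1, 1)) at_top"
    if m: "m \<in> ?X" for m
  proof -
    have "m \<in> S_m" using m S by blast
    then show "((\<lambda>s. planar_flow s m) \<longlongrightarrow> (1, 0)) at_bot" "((\<lambda>s. planar_flow s m) \<longlongrightarrow> (1, 1)) at_top"
      using planar_flow_quadrant_limits[of m] m by auto
  qed
  have m: "(1, 1/2) \<in> ?X" by simp
  show "\<exists>p \<in> phase_space. T34 = orbit p" unfolding T34_def
    by (rule planar_pieces_orbit[OF X S m, where k = snd, OF _ _ lim[OF m] filters_nontrivial(2,1)])
      (auto simp: inj_on_def)
  show "has_dimension (subtopology phase_top T34) 1" unfolding T34_def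
    by (rule curve_dimension[of "{0<..<1}" "\<lambda>t. (1, t)" snd]) (use S in \<open>auto intro!: continuous_intros\<close>)
  show "p \<in> T34 \<Longrightarrow> limitin phase_top (\<lambda>t. ricci_dynamics t p) p3 at_bot"
    unfolding T34_def p_eq by (rule limit_in_phase_space[OF lim(1) S]; simp add: equilibria_S_m)
  show "p \<in> T34 \<Longrightarrow> limitin phase_top (\<lambda>t. ricci_dynamics t p) p4 at_top"
    unfolding T34_def p_eq by (rule limit_in_phase_space[OF lim(2) S]; simp add: equilibria_S_m)
qed

lemma T23_facts:
  shows "\<exists>p \<in> phase_space. T23 = orbit p" "has_dimension (subtopology phase_top T23) 1"
    "p \<in> T23 \<Longrightarrow> limitin phase_top (\<lambda>t. ricci_dynamics t p) p2 at_bot"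
    "p \<in> T23 \<Longrightarrow> limitin phase_top (\<lambda>t. ricci_dynamics t p) p3 at_top"
proof -
  have X: "separatrix \<in> set planar_pieces" by (simp add: planar_pieces_def)
  note S = planar_pieces_S_m[OF X]
  have lim: "((\<lambda>s. planar_flow s m) \<longlongrightarrow> (0, - 1)) at_bot" "((\<lambda>s. planar_flow s m) \<longlongrightarrow> (1, 0)) at_top"
    if "m \<in> separatrix" for m
    using separatrix_limit_bot[OF that] strip_limit_top[of m] that strip_pieces(3) by auto
  have m: "(1/2, separatrix_height (1/2)) \<in> separatrix" by (simp add: separatrix_iff)
  have T: "T23 = in_phase_space separatrix" by (simp add: T23_def planar_T23_eq)
  show "\<exists>p \<in> phase_space. T23 = orbit p" unfolding T
    by (rule planar_pieces_orbit[OF X S m, where k = fst, OF _ _ lim[OF m] filters_nontrivial(2,1)])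
      (auto simp: inj_on_def separatrix_iff)
  show "has_dimension (subtopology phase_top T23) 1" unfolding T
  proof (rule curve_dimension[of "{0<..<1}" "\<lambda>t. (t, separatrix_height t)" fst])
    show "continuous_on {0<..<1} (\<lambda>t. (t, separatrix_height t))"
      by (intro continuous_intros continuous_separatrix_height)
  qed (use S in \<open>auto simp: separatrix_iff intro!: continuous_intros\<close>)
  show "p \<in> T23 \<Longrightarrow> limitin phase_top (\<lambda>t. ricci_dynamics t p) p2 at_bot"
    unfolding T p_eq by (rule limit_in_phase_space[OF lim(1) S]; simp add: equilibria_S_m)
  show "p \<in> T23 \<Longrightarrow> limitin phase_top (\<lambda>t. ricci_dynamics t p) p3 at_top"
    unfolding T p_eq by (rule limit_in_phase_space[OF lim(2) S]; simp add: equilibria_S_m)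
qed

text \<open>Backwards the trajectory goes to infinity, so no planar limit bounds m3 from below; its
  divergence shows instead that every negative value is passed.\<close>

lemma T13'_facts:
  shows "\<exists>p \<in> phase_space. T13' = orbit p" "has_dimension (subtopology phase_top T13') 1"
    "p \<in> T13' \<Longrightarrow> limitin phase_top (\<lambda>t. ricci_dynamics t p) p1 at_bot"
    "p \<in> T13' \<Longrightarrow> limitin phase_top (\<lambda>t. ricci_dynamics t p) p3 at_top"
proof -
  let ?X = "{(m2 :: real, m3 :: real). m2 = 1 \<and> m3 < 0}"
  have X: "?X \<in> set planar_pieces" by (simp add: planar_pieces_def)
  note S = planar_pieces_S_m[OF X]
  have lim: "((\<lambda>s. planar_flow s m) \<longlongrightarrow> (1, 0)) at_top" "filterlim (\<lambda>s. snd (planar_flow s m)) at_bot at_bot"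
    if "m \<in> ?X" for m
    using planar_flow_right_edge_limits[of m] that by auto
  have m: "(1, - 1) \<in> ?X" by simp
  show "\<exists>p \<in> phase_space. T13' = orbit p" unfolding T13'_def
  proof (rule orbit_in_phase_space[OF planar_pieces_invariant[OF X] S m, where k = snd])
    fix n assume n: "n \<in> ?X"
    have "\<forall>\<^sub>F s in at_bot. snd (planar_flow s (1, - 1)) \<le> snd n - 1"
      using lim(2)[OF m] unfolding filterlim_at_bot by (rule spec)
    from eventually_happens'[OF filters_nontrivial(2) this]
    obtain s where "snd (planar_flow s (1, - 1)) \<le> snd n - 1" by blast
    then show "\<exists>s. snd (planar_flow s (1, - 1)) < snd n" by (intro exI[of _ s]) simp
    show "\<exists>s. snd n < snd (planar_flow s (1, - 1))"
      by (rule tendsto_exceeds(2)[OF tendsto_snd[OF lim(1)[OF m]] filters_nontrivial(1)])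
        (use n in auto)
  qed (auto simp: inj_on_def intro: continuous_intros)
  show "has_dimension (subtopology phase_top T13') 1" unfolding T13'_def
    by (rule curve_dimension[of "{..<0}" "\<lambda>t. (1, t)" snd]) (use S in \<open>auto intro!: continuous_intros\<close>)
  show "p \<in> T13' \<Longrightarrow> limitin phase_top (\<lambda>t. ricci_dynamics t p) p1 at_bot"
    unfolding T13'_def p_eq by (rule limit_infinity_in_phase_space[OF lim(2) S])
  show "p \<in> T13' \<Longrightarrow> limitin phase_top (\<lambda>t. ricci_dynamics t p) p3 at_top"
    unfolding T13'_def p_eq by (rule limit_in_phase_space[OF lim(1) S]; simp add: equilibria_S_m)
qed

lemma B14_facts:
  shows "openin phase_top B14" "connectedin phase_top B14" "has_dimension (subtopology phase_top B14) 2"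
    "p \<in> B14 \<Longrightarrow> limitin phase_top (\<lambda>t. ricci_dynamics t p) p1 at_bot"
    "p \<in> B14 \<Longrightarrow> limitin phase_top (\<lambda>t. ricci_dynamics t p) p4 at_top"
proof -
  let ?X = "{(m2 :: real, m3 :: real). 0 < m2 \<and> m2 < 1 \<and> 0 < m3 \<and> m3 < m2}"
  have X: "?X \<in> set planar_pieces" by (simp add: planar_pieces_def)
  note S = planar_pieces_S_m[OF X]
  have lim: "((\<lambda>s. planar_flow s m) \<longlongrightarrow> (0, 0)) at_bot" "((\<lambda>s. planar_flow s m) \<longlongrightarrow> (1, 1)) at_top"
    if m: "m \<in> ?X" for m
  proof -
    have "m \<in> S_m" using m S by blast
    then show "((\<lambda>s. planar_flow s m) \<longlongrightarrow> (0, 0)) at_bot" "((\<lambda>s. planar_flow s m) \<longlongrightarrow> (1, 1)) at_top"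
      using planar_flow_quadrant_limits[of m] m by auto
  qed
  have e: "?X = {m. 0 < fst m} \<inter> {m. fst m < 1} \<inter> {m. 0 < snd m} \<inter> {m. snd m < fst m}" by auto
  have o: "open ?X" unfolding e by (intro open_Int open_Collect_less continuous_intros)
  have "convex ?X"
  proof -
    have "convex {m :: real \<times> real. 0 < (1, 0) \<bullet> m}" "convex {m :: real \<times> real. (1, 0) \<bullet> m < 1}"
      "convex {m :: real \<times> real. 0 < (0, 1) \<bullet> m}" "convex {m :: real \<times> real. (- 1, 1) \<bullet> m < 0}"
      by (rule convex_halfspace_gt convex_halfspace_lt)+
    moreover have "?X = {m. 0 < (1, 0) \<bullet> m} \<inter> {m. (1, 0) \<bullet> m < 1} \<inter> {m. 0 < (0, 1) \<bullet> m}
        \<inter> {m. (- 1, 1) \<bullet> m < 0}" by (auto simp: inner_prod_def)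
    ultimately show ?thesis by (simp only: convex_Int)
  qed
  then have c: "connected ?X" by (rule convex_connected)
  have "(1/2, 1/4) \<in> ?X" by simp
  then have "?X \<noteq> {}" by blast
  from open_set_dimension[OF o this S _ c]
  show "openin phase_top B14" "connectedin phase_top B14" "has_dimension (subtopology phase_top B14) 2"
    unfolding B14_def by auto
  show "p \<in> B14 \<Longrightarrow> limitin phase_top (\<lambda>t. ricci_dynamics t p) p1 at_bot"
    unfolding B14_def p_eq by (rule limit_in_phase_space[OF lim(1) S]; simp add: equilibria_S_m)
  show "p \<in> B14 \<Longrightarrow> limitin phase_top (\<lambda>t. ricci_dynamics t p) p4 at_top"
    unfolding B14_def p_eq by (rule limit_in_phase_space[OF lim(2) S]; simp add: equilibria_S_m)
qed

lemma B13_facts: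
  shows "openin phase_top B13" "connectedin phase_top B13" "has_dimension (subtopology phase_top B13) 2"
    "p \<in> B13 \<Longrightarrow> limitin phase_top (\<lambda>t. ricci_dynamics t p) p1 at_bot"
    "p \<in> B13 \<Longrightarrow> limitin phase_top (\<lambda>t. ricci_dynamics t p) p3 at_top"
proof -
  have X: "above_separatrix \<in> set planar_pieces" by (simp add: planar_pieces_def)
  note S = planar_pieces_S_m[OF X]
  have B: "B13 = in_phase_space above_separatrix" by (simp add: B13_def separatrix_sides_eq)
  have lim: "((\<lambda>s. planar_flow s m) \<longlongrightarrow> (0, 0)) at_bot" "((\<lambda>s. planar_flow s m) \<longlongrightarrow> (1, 0)) at_top"
    if "m \<in> above_separatrix" for m
    using above_separatrix_limit_bot[OF that] strip_limit_top[of m] that strip_pieces(1) by auto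
  have "(1/2, - (1/4)) \<in> above_separatrix"
    by (intro separatrix_sides_easy) (auto simp: strip_def)
  then have "above_separatrix \<noteq> {}" by blast
  from open_set_dimension[OF open_separatrix_sides(1) this S _ connected_separatrix_sides(1)]
  show "openin phase_top B13" "connectedin phase_top B13" "has_dimension (subtopology phase_top B13) 2"
    unfolding B using strip_pieces(1) by (auto simp: strip_def)
  show "p \<in> B13 \<Longrightarrow> limitin phase_top (\<lambda>t. ricci_dynamics t p) p1 at_bot"
    unfolding B p_eq by (rule limit_in_phase_space[OF lim(1) S]; simp add: equilibria_S_m)
  show "p \<in> B13 \<Longrightarrow> limitin phase_top (\<lambda>t. ricci_dynamics t p) p3 at_top"
    unfolding B p_eq by (rule limit_in_phase_space[OF lim(2) S]; simp add: equilibria_S_m)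
qed

lemma B13'_facts:
  shows "openin phase_top B13'" "connectedin phase_top B13'" "has_dimension (subtopology phase_top B13') 2"
    "p \<in> B13' \<Longrightarrow> limitin phase_top (\<lambda>t. ricci_dynamics t p) p1 at_bot"
    "p \<in> B13' \<Longrightarrow> limitin phase_top (\<lambda>t. ricci_dynamics t p) p3 at_top"
proof -
  have X: "below_separatrix \<in> set planar_pieces" by (simp add: planar_pieces_def)
  note S = planar_pieces_S_m[OF X]
  have B: "B13' = in_phase_space below_separatrix" by (simp add: B13'_def separatrix_sides_eq)
  have lim: "filterlim (\<lambda>s. snd (planar_flow s m)) at_bot at_bot" "((\<lambda>s. planar_flow s m) \<longlongrightarrow> (1, 0)) at_top"
    if "m \<in> below_separatrix" for m
    using below_separatrix_limit_bot[OF that] strip_limit_top[of m] that strip_pieces(2) by auto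
  have "(1/2, - 2) \<in> below_separatrix"
    by (intro separatrix_sides_easy) (auto simp: strip_def)
  then have "below_separatrix \<noteq> {}" by blast
  from open_set_dimension[OF open_separatrix_sides(2) this S _ connected_separatrix_sides(2)]
  show "openin phase_top B13'" "connectedin phase_top B13'" "has_dimension (subtopology phase_top B13') 2"
    unfolding B using strip_pieces(2) by (auto simp: strip_def)
  show "p \<in> B13' \<Longrightarrow> limitin phase_top (\<lambda>t. ricci_dynamics t p) p1 at_bot"
    unfolding B p_eq by (rule limit_infinity_in_phase_space[OF lim(1) S])
  show "p \<in> B13' \<Longrightarrow> limitin phase_top (\<lambda>t. ricci_dynamics t p) p3 at_top"
    unfolding B p_eq by (rule limit_in_phase_space[OF lim(2) S]; simp add: equilibria_S_m)
qed

lemma pieces_partition: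
  "sorted_wrt disjnt (map in_phase_space planar_pieces)"
  "phase_space = \<Union> (set (map in_phase_space planar_pieces))"
  "S \<in> set (map in_phase_space planar_pieces) \<Longrightarrow> ricci_dynamics t ` S = S"
proof -
  show "sorted_wrt disjnt (map in_phase_space planar_pieces)"
    unfolding sorted_wrt_map
    by (rule sorted_wrt_mono_rel[OF _ planar_pieces_disjnt])
      (use in_phase_space_disjnt planar_pieces_subset in blast)
  have "\<Union> (set planar_pieces) = reduced_domain"
    using planar_pieces_cover planar_pieces_subset by blast
  then have "in_phase_space (\<Union> (set planar_pieces)) = phase_space"
    using reduced_domain_surj by simp
  then show "phase_space = \<Union> (set (map in_phase_space planar_pieces))"
    unfolding in_phase_space_image by (simp add: image_Union)
  show "S \<in> set (map in_phase_space planar_pieces) \<Longrightarrow> ricci_dynamics t ` S = S"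
  proof -
    assume "S \<in> set (map in_phase_space planar_pieces)"
    then obtain X where X: "X \<in> set planar_pieces" "S = in_phase_space X" by auto
    show ?thesis unfolding X(2) by (rule ricci_dynamics_image[OF planar_pieces_invariant[OF X(1)]])
  qed
qed

text \<open>A fixed point is an invariant singleton, and the singletons are among the invariant
  pieces.\<close>

lemma equilibria_fixed: "p \<in> {p1, p2, p3, p4} \<Longrightarrow> ricci_dynamics t p = p"
proof -
  assume "p \<in> {p1, p2, p3, p4}"
  then have "{p} \<in> set (map in_phase_space planar_pieces)"
    unfolding pieces_eq[symmetric] by (elim insertE emptyE) simp_all
  from pieces_partition(3)[OF this] show ?thesis by simp
qed

theorem theoremA:
  shows
    "sorted_wrt disjnt ([{p1}, {p2}, {p3}, {p4}] @ [T12, T13, T13', T14, T23, T34] @ [B14, B13, B13'])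
     \<and> phase_space = \<Union> (set ([{p1}, {p2}, {p3}, {p4}] @ [T12, T13, T13', T14, T23, T34] @ [B14, B13, B13']))
     \<and> (\<forall>S \<in> set ([{p1}, {p2}, {p3}, {p4}] @ [T12, T13, T13', T14, T23, T34] @ [B14, B13, B13']).
          \<forall>t. ricci_dynamics t ` S = S)
     \<and> (\<forall>T \<in> {T12, T13, T13', T14, T23, T34}.
          (\<exists>p \<in> phase_space. T = orbit p) \<and> has_dimension (subtopology phase_top T) 1)
     \<and> (\<forall>B \<in> {B14, B13, B13'}.
          openin phase_top B \<and> connectedin phase_top B \<and> has_dimension (subtopology phase_top B) 2)
     \<and> (\<forall>p \<in> {p1, p2, p3, p4}. \<forall>t. ricci_dynamics t p = p)
     \<and> (\<forall>(T, pi, pj) \<in> {(T12, p1, p2), (T13, p1, p3), (T13', p1, p3), (T14, p1, p4), (T23, p2, p3), (T34, p3, p4)}.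
          \<forall>p \<in> T. limitin phase_top (\<lambda>t. ricci_dynamics t p) pi at_bot \<and>
                  limitin phase_top (\<lambda>t. ricci_dynamics t p) pj at_top)
     \<and> (\<forall>(B, pi, pj) \<in> {(B14, p1, p4), (B13, p1, p3), (B13', p1, p3)}.
          \<forall>p \<in> B. limitin phase_top (\<lambda>t. ricci_dynamics t p) pi at_bot \<and>
                  limitin phase_top (\<lambda>t. ricci_dynamics t p) pj at_top)"
  unfolding pieces_eq
  by (intro conjI pieces_partition(1,2) ballI allI pieces_partition(3) equilibria_fixed)
    (auto simp del: One_nat_def simp: T12_facts T13_facts T13'_facts T14_facts T23_facts T34_facts B14_facts B13_facts B13'_facts)

end
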